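(* Let $P$ be a multiobjective combinatorial optimization (MOCO) problem and let the number of objectives $d$ be fixed. If the $\varepsilon$-constraint scalarization of $P$ can be solved in polynomial time, then the Pareto-front $\mathcal{Y}_{\mathrm{N}}$ of instances of $P$ with $d$ objectives can be enumerated in output-polynomial time.
   Context: An instance of a MOCO problem is a pair $(\mathcal{S},C)$ with solution set $\mathcal{S}\subseteq\{0,1\}^n$ and objective matrix $C\in\mathbb{Q}^{d\times n}$; a MOCO problem $P$ is the collection of its instances. The set $\mathcal{S}$ is given implicitly, and the input size of an instance is $n+\langle C\rangle$, where $\langle\cdot\rangle$ denotes binary encoding length. The Pareto-front $\mathcal{Y}_{\mathrm{N}}$ is the set of minimal elements of $\mathcal{Y}=\{Cx\mid x\in\mathcal{S}\}$ with respect to the componentwise order $\le$ on $\mathbb{Q}^d$. With $C_i$ the $i$-th row of $C$, the $\varepsilon$-constraint scalarization of $P$ is the problem: given an instance $(\mathcal{S},C)$ and $\varepsilon\in\mathbb{Q}^d$, solve $$\min\{\mathbf{1}^{T}Cx \mid x\in\mathcal{S},\ C_1x\le\varepsilon_1,\ \dots,\ C_dx\le\varepsilon_d\},$$ where $\mathbf 1$ is the all-ones vector. The model of computation is the Random Access Machine (RAM), with memory cells holding integers of polynomially bounded bit length. An enumeration algorithm for the Pareto-front outputs every element of $\mathcal{Y}_{\mathrm{N}}$ exactly once and terminates after finitely many steps. It runs in output-polynomial time if its total running time is bounded by a polynomial in the input size and $|\mathcal{Y}_{\mathrm{N}}|$. *)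

theory Defs
  imports
    "Jordan_Normal_Form.Matrix"
    "HOL-Computational_Algebra.Polynomial"
    "HOL-Library.Log_Nat"
begin

section \<open>Encoding lengths\<close>

definition int_size :: "int \<Rightarrow> nat" where
  "int_size z = 1 + floorlog 2 (nat \<bar>z\<bar>)"

text \<open>Rationals are written in lowest terms with positive denominator (\<^const>\<open>quotient_of\<close>),
  both for measuring their length and as machine input and output.\<close>

definition rat_code :: "rat \<Rightarrow> int list" where
  "rat_code r = (case quotient_of r of (p, q) \<Rightarrow> [p, q])"

definition rat_size :: "rat \<Rightarrow> nat" where
  "rat_size r = sum_list (map int_size (rat_code r))"

definition vec_code :: "rat vec \<Rightarrow> int list" where
  "vec_code v = concat (map rat_code (list_of_vec v))"

definition vec_size :: "rat vec \<Rightarrow> nat" where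
  "vec_size v = (\<Sum>i<dim_vec v. rat_size (v $ i))"

text \<open>Row-major.\<close>

definition mat_code :: "rat mat \<Rightarrow> int list" where
  "mat_code A = concat (map vec_code (rows A))"

definition mat_size :: "rat mat \<Rightarrow> nat" where
  "mat_size A = (\<Sum>i<dim_row A. \<Sum>j<dim_col A. rat_size (A $$ (i, j)))"

section \<open>Random access machines\<close>

text \<open>
  The memory cells are indexed by the naturals, hold integers and are initially 0. The input is a
  finite list of integers with random access for reading only; it does not count as memory.
  Results are appended to a write-only output list. Each instruction takes one time
  step; this is polynomially equivalent to charging for bit length, because polynomial time
  bounds are only ever used together with polynomial bounds on the bit length of all cells
  (see \<open>ram_outputs\<close>).
\<close>

datatype arith_op = Add | Sub | Mul | Div

fun arith :: "arith_op \<Rightarrow> int \<Rightarrow> int \<Rightarrow> int" where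
  "arith Add x y = x + y"
| "arith Sub x y = x - y"
| "arith Mul x y = x * y"
| "arith Div x y = x div y"

datatype instr =
    Const nat int
  | Arith arith_op nat nat nat
  | Load nat nat
  | Store nat nat
  | Input nat nat
  | Output nat
  | Jump nat
  | JumpPos nat nat
  | Halt

type_synonym ram = "instr list"

text \<open>Program counter, memory, output so far.\<close>

type_synonym config = "nat \<times> (nat \<Rightarrow> int) \<times> int list"

text \<open>Indirect access with a negative address gets stuck, which is different from halting.
  Reading beyond the end of the input yields 0.\<close>

fun exec :: "int list \<Rightarrow> instr \<Rightarrow> config \<Rightarrow> config option" where
  "exec w (Const r c) (pc, m, out) = Some (Suc pc, m(r := c), out)"
| "exec w (Arith f r s t) (pc, m, out) = Some (Suc pc, m(r := arith f (m s) (m t)), out)"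
| "exec w (Load r s) (pc, m, out) =
    (if m s < 0 then None else Some (Suc pc, m(r := m (nat (m s))), out))"
| "exec w (Store r s) (pc, m, out) =
    (if m r < 0 then None else Some (Suc pc, m(nat (m r) := m s), out))"
| "exec w (Input r s) (pc, m, out) =
    (if m s < 0 then None
     else Some (Suc pc, m(r := (if nat (m s) < length w then w ! nat (m s) else 0)), out))"
| "exec w (Output r) (pc, m, out) = Some (Suc pc, m, out @ [m r])"
| "exec w (Jump l) (pc, m, out) = Some (l, m, out)"
| "exec w (JumpPos r l) (pc, m, out) = Some (if m r > 0 then l else Suc pc, m, out)"
| "exec w Halt (pc, m, out) = None"

definition step :: "ram \<Rightarrow> int list \<Rightarrow> config \<Rightarrow> config option" where
  "step M w c = (if fst c < length M then exec w (M ! fst c) c else None)"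

primrec run :: "ram \<Rightarrow> int list \<Rightarrow> nat \<Rightarrow> config option" where
  "run M w 0 = Some (0, \<lambda>_. 0, [])"
| "run M w (Suc t) = Option.bind (run M w t) (step M w)"

text \<open>\<open>ram_outputs M w t b out\<close>: on input \<open>w\<close>, \<open>M\<close> reaches a \<^const>\<open>Halt\<close> instruction after at most
  \<open>t\<close> steps with output \<open>out\<close>, and up to then every memory cell has length at most \<open>b\<close>.\<close>

definition ram_outputs :: "ram \<Rightarrow> int list \<Rightarrow> nat \<Rightarrow> nat \<Rightarrow> int list \<Rightarrow> bool" where
  "ram_outputs M w t b out \<longleftrightarrow>
    (\<exists>k\<le>t. \<exists>pc m. run M w k = Some (pc, m, out) \<and> pc < length M \<and> M ! pc = Halt \<and>
      (\<forall>j\<le>k. \<forall>pc' m' out'. run M w j = Some (pc', m', out') \<longrightarrow> (\<forall>a. int_size (m' a) \<le> b)))"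

section \<open>Multiobjective combinatorial optimization problems\<close>

text \<open>
  As the solution set is given implicitly, an instance \<open>(\<S>, C)\<close> carries, besides \<open>\<S>\<close> and \<open>C\<close>,
  the description of \<open>\<S>\<close> (such as a graph) that is handed to algorithms in place of \<open>\<S>\<close>. How
  descriptions denote solution sets is up to the problem; one set may have several descriptions.
  The description does not contribute to the input size.
\<close>

record moco_instance =
  description :: "int list"
  solutions :: "rat vec set"
  objectives :: "rat mat"

abbreviation num_vars :: "moco_instance \<Rightarrow> nat" where
  "num_vars I \<equiv> dim_col (objectives I)"

abbreviation num_objs :: "moco_instance \<Rightarrow> nat" where
  "num_objs I \<equiv> dim_row (objectives I)"

definition binary_vecs :: "nat \<Rightarrow> rat vec set" where
  "binary_vecs n = {x \<in> carrier_vec n. \<forall>i<n. x $ i \<in> {0, 1}}"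

definition moco_problem :: "moco_instance set \<Rightarrow> bool" where
  "moco_problem P \<longleftrightarrow> (\<forall>I\<in>P. solutions I \<subseteq> binary_vecs (num_vars I))"

definition input_size :: "moco_instance \<Rightarrow> nat" where
  "input_size I = num_vars I + mat_size (objectives I)"

definition outcomes :: "moco_instance \<Rightarrow> rat vec set" where
  "outcomes I = (\<lambda>x. objectives I *\<^sub>v x) ` solutions I"

text \<open>The order on \<^typ>\<open>rat vec\<close> is the componentwise one.\<close>

definition pareto_front :: "moco_instance \<Rightarrow> rat vec set" where
  "pareto_front I = {y \<in> outcomes I. \<not> (\<exists>y'\<in>outcomes I. y' < y)}"

section \<open>The epsilon-constraint scalarization\<close>

definition eps_feasible :: "moco_instance \<Rightarrow> rat vec \<Rightarrow> rat vec set" where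
  "eps_feasible I \<epsilon> =
    {x \<in> solutions I. \<forall>i<num_objs I. row (objectives I) i \<bullet> x \<le> \<epsilon> $ i}"

definition eps_objective :: "moco_instance \<Rightarrow> rat vec \<Rightarrow> rat" where
  "eps_objective I x = vec (num_objs I) (\<lambda>_. 1) \<bullet> (objectives I *\<^sub>v x)"

text \<open>An answer is 0 if the scalarization is infeasible, and otherwise 1 followed by the entries
  of an optimal solution, which are 0 or 1, so that the floor only changes their type.\<close>

definition eps_answer :: "moco_instance \<Rightarrow> rat vec \<Rightarrow> int list \<Rightarrow> bool" where
  "eps_answer I \<epsilon> out \<longleftrightarrow>
    (if eps_feasible I \<epsilon> = {} then out = [0]
     else \<exists>x. is_arg_min (eps_objective I) (\<lambda>x. x \<in> eps_feasible I \<epsilon>) x \<and>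
            out = 1 # map floor (list_of_vec x))"

definition eps_input :: "moco_instance \<Rightarrow> rat vec \<Rightarrow> int list" where
  "eps_input I \<epsilon> =
    [int (num_vars I), int (num_objs I), int (length (description I))]
      @ mat_code (objectives I) @ vec_code \<epsilon> @ description I"

definition eps_constraint_poly_time :: "moco_instance set \<Rightarrow> bool" where
  "eps_constraint_poly_time P \<longleftrightarrow>
    (\<exists>M (p :: nat poly) (q :: nat poly). \<forall>I\<in>P. \<forall>\<epsilon>\<in>carrier_vec (num_objs I).
      let s = input_size I + vec_size \<epsilon> in
      \<exists>out. ram_outputs M (eps_input I \<epsilon>) (poly p s) (poly q s) out \<and> eps_answer I \<epsilon> out)"

section \<open>Enumeration of the Pareto-front\<close>

definition moco_input :: "moco_instance \<Rightarrow> int list" where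
  "moco_input I =
    [int (num_vars I), int (num_objs I), int (length (description I))]
      @ mat_code (objectives I) @ description I"

text \<open>A polynomial in the sum of the input size and the cardinality of the front is as good as one
  in two variables, since only upper bounds matter. The bit length of the cells is bounded in
  terms of the input size alone.\<close>

definition pareto_front_output_poly_time :: "moco_instance set \<Rightarrow> bool" where
  "pareto_front_output_poly_time P \<longleftrightarrow>
    (\<exists>M (p :: nat poly) (q :: nat poly). \<forall>I\<in>P. \<exists>ys.
      ram_outputs M (moco_input I)
        (poly p (input_size I + card (pareto_front I))) (poly q (input_size I))
        (concat (map vec_code ys)) \<and>
      distinct ys \<and> set ys = pareto_front I)"

end

theory Submission
  imports Defs "HOL-Library.Nat_Bijection"
begin

text \<open>
  Multiplying \<open>C\<close> by the product \<open>D\<close> of its denominators makes all objective values integers, so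
  \<open>C\<^sub>i x < y\<^sub>i\<close> can be written as \<open>C\<^sub>i x \<le> y\<^sub>i - 1/D\<close>. An optimal solution of a scalarization is
  nondominated, since dominating points would be feasible and have a smaller sum. Given the \<open>m\<close>
  points found so far, scalarizations are solved for all right-hand sides each of whose entries is
  either strictly below that coordinate of a found point or vacuous. There are \<open>(m + 1)\<^sup>d\<close> of them;
  whenever a new point appears it is printed and the search over the grid restarts. If the whole
  grid yields nothing new, then the front is complete: a missing point \<open>y\<close> would be feasible for
  the right-hand side given in each coordinate by the least found value above \<open>y\<^sub>i\<close>, and the found
  point returned there would dominate \<open>y\<close>.

  On the machine level, the algorithm is written in a small language with expressions, loops and
  arrays and compiled to the random access machine. The machine for the scalarization is interpreted
  by this program. Its memory in the \<open>c\<close>-th call is the \<open>c\<close>-th row of an array addressed by a pairing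
  function, so no clearing between calls is necessary.
\<close>

section \<open>Expressions\<close>

text \<open>Restarting is affordable because only front points are ever listed. With
  \<open>F\<close> front points a pass visits at most \<open>(F + 1) ^ d\<close> grid points and at
  most \<open>F\<close> restarts occur, so for constant \<open>d\<close> the number of calls is
  polynomial in \<open>F\<close>. The program never knows \<open>F\<close>; it occurs only in the
  analysis. The cell lengths, however, must be polynomial in the input size alone, while
  \<open>F\<close> may be exponential. This works since \<open>F\<close> is at most
  \<open>2 ^ n\<close>: all counters, and even the addresses of the rows reserved for the calls,
  have polynomially many bits. The right-hand sides stay short because the product of the
  denominators is no longer than the whole matrix. The description of the solution set may be
  arbitrarily long without contributing to the input size, so it cannot be copied. The simulated
  machine reads its input through an index translation into the real input instead. As memory has to
  be bounded at all times, bounds on stored values are built into the semantics of the language, and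
  time is a clock in its state.\<close>

datatype aexp = Lit int | Var nat | Bin arith_op aexp aexp

primrec aval :: "aexp \<Rightarrow> (nat \<Rightarrow> int) \<Rightarrow> int" where
  "aval (Lit c) v = c"
| "aval (Var x) v = v x"
| "aval (Bin f a b) v = arith f (aval a v) (aval b v)"

primrec leaves :: "aexp \<Rightarrow> nat" where
  "leaves (Lit c) = 1"
| "leaves (Var x) = 1"
| "leaves (Bin f a b) = leaves a + leaves b"

primrec avars :: "aexp \<Rightarrow> nat set" where
  "avars (Lit c) = {}"
| "avars (Var x) = {x}"
| "avars (Bin f a b) = avars a \<union> avars b"

primrec alits :: "aexp \<Rightarrow> int set" where
  "alits (Lit c) = {c}"
| "alits (Var x) = {}"
| "alits (Bin f a b) = alits a \<union> alits b"

lemma leaves_pos: "leaves e \<ge> 1"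
  by (induction e) auto

text \<open>Rounding down moves negative quotients away from zero, but 1 is the extreme positive
  divisor and returns the dividend itself. Negating both operands reduces negative divisors to
  positive ones, and division by 0 gives 0.\<close>

lemma abs_zdiv_le: "\<bar>x div y\<bar> \<le> \<bar>x\<bar>" for x y :: int
proof -
  have pos: "\<bar>u div v\<bar> \<le> \<bar>u\<bar>" if "v > 0" for u v :: int
  proof (cases "u \<ge> 0")
    case True
    then have "0 \<le> u div v" "u div v \<le> u div 1"
      using that by (simp add: pos_imp_zdiv_nonneg_iff, intro zdiv_mono2) auto
    then show ?thesis by simp
  next
    case False
    then have "u div v < 0" "u div 1 \<le> u div v"
      using that by (simp add: pos_imp_zdiv_neg_iff, intro zdiv_mono2_neg) auto
    then show ?thesis by simp
  qed
  show ?thesis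
    using pos[of y x] pos[of "- y" "- x"] by (cases y "0::int" rule: linorder_cases) auto
qed

text \<open>From 2 on, sums are dominated by products, as \<open>(X - 1) * (Y - 1)\<close> is at
  least 1. Hence one multiplicative bound covers all four operations, and the exponent in
  \<open>aval_bound\<close> simply counts leaves.\<close>

lemma abs_arith_le:
  assumes "\<bar>x\<bar> \<le> X" "\<bar>y\<bar> \<le> Y" "2 \<le> X" "2 \<le> Y"
  shows "\<bar>arith f x y\<bar> \<le> X * Y"
proof -
  have a: "X + Y \<le> X * Y"
    using mult_mono[of 1 "X - 1" 1 "Y - 1"] assms by (simp add: algebra_simps)
  have b: "\<bar>x * y\<bar> \<le> X * Y"
    unfolding abs_mult using assms by (intro mult_mono) auto
  note c = abs_zdiv_le[of x y]
  have d: "X \<le> X * Y" using mult_left_mono[of 1 Y X] assms by simp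
  show ?thesis
    using a b c d assms by (cases f) auto
qed

lemma aval_bound:
  assumes "\<forall>x\<in>avars e. \<bar>v x\<bar> \<le> V" "\<forall>c\<in>alits e. \<bar>c\<bar> \<le> V" "2 \<le> V"
  shows "\<bar>aval e v\<bar> \<le> V ^ leaves e"
  using assms
proof (induction e)
  case (Bin f a b)
  have "2 \<le> V ^ leaves e" for e
    using power_increasing[of 1 "leaves e" V] leaves_pos[of e] Bin.prems(3) by simp
  then show ?case
    using Bin by (auto simp: power_add intro!: abs_arith_le)
qed auto

section \<open>Paths of bounded configurations\<close>

definition bounded_mem :: "int \<Rightarrow> (nat \<Rightarrow> int) \<Rightarrow> bool" where
  "bounded_mem B m \<longleftrightarrow> (\<forall>a. \<bar>m a\<bar> \<le> B)"

lemma bounded_mem_upd: "bounded_mem B m \<Longrightarrow> \<bar>v\<bar> \<le> B \<Longrightarrow> bounded_mem B (m(a := v))"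
  by (auto simp: bounded_mem_def)

text \<open>Both endpoints satisfy the memory bound, so paths can be concatenated and, by
  \<open>reach_run\<close>, the bound holds at every moment of a run, as \<open>ram_outputs\<close>
  demands. The start is arbitrary because code fragments are entered in the middle of a
  program.\<close>

inductive reach :: "ram \<Rightarrow> int list \<Rightarrow> int \<Rightarrow> nat \<Rightarrow> config \<Rightarrow> config \<Rightarrow> bool"
  for M w B where
  reach_refl: "bounded_mem B (fst (snd c)) \<Longrightarrow> reach M w B 0 c c"
| reach_step: "bounded_mem B (fst (snd c)) \<Longrightarrow> step M w c = Some c' \<Longrightarrow> reach M w B k c' c'' \<Longrightarrow>
    reach M w B (Suc k) c c''"

lemma reach_trans: "reach M w B k c c' \<Longrightarrow> reach M w B l c' c'' \<Longrightarrow> reach M w B (k + l) c c''"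
  by (induction rule: reach.induct) (auto intro: reach.intros)

lemma reach_single:
  assumes "bounded_mem B (fst (snd c))" "step M w c = Some c'" "bounded_mem B (fst (snd c'))"
  shows "reach M w B 1 c c'"
  using reach_step[OF assms(1,2) reach_refl[OF assms(3)]] by simp

lemma reach_run:
  assumes "reach M w B k c c'" "run M w j = Some c"
  shows "run M w (j + k) = Some c' \<and>
    (\<forall>i. j \<le> i \<longrightarrow> i \<le> j + k \<longrightarrow> (\<exists>ci. run M w i = Some ci \<and> bounded_mem B (fst (snd ci))))"
  using assms
proof (induction arbitrary: j rule: reach.induct)
  case (reach_refl c)
  then show ?case by auto
next
  case (reach_step c c' k c'')
  have "run M w (Suc j) = Some c'"
    using reach_step by simp
  from reach_step.IH[OF this] show ?case
    using reach_step.prems reach_step.hyps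
    by (metis add_Suc_right add_Suc_shift le_antisym not_less_eq_eq)
qed

section \<open>Code fragments placed inside a program\<close>

definition code_at :: "ram \<Rightarrow> nat \<Rightarrow> instr list \<Rightarrow> bool" where
  "code_at M p is \<longleftrightarrow> (\<forall>i<length is. p + i < length M \<and> M ! (p + i) = is ! i)"

lemma code_at_append:
  "code_at M p (xs @ ys) \<longleftrightarrow> code_at M p xs \<and> code_at M (p + length xs) ys"
proof
  assume a: "code_at M p (xs @ ys)"
  have "p + i < length M \<and> M ! (p + i) = xs ! i" if "i < length xs" for i
    using a that unfolding code_at_def by (auto simp: nth_append dest!: spec[of _ i])
  moreover have "p + length xs + i < length M \<and> M ! (p + length xs + i) = ys ! i" if "i < length ys" for i
    using a that unfolding code_at_def by (auto simp: nth_append add.assoc dest!: spec[of _ "length xs + i"])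
  ultimately show "code_at M p xs \<and> code_at M (p + length xs) ys"
    unfolding code_at_def by auto
next
  assume a: "code_at M p xs \<and> code_at M (p + length xs) ys"
  show "code_at M p (xs @ ys)"
    unfolding code_at_def
  proof (intro allI impI)
    fix i assume i: "i < length (xs @ ys)"
    show "p + i < length M \<and> M ! (p + i) = (xs @ ys) ! i"
    proof (cases "i < length xs")
      case True
      then show ?thesis using a by (auto simp: code_at_def nth_append)
    next
      case False
      then have "i = length xs + (i - length xs)" "i - length xs < length ys" using i by auto
      then show ?thesis using a False unfolding code_at_def
        by (metis add.assoc nth_append_length_plus)
    qed
  qed
qed

lemma code_at_Cons:
  "code_at M p (x # xs) \<longleftrightarrow> p < length M \<and> M ! p = x \<and> code_at M (Suc p) xs"
  using code_at_append[of M p "[x]" xs] by (auto simp: code_at_def)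

lemma code_at_Nil [simp]: "code_at M p []"
  by (simp add: code_at_def)

lemma reach_instr:
  assumes "code_at M p [ins]" "bounded_mem B m" "exec w ins (p, m, out) = Some (p', m', out')"
    and "bounded_mem B m'"
  shows "reach M w B 1 (p, m, out) (p', m', out')"
  by (rule reach_single) (use assms in \<open>auto simp: step_def code_at_Cons\<close>)

text \<open>The result is left in cell \<open>k\<close>; only cells from \<open>k\<close> on are overwritten.\<close>

primrec cexp :: "nat \<Rightarrow> aexp \<Rightarrow> instr list" where
  "cexp k (Lit c) = [Const k c]"
| "cexp k (Var x) = [Const k 0, Arith Add k x k]"
| "cexp k (Bin f a b) = cexp k a @ cexp (Suc k) b @ [Arith f k k (Suc k)]"

text \<open>No instruction copies a cell, so a variable is fetched by adding it to 0. In a binary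
  operation the first result waits in cell \<open>k\<close>, which the second evaluation, started at
  \<open>Suc k\<close>, leaves alone; variables are safe because their cells lie below
  \<open>k\<close>.\<close>

lemma cexp_reach:
  assumes "code_at M p (cexp k e)" "\<forall>x\<in>avars e. x < k" "bounded_mem B m"
    and "\<forall>x\<in>avars e. \<bar>m x\<bar> \<le> V" "\<forall>c\<in>alits e. \<bar>c\<bar> \<le> V" "2 \<le> V" "V ^ leaves e \<le> B"
  shows "\<exists>m'. reach M w B (length (cexp k e)) (p, m, out) (p + length (cexp k e), m', out) \<and>
    bounded_mem B m' \<and> m' k = aval e m \<and> (\<forall>r. r < k \<or> r \<ge> k + leaves e \<longrightarrow> m' r = m r)"
  using assms
proof (induction e arbitrary: p k m)
  case (Lit c)
  then have b: "bounded_mem B (m(k := c))"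
    by (intro bounded_mem_upd) auto
  have "reach M w B 1 (p, m, out) (Suc p, m(k := c), out)"
    by (rule reach_instr[where ins = "Const k c"]) (use Lit b in auto)
  then show ?case using b by (intro exI[of _ "m(k := c)"]) (auto simp: fun_upd_same fun_upd_other simp del: fun_upd_apply)
next
  case (Var x)
  let ?m1 = "m(k := 0)" and ?m2 = "m(k := m x)"
  have B: "0 \<le> B" using Var.prems(3) unfolding bounded_mem_def by (meson abs_ge_zero order_trans)
  have b1: "bounded_mem B ?m1" using Var B by (intro bounded_mem_upd) auto
  have b2: "bounded_mem B ?m2" using Var by (intro bounded_mem_upd) (auto simp: bounded_mem_def)
  have "reach M w B 1 (p, m, out) (Suc p, ?m1, out)"
    by (rule reach_instr[where ins = "Const k 0"]) (use Var b1 in \<open>auto simp: code_at_Cons\<close>)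
  moreover have "reach M w B 1 (Suc p, ?m1, out) (Suc (Suc p), ?m2, out)"
    by (rule reach_instr[where ins = "Arith Add k x k"]) (use Var b1 b2 in \<open>auto simp: code_at_Cons\<close>)
  ultimately have "reach M w B (1 + 1) (p, m, out) (Suc (Suc p), ?m2, out)"
    by (rule reach_trans)
  then show ?case using b2
    by (intro exI[of _ ?m2]) (simp del: fun_upd_apply add: fun_upd_same fun_upd_other)
next
  case (Bin f a b)
  let ?la = "length (cexp k a)" and ?lb = "length (cexp (Suc k) b)"
  have V: "V ^ leaves a \<le> V ^ leaves (Bin f a b)" "V ^ leaves b \<le> V ^ leaves (Bin f a b)"
    using Bin.prems(6) by (auto intro!: power_increasing)
  obtain m1 where m1: "reach M w B ?la (p, m, out) (p + ?la, m1, out)" "bounded_mem B m1"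
      "m1 k = aval a m" "\<forall>r. r < k \<or> r \<ge> k + leaves a \<longrightarrow> m1 r = m r"
    using Bin.IH(1)[of p k m] Bin.prems V by (auto simp: code_at_append)
  have eqb: "\<forall>x\<in>avars b. m1 x = m x" using m1(4) Bin.prems(2) by auto
  have avb: "aval b m1 = aval b m"
    using eqb by (induction b) auto
  have cb: "code_at M (p + ?la) (cexp (Suc k) b)" using Bin.prems(1) by (simp add: code_at_append)
  have vb: "\<forall>x\<in>avars b. x < Suc k" using Bin.prems(2) by (auto simp: less_Suc_eq)
  have bb: "\<forall>x\<in>avars b. \<bar>m1 x\<bar> \<le> V" using Bin.prems(4) eqb by auto
  have lb: "\<forall>c\<in>alits b. \<bar>c\<bar> \<le> V" using Bin.prems(5) by auto
  obtain m2 where m2: "reach M w B ?lb (p + ?la, m1, out) (p + ?la + ?lb, m2, out)" "bounded_mem B m2"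
      "m2 (Suc k) = aval b m1" "\<forall>r. r < Suc k \<or> r \<ge> Suc k + leaves b \<longrightarrow> m2 r = m1 r"
    using Bin.IH(2)[OF cb vb m1(2) bb lb Bin.prems(6) order_trans[OF V(2) Bin.prems(7)]] by blast
  let ?v = "arith f (aval a m) (aval b m)" 
  let ?m3 = "m2(k := ?v)"
  have "\<bar>aval (Bin f a b) m\<bar> \<le> V ^ leaves (Bin f a b)"
    using Bin.prems by (intro aval_bound) auto
  then have b3: "bounded_mem B ?m3"
    using Bin.prems(7) by (intro bounded_mem_upd m2(2)) auto
  have k: "m2 k = aval a m" using m1(3) m2(4) by simp
  have "reach M w B 1 (p + ?la + ?lb, m2, out) (Suc (p + ?la + ?lb), ?m3, out)"
    by (rule reach_instr[where ins = "Arith f k k (Suc k)"])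
      (use Bin.prems(1) b3 m2 avb k in \<open>auto simp: code_at_append ac_simps\<close>)
  then have "reach M w B (?la + (?lb + 1)) (p, m, out) (Suc (p + ?la + ?lb), ?m3, out)"
    using reach_trans[OF m1(1) reach_trans[OF m2(1)]] by blast
  moreover have "\<forall>r. r < k \<or> r \<ge> k + leaves (Bin f a b) \<longrightarrow> ?m3 r = m r"
    using m1(4) m2(4) leaves_pos[of a] by auto
  ultimately show ?case using b3 by (intro exI[of _ ?m3]) (simp add: ac_simps fun_upd_same del: fun_upd_apply)
qed

section \<open>A structured language\<close>

datatype com =
    Skip
  | Assign nat aexp
  | Fetch nat nat aexp aexp
  | Put nat aexp aexp aexp
  | Read nat aexp
  | Emit aexp
  | Seq com com
  | Cond aexp com com
  | Loop aexp com

text \<open>The clock \<open>tm\<close> counts executed commands; a command costs boundedly many machine steps. In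
  \<open>ar\<close>, the first index is the name of a two-dimensional array.\<close>

record st =
  vs :: "nat \<Rightarrow> int"
  ar :: "nat \<Rightarrow> nat \<Rightarrow> nat \<Rightarrow> int"
  ou :: "int list"
  tm :: nat

definition arr_upd :: "(nat \<Rightarrow> nat \<Rightarrow> nat \<Rightarrow> int) \<Rightarrow> nat \<Rightarrow> nat \<Rightarrow> nat \<Rightarrow> int \<Rightarrow> nat \<Rightarrow> nat \<Rightarrow> nat \<Rightarrow> int" where
  "arr_upd h a i j z = (\<lambda>a' i' j'. if a' = a \<and> i' = i \<and> j' = j then z else h a' i' j')"

definition read_input :: "int list \<Rightarrow> nat \<Rightarrow> int" where
  "read_input w i = (if i < length w then w ! i else 0)"

text \<open>All values that are stored in variables and arrays are required to be at most \<open>V\<close> in absolute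
  value. Intermediate results of expressions are not restricted: an expression with \<open>l\<close> leaves
  does not exceed \<open>V ^ l\<close>, which only multiplies the bit length by a constant.\<close>

inductive bs :: "int list \<Rightarrow> int \<Rightarrow> com \<Rightarrow> st \<Rightarrow> st \<Rightarrow> bool" for w V where
  bs_Skip: "bs w V Skip s s"
| bs_Assign: "\<bar>aval e (vs s)\<bar> \<le> V \<Longrightarrow>
    bs w V (Assign x e) s (s\<lparr>vs := (vs s)(x := aval e (vs s)), tm := tm s + 1\<rparr>)"
| bs_Fetch: "0 \<le> aval e (vs s) \<Longrightarrow> 0 \<le> aval f (vs s) \<Longrightarrow>
    bs w V (Fetch x a e f) s
      (s\<lparr>vs := (vs s)(x := ar s a (nat (aval e (vs s))) (nat (aval f (vs s)))), tm := tm s + 1\<rparr>)"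
| bs_Put: "0 \<le> aval e (vs s) \<Longrightarrow> 0 \<le> aval f (vs s) \<Longrightarrow> \<bar>aval g (vs s)\<bar> \<le> V \<Longrightarrow>
    bs w V (Put a e f g) s
      (s\<lparr>ar := arr_upd (ar s) a (nat (aval e (vs s))) (nat (aval f (vs s))) (aval g (vs s)),
        tm := tm s + 1\<rparr>)"
| bs_Read: "0 \<le> aval e (vs s) \<Longrightarrow> \<bar>read_input w (nat (aval e (vs s)))\<bar> \<le> V \<Longrightarrow>
    bs w V (Read x e) s
      (s\<lparr>vs := (vs s)(x := read_input w (nat (aval e (vs s)))), tm := tm s + 1\<rparr>)"
| bs_Emit: "bs w V (Emit e) s (s\<lparr>ou := ou s @ [aval e (vs s)], tm := tm s + 1\<rparr>)"
| bs_Seq: "bs w V c s s' \<Longrightarrow> bs w V d s' s'' \<Longrightarrow> bs w V (Seq c d) s s''"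
| bs_CondT: "aval e (vs s) > 0 \<Longrightarrow> bs w V c (s\<lparr>tm := tm s + 1\<rparr>) s' \<Longrightarrow> bs w V (Cond e c d) s s'"
| bs_CondF: "\<not> aval e (vs s) > 0 \<Longrightarrow> bs w V d (s\<lparr>tm := tm s + 1\<rparr>) s' \<Longrightarrow> bs w V (Cond e c d) s s'"
| bs_LoopT: "aval e (vs s) > 0 \<Longrightarrow> bs w V c (s\<lparr>tm := tm s + 1\<rparr>) s' \<Longrightarrow> bs w V (Loop e c) s' s'' \<Longrightarrow>
    bs w V (Loop e c) s s''"
| bs_LoopF: "\<not> aval e (vs s) > 0 \<Longrightarrow> bs w V (Loop e c) s (s\<lparr>tm := tm s + 1\<rparr>)"

section \<open>Arrays inside the linear memory\<close>

text \<open>\<^const>\<open>prod_encode\<close> as an expression.\<close>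

definition pair_exp :: "aexp \<Rightarrow> aexp \<Rightarrow> aexp" where
  "pair_exp a b = Bin Add (Bin Div (Bin Mul (Bin Add a b) (Bin Add (Bin Add a b) (Lit 1))) (Lit 2)) a"

definition addr :: "nat \<Rightarrow> nat \<Rightarrow> aexp \<Rightarrow> aexp \<Rightarrow> aexp" where
  "addr H a e f = Bin Add (Lit (int H)) (pair_exp (Lit (int a)) (pair_exp e f))"

definition loc :: "nat \<Rightarrow> nat \<Rightarrow> nat \<Rightarrow> nat \<Rightarrow> nat" where
  "loc H a i j = H + prod_encode (a, prod_encode (i, j))"

lemma aval_pair_exp:
  assumes "0 \<le> aval e v" "0 \<le> aval f v"
  shows "aval (pair_exp e f) v = int (prod_encode (nat (aval e v), nat (aval f v)))"
proof -
  obtain i j where "aval e v = int i" "aval f v = int j" using assms by (metis nonneg_int_cases)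
  then show ?thesis
    by (simp add: pair_exp_def prod_encode_def triangle_def zdiv_int ring_distribs ac_simps)
qed

lemma aval_addr:
  assumes "0 \<le> aval e v" "0 \<le> aval f v"
  shows "aval (addr H a e f) v = int (loc H a (nat (aval e v)) (nat (aval f v)))"
  using aval_pair_exp[of "Lit (int a)" v "pair_exp e f"] aval_pair_exp[OF assms]
  by (simp add: addr_def loc_def)

lemma avars_addr [simp]: "avars (addr H a e f) = avars e \<union> avars f"
  by (auto simp: addr_def pair_exp_def)

lemma alits_addr: "alits (addr H a e f) = {int H, int a, 1, 2} \<union> alits e \<union> alits f"
  by (auto simp: addr_def pair_exp_def)

lemma leaves_addr: "leaves (addr H a e f) = leaves (addr 0 a e f)"
  by (simp add: addr_def pair_exp_def)

lemma loc_ge: "loc H a i j \<ge> H" by (simp add: loc_def)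

lemma loc_eq: "loc H a i j = loc H a' i' j' \<longleftrightarrow> a = a' \<and> i = i' \<and> j = j'"
  by (auto simp: loc_def)

text \<open>Jumps are absolute, so the start address \<open>p\<close> is a parameter. Cells below
  \<open>N\<close> hold the variables, those from \<open>N\<close> up to \<open>H\<close> are
  scratch space, and arrays live from \<open>H\<close> on. The machine jumps on positive values,
  whence the negative branch of a conditional comes first.\<close>

primrec compile :: "nat \<Rightarrow> nat \<Rightarrow> nat \<Rightarrow> com \<Rightarrow> instr list" where
  "compile N H p Skip = []"
| "compile N H p (Assign x e) = cexp N e @ [Const x 0, Arith Add x N x]"
| "compile N H p (Fetch x a e f) = cexp N (addr H a e f) @ [Load x N]"
| "compile N H p (Put a e f g) = cexp N (addr H a e f) @ cexp (Suc N) g @ [Store N (Suc N)]"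
| "compile N H p (Read x e) = cexp N e @ [Input x N]"
| "compile N H p (Emit e) = cexp N e @ [Output N]"
| "compile N H p (Seq c d) = (let cc = compile N H p c in cc @ compile N H (p + length cc) d)"
| "compile N H p (Cond e c d) =
    (let ce = cexp N e; p1 = p + length ce + 1; cd = compile N H p1 d; p2 = p1 + length cd + 1;
       cc = compile N H p2 c
     in ce @ [JumpPos N p2] @ cd @ [Jump (p2 + length cc)] @ cc)"
| "compile N H p (Loop e c) =
    (let ce = cexp N e; p1 = p + length ce + 2; cc = compile N H p1 c
     in ce @ [JumpPos N p1, Jump (p1 + length cc + 1)] @ cc @ [Jump p])"

primrec cvars :: "com \<Rightarrow> nat set" where
  "cvars Skip = {}"
| "cvars (Assign x e) = {x} \<union> avars e"
| "cvars (Fetch x a e f) = {x} \<union> avars e \<union> avars f"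
| "cvars (Put a e f g) = avars e \<union> avars f \<union> avars g"
| "cvars (Read x e) = {x} \<union> avars e"
| "cvars (Emit e) = avars e"
| "cvars (Seq c d) = cvars c \<union> cvars d"
| "cvars (Cond e c d) = avars e \<union> cvars c \<union> cvars d"
| "cvars (Loop e c) = avars e \<union> cvars c"

text \<open>Addresses enter with offset 0 in place of \<open>H\<close>: the offset depends on
  \<open>room\<close> of the whole command and is bounded separately in
  \<open>compile_correct\<close>.\<close>

primrec clits :: "com \<Rightarrow> int set" where
  "clits Skip = {}"
| "clits (Assign x e) = alits e"
| "clits (Fetch x a e f) = alits (addr 0 a e f)"
| "clits (Put a e f g) = alits (addr 0 a e f) \<union> alits g"
| "clits (Read x e) = alits e"
| "clits (Emit e) = alits e"
| "clits (Seq c d) = clits c \<union> clits d"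
| "clits (Cond e c d) = alits e \<union> clits c \<union> clits d"
| "clits (Loop e c) = alits e \<union> clits c"

text \<open>Plays two roles: it bounds the scratch cells in use and, as \<open>V ^ room c\<close>,
  all intermediate values. The extra 1 for \<open>Put\<close> is the cell keeping the address while
  the stored value is computed.\<close>

primrec room :: "com \<Rightarrow> nat" where
  "room Skip = 0"
| "room (Assign x e) = leaves e"
| "room (Fetch x a e f) = leaves (addr 0 a e f)"
| "room (Put a e f g) = leaves (addr 0 a e f) + leaves g + 1"
| "room (Read x e) = leaves e"
| "room (Emit e) = leaves e"
| "room (Seq c d) = room c + room d"
| "room (Cond e c d) = leaves e + room c + room d"
| "room (Loop e c) = leaves e + room c"

lemma finite_cvars: "finite (cvars c)"
proof -
  have "finite (avars e)" for e by (induction e) auto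
  then show ?thesis by (induction c) auto
qed

lemma finite_clits: "finite (clits c)"
proof -
  have "finite (alits e)" for e by (induction e) auto
  then show ?thesis by (induction c) auto
qed

section \<open>Correctness of the compiler\<close>

definition bounded_st :: "int \<Rightarrow> st \<Rightarrow> bool" where
  "bounded_st V s \<longleftrightarrow> (\<forall>x. \<bar>vs s x\<bar> \<le> V) \<and> (\<forall>a i j. \<bar>ar s a i j\<bar> \<le> V)"

definition repr :: "nat \<Rightarrow> nat \<Rightarrow> st \<Rightarrow> (nat \<Rightarrow> int) \<Rightarrow> bool" where
  "repr N H s m \<longleftrightarrow> (\<forall>x<N. m x = vs s x) \<and> (\<forall>a i j. m (loc H a i j) = ar s a i j)"

lemma aval_cong: "\<forall>x\<in>avars e. v x = v' x \<Longrightarrow> aval e v = aval e v'"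
  by (induction e) auto

lemma bs_tm: "bs w V c s s' \<Longrightarrow> tm s \<le> tm s'"
  by (induction rule: bs.induct) auto

lemma bs_bounded: "bs w V c s s' \<Longrightarrow> bounded_st V s \<Longrightarrow> bounded_st V s'"
  by (induction rule: bs.induct) (auto simp: bounded_st_def arr_upd_def)

lemma cexp_repr:
  assumes "code_at M p (cexp k e)" "avars e \<subseteq> {..<N}" "N \<le> k" "k + leaves e \<le> H"
    and "bounded_mem B m" "repr N H s m" "bounded_st V s" "\<forall>c\<in>alits e. \<bar>c\<bar> \<le> V" "2 \<le> V" "V ^ leaves e \<le> B"
  shows "\<exists>m'. reach M w B (length (cexp k e)) (p, m, out) (p + length (cexp k e), m', out) \<and>
    bounded_mem B m' \<and> repr N H s m' \<and> m' k = aval e (vs s) \<and> (\<forall>r<k. m' r = m r)"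
proof -
  have eq: "\<forall>x\<in>avars e. m x = vs s x" using assms by (auto simp: repr_def)
  have "\<forall>x\<in>avars e. \<bar>m x\<bar> \<le> V" using eq assms(7) by (auto simp: bounded_st_def)
  then obtain m' where m': "reach M w B (length (cexp k e)) (p, m, out) (p + length (cexp k e), m', out)"
     "bounded_mem B m'" "m' k = aval e m" "\<forall>r. r < k \<or> r \<ge> k + leaves e \<longrightarrow> m' r = m r"
    using cexp_reach[of M p k e B m V w out] assms by fastforce
  have "repr N H s m'"
    unfolding repr_def
  proof (intro conjI allI impI)
    fix x assume "x < N" then show "m' x = vs s x" using m'(4) assms(3,6) by (auto simp: repr_def)
  next
    fix a i j
    have "loc H a i j \<ge> k + leaves e" using loc_ge[of H a i j] assms(4) by linarith
    then show "m' (loc H a i j) = ar s a i j" using m'(4) assms(6) by (auto simp: repr_def)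
  qed
  then show ?thesis using m' aval_cong[OF eq] by (intro exI[of _ m']) auto
qed


lemma loc_neq: "r < H \<Longrightarrow> loc H a i j \<noteq> r"
  using loc_ge[of H a i j] by auto

lemma repr_reg: "N \<le> H \<Longrightarrow> x < N \<Longrightarrow> repr N H s m \<Longrightarrow> repr N H (s\<lparr>vs := (vs s)(x := v), tm := t\<rparr>) (m(x := v))"
  by (simp add: repr_def loc_neq)

lemma repr_arr: "N \<le> H \<Longrightarrow> repr N H s m \<Longrightarrow>
    repr N H (s\<lparr>ar := arr_upd (ar s) a i j v, tm := t\<rparr>) (m(loc H a i j := v))"
  using loc_ge[of H a i j] by (simp add: repr_def arr_upd_def loc_eq)

lemma repr_tm: "repr N H (s\<lparr>tm := t\<rparr>) m = repr N H s m" "repr N H (s\<lparr>ou := x\<rparr>) m = repr N H s m"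
  by (auto simp: repr_def)

lemma bounded_st_tm: "bounded_st V (s\<lparr>tm := t\<rparr>) = bounded_st V s"
  by (auto simp: bounded_st_def)

lemma power_room:
  assumes "2 \<le> (V::int)" "V ^ k \<le> B" "l \<le> k"
  shows "V ^ l \<le> B"
  using power_increasing[OF assms(3), of V] assms by linarith

text \<open>The induction follows the execution, since a loop re-enters its own code. Each tick of
  the clock pays for one expression, or the two of a \<open>Put\<close>, and a few jumps or
  transfers. \<open>K\<close> exceeds the length of the outermost code, hence that of every part, so
  the same factor survives nesting.\<close>

theorem compile_correct:
  assumes "bs w V c s s'" and "code_at M p (compile N H p c)" and "cvars c \<subseteq> {..<N}"
    and "N + room c \<le> H" and "2 \<le> V" and "V ^ room c \<le> B" and "V \<le> B"
    and "\<forall>z\<in>clits c. \<bar>z\<bar> \<le> V" and "int H \<le> V"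
    and "repr N H s m" and "bounded_st V s" and "bounded_mem B m"
    and "length (compile N H p c) + 3 \<le> K"
  shows "\<exists>k m'. k \<le> K * (tm s' - tm s) \<and>
    reach M w B k (p, m, ou s) (p + length (compile N H p c), m', ou s') \<and>
    repr N H s' m' \<and> bounded_mem B m'"
  using assms
proof (induction arbitrary: p m rule: bs.induct)
  case (bs_Skip s)
  then show ?case by (auto intro!: exI[of _ m] reach_refl)
next
  case (bs_Assign e s x)
  obtain m1 where m1: "reach M w B (length (cexp N e)) (p, m, ou s) (p + length (cexp N e), m1, ou s)"
      "bounded_mem B m1" "repr N H s m1" "m1 N = aval e (vs s)"
    using cexp_repr[of M p N e N H B m s V w "ou s"] bs_Assign by (auto simp: code_at_append)
  have x: "x < N" using bs_Assign by auto
  let ?p = "p + length (cexp N e)" and ?m2 = "m1(x := 0)" and ?m3 = "m1(x := aval e (vs s))"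
  have b2: "bounded_mem B ?m2" using m1(2) bs_Assign.prems by (intro bounded_mem_upd) auto
  have b3: "bounded_mem B ?m3" using m1(2) bs_Assign.prems bs_Assign.hyps by (intro bounded_mem_upd) auto
  have r1: "reach M w B 1 (?p, m1, ou s) (Suc ?p, ?m2, ou s)"
    by (rule reach_instr[where ins = "Const x 0"]) (use bs_Assign.prems m1 b2 in \<open>auto simp: code_at_append code_at_Cons\<close>)
  have r2: "reach M w B 1 (Suc ?p, ?m2, ou s) (Suc (Suc ?p), ?m3, ou s)"
    by (rule reach_instr[where ins = "Arith Add x N x"])
       (use bs_Assign.prems m1 b2 b3 x in \<open>auto simp: code_at_append code_at_Cons\<close>)
  show ?case
    using reach_trans[OF reach_trans[OF m1(1) r1] r2] repr_reg[OF _ x m1(3), where t = "tm s + 1"] b3 bs_Assign.prems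
    by (intro exI[of _ "length (cexp N e) + 1 + 1"] exI[of _ ?m3]) (auto simp del: fun_upd_apply)
next
  case (bs_Fetch e s f x a)
  let ?e = "addr H a e f" and ?l = "loc H a (nat (aval e (vs s))) (nat (aval f (vs s)))"
  obtain m1 where m1: "reach M w B (length (cexp N ?e)) (p, m, ou s) (p + length (cexp N ?e), m1, ou s)"
      "bounded_mem B m1" "repr N H s m1" "m1 N = aval ?e (vs s)"
    using cexp_repr[of M p N ?e N H B m s V w "ou s"] bs_Fetch
    by (auto simp: code_at_append alits_addr leaves_addr[of H])
  have x: "x < N" using bs_Fetch by auto
  have ad: "m1 N = int ?l" using aval_addr[OF bs_Fetch.hyps] m1(4) by simp
  have v: "m1 ?l = ar s a (nat (aval e (vs s))) (nat (aval f (vs s)))" using m1(3) by (auto simp: repr_def)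
  let ?p = "p + length (cexp N ?e)" and ?m2 = "m1(x := m1 ?l)"
  have b2: "bounded_mem B ?m2" using m1(2) by (auto simp: bounded_mem_def)
  have r1: "reach M w B 1 (?p, m1, ou s) (Suc ?p, ?m2, ou s)"
    by (rule reach_instr[where ins = "Load x N"]) (use bs_Fetch.prems m1(1,2) b2 ad in \<open>auto simp: code_at_append code_at_Cons\<close>)
  show ?case
    using reach_trans[OF m1(1) r1] repr_reg[OF _ x m1(3), where t = "tm s + 1"] b2 bs_Fetch.prems v
    by (intro exI[of _ "length (cexp N ?e) + 1"] exI[of _ ?m2]) (auto simp del: fun_upd_apply)
next
  case (bs_Put e s f g a)
  let ?e = "addr H a e f" and ?l = "loc H a (nat (aval e (vs s))) (nat (aval f (vs s)))"
  have pw: "V ^ leaves ?e \<le> B" "V ^ leaves g \<le> B"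
    by (rule power_room[OF bs_Put.prems(4,5)], simp add: leaves_addr[of H])+
  obtain m1 where m1: "reach M w B (length (cexp N ?e)) (p, m, ou s) (p + length (cexp N ?e), m1, ou s)"
      "bounded_mem B m1" "repr N H s m1" "m1 N = aval ?e (vs s)"
    using cexp_repr[of M p N ?e N H B m s V w "ou s"] bs_Put pw
    by (auto simp: code_at_append alits_addr leaves_addr[of H])
  let ?p = "p + length (cexp N ?e)"
  let ?q = "?p + length (cexp (Suc N) g)"
  have cg: "code_at M ?p (cexp (Suc N) g)" and vg: "avars g \<subseteq> {..<N}" and rg: "Suc N + leaves g \<le> H"
    and lg: "\<forall>c\<in>alits g. \<bar>c\<bar> \<le> V"
    using bs_Put.prems(1,2,3,7) by (simp_all add: code_at_append)
  obtain m2 where m2: "reach M w B (length (cexp (Suc N) g)) (?p, m1, ou s) (?q, m2, ou s)"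
      "bounded_mem B m2" "repr N H s m2" "m2 (Suc N) = aval g (vs s)" "\<forall>r<Suc N. m2 r = m1 r"
    using cexp_repr[where w = w and out = "ou s", OF cg vg _ rg m1(2,3) bs_Put.prems(10) lg bs_Put.prems(4) pw(2)] by auto
  have ad: "m2 N = int ?l" using aval_addr[OF bs_Put.hyps(1,2)] m1(4) m2(5) by simp
  let ?m3 = "m2(?l := aval g (vs s))"
  have b3: "bounded_mem B ?m3" using m2(2) bs_Put.prems bs_Put.hyps by (intro bounded_mem_upd) auto
  have r1: "reach M w B 1 (?q, m2, ou s) (Suc ?q, ?m3, ou s)"
    by (rule reach_instr[where ins = "Store N (Suc N)"])
       (use bs_Put.prems m2(1,2,4) b3 ad in \<open>auto simp: code_at_append code_at_Cons add.assoc\<close>)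
  show ?case
    using reach_trans[OF reach_trans[OF m1(1) m2(1)] r1] repr_arr[OF _ m2(3), where t = "tm s + 1"] b3 bs_Put.prems
    by (intro exI[of _ "length (cexp N ?e) + length (cexp (Suc N) g) + 1"] exI[of _ ?m3])
      (auto simp del: fun_upd_apply simp: add.assoc)
next
  case (bs_Read e s x)
  let ?v = "read_input w (nat (aval e (vs s)))"
  obtain m1 where m1: "reach M w B (length (cexp N e)) (p, m, ou s) (p + length (cexp N e), m1, ou s)"
      "bounded_mem B m1" "repr N H s m1" "m1 N = aval e (vs s)"
    using cexp_repr[of M p N e N H B m s V w "ou s"] bs_Read by (auto simp: code_at_append)
  have x: "x < N" using bs_Read by auto
  let ?p = "p + length (cexp N e)" and ?m2 = "m1(x := ?v)"
  have b2: "bounded_mem B ?m2" using m1(2) bs_Read.prems bs_Read.hyps by (intro bounded_mem_upd) auto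
  have r1: "reach M w B 1 (?p, m1, ou s) (Suc ?p, ?m2, ou s)"
    by (rule reach_instr[where ins = "Input x N"])
       (use bs_Read m1 b2 in \<open>auto simp: code_at_append code_at_Cons read_input_def\<close>)
  show ?case
    using reach_trans[OF m1(1) r1] repr_reg[OF _ x m1(3), where t = "tm s + 1"] b2 bs_Read.prems
    by (intro exI[of _ "length (cexp N e) + 1"] exI[of _ ?m2]) (auto simp del: fun_upd_apply)
next
  case (bs_Emit e s)
  obtain m1 where m1: "reach M w B (length (cexp N e)) (p, m, ou s) (p + length (cexp N e), m1, ou s)"
      "bounded_mem B m1" "repr N H s m1" "m1 N = aval e (vs s)"
    using cexp_repr[of M p N e N H B m s V w "ou s"] bs_Emit by (auto simp: code_at_append)
  let ?p = "p + length (cexp N e)"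
  have r1: "reach M w B 1 (?p, m1, ou s) (Suc ?p, m1, ou s @ [aval e (vs s)])"
    by (rule reach_instr[where ins = "Output N"])
       (use bs_Emit m1 in \<open>auto simp: code_at_append code_at_Cons\<close>)
  show ?case
    using reach_trans[OF m1(1) r1] m1 bs_Emit.prems
    by (intro exI[of _ "length (cexp N e) + 1"] exI[of _ m1]) (auto simp: repr_def)
next
  case (bs_Seq c s s' d s'')
  let ?lc = "length (compile N H p c)"
  have pw: "V ^ room c \<le> B" "V ^ room d \<le> B"
    by (rule power_room[OF bs_Seq.prems(4,5)], simp add: leaves_addr[of H])+
  have bd: "bounded_st V s'" using bs_bounded bs_Seq by blast
  obtain k1 m1 where m1: "k1 \<le> K * (tm s' - tm s)" "reach M w B k1 (p, m, ou s) (p + ?lc, m1, ou s')"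
      "repr N H s' m1" "bounded_mem B m1"
    using bs_Seq.IH(1)[of p m] bs_Seq.prems pw by (auto simp: code_at_append Let_def)
  obtain k2 m2 where m2: "k2 \<le> K * (tm s'' - tm s')"
      "reach M w B k2 (p + ?lc, m1, ou s') (p + ?lc + length (compile N H (p + ?lc) d), m2, ou s'')"
      "repr N H s'' m2" "bounded_mem B m2"
    using bs_Seq.IH(2)[of "p + ?lc" m1] bs_Seq.prems pw bd m1 by (auto simp: code_at_append Let_def)
  have "K * (tm s' - tm s) + K * (tm s'' - tm s') = K * (tm s'' - tm s)"
    using bs_tm[OF bs_Seq.hyps(1)] bs_tm[OF bs_Seq.hyps(2)]
    by (simp flip: distrib_left)
  then show ?case
    using reach_trans[OF m1(2) m2(2)] m1 m2
    by (intro exI[of _ "k1 + k2"] exI[of _ m2]) (auto simp: Let_def add.assoc)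
next
  case (bs_CondT e s c s' d)
  define ce where "ce = cexp N e"
  define cd where "cd = compile N H (p + length ce + 1) d"
  define p2 where "p2 = p + length ce + 1 + length cd + 1"
  define cc where "cc = compile N H p2 c"
  have code: "compile N H p (Cond e c d) = ce @ [JumpPos N p2] @ cd @ [Jump (p2 + length cc)] @ cc"
    by (simp add: ce_def cd_def p2_def cc_def Let_def)
  have at: "code_at M p ce" "code_at M (p + length ce) [JumpPos N p2]" "code_at M p2 cc"
    using bs_CondT.prems(1) unfolding code by (auto simp: code_at_append code_at_Cons p2_def ac_simps)
  have pw: "V ^ room c \<le> B" "V ^ leaves e \<le> B"
    by (rule power_room[OF bs_CondT.prems(4,5)], simp add: leaves_addr[of H])+
  obtain m1 where m1: "reach M w B (length ce) (p, m, ou s) (p + length ce, m1, ou s)"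
      "bounded_mem B m1" "repr N H s m1" "m1 N = aval e (vs s)"
    using cexp_repr[of M p N e N H B m s V w "ou s"] bs_CondT.prems at pw unfolding ce_def by auto
  have r1: "reach M w B 1 (p + length ce, m1, ou s) (p2, m1, ou s)"
    by (rule reach_instr[where ins = "JumpPos N p2"]) (use at m1 bs_CondT.hyps in auto)
  obtain k2 m2 where m2: "k2 \<le> K * (tm s' - (tm s + 1))" "reach M w B k2 (p2, m1, ou s) (p2 + length cc, m2, ou s')"
      "repr N H s' m2" "bounded_mem B m2"
    using bs_CondT.IH[of p2 m1] bs_CondT.prems m1 at pw unfolding code unfolding cc_def
    by (auto simp: repr_tm bounded_st_tm)
  have "tm s + 1 \<le> tm s'" using bs_tm[OF bs_CondT.hyps(2)] by simp
  then have "K * (tm s' - tm s) = K * (tm s' - (tm s + 1)) + K"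
    by (auto simp: le_iff_add algebra_simps)
  moreover have "length ce + 1 \<le> K" using bs_CondT.prems(12) unfolding code by simp
  ultimately have "length ce + 1 + k2 \<le> K * (tm s' - tm s)" using m2(1) by linarith
  then show ?case
    using reach_trans[OF reach_trans[OF m1(1) r1] m2(2)] m2 unfolding code
    by (intro exI[of _ "length ce + 1 + k2"] exI[of _ m2]) (auto simp: p2_def ac_simps)
next
  case (bs_CondF e s d s' c)
  define ce where "ce = cexp N e"
  define p1 where "p1 = p + length ce + 1"
  define cd where "cd = compile N H p1 d"
  define p2 where "p2 = p1 + length cd + 1"
  define cc where "cc = compile N H p2 c"
  have code: "compile N H p (Cond e c d) = ce @ [JumpPos N p2] @ cd @ [Jump (p2 + length cc)] @ cc"
    by (simp add: ce_def cd_def p1_def p2_def cc_def Let_def)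
  have at: "code_at M p ce" "code_at M (p + length ce) [JumpPos N p2]" "code_at M p1 cd"
      "code_at M (p1 + length cd) [Jump (p2 + length cc)]"
    using bs_CondF.prems(1) unfolding code by (auto simp: code_at_append code_at_Cons p1_def p2_def ac_simps)
  have pw: "V ^ room d \<le> B" "V ^ leaves e \<le> B"
    by (rule power_room[OF bs_CondF.prems(4,5)], simp add: leaves_addr[of H])+
  obtain m1 where m1: "reach M w B (length ce) (p, m, ou s) (p + length ce, m1, ou s)"
      "bounded_mem B m1" "repr N H s m1" "m1 N = aval e (vs s)"
    using cexp_repr[of M p N e N H B m s V w "ou s"] bs_CondF.prems at pw unfolding ce_def by auto
  have r1: "reach M w B 1 (p + length ce, m1, ou s) (p1, m1, ou s)"
    by (rule reach_instr[where ins = "JumpPos N p2"]) (use at m1 bs_CondF.hyps in \<open>auto simp: p1_def\<close>)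
  obtain k2 m2 where m2: "k2 \<le> K * (tm s' - (tm s + 1))" "reach M w B k2 (p1, m1, ou s) (p1 + length cd, m2, ou s')"
      "repr N H s' m2" "bounded_mem B m2"
    using bs_CondF.IH[of p1 m1] bs_CondF.prems m1 at pw unfolding code unfolding cd_def
    by (auto simp: repr_tm bounded_st_tm)
  have r3: "reach M w B 1 (p1 + length cd, m2, ou s') (p2 + length cc, m2, ou s')"
    by (rule reach_instr[where ins = "Jump (p2 + length cc)"]) (use at m2 in auto)
  have "tm s + 1 \<le> tm s'" using bs_tm[OF bs_CondF.hyps(2)] by simp
  then have "K * (tm s' - tm s) = K * (tm s' - (tm s + 1)) + K"
    by (auto simp: le_iff_add algebra_simps)
  moreover have "length ce + 2 \<le> K" using bs_CondF.prems(12) unfolding code by simp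
  ultimately have "length ce + 1 + k2 + 1 \<le> K * (tm s' - tm s)" using m2(1) by linarith
  then show ?case
    using reach_trans[OF reach_trans[OF reach_trans[OF m1(1) r1] m2(2)] r3] m2 unfolding code
    by (intro exI[of _ "length ce + 1 + k2 + 1"] exI[of _ m2]) (auto simp: p1_def p2_def ac_simps)
next
  case (bs_LoopT e s c s' s'')
  define ce where "ce = cexp N e"
  define p1 where "p1 = p + length ce + 2"
  define cc where "cc = compile N H p1 c"
  have code: "compile N H p (Loop e c) = ce @ [JumpPos N p1, Jump (p1 + length cc + 1)] @ cc @ [Jump p]"
    by (simp add: ce_def p1_def cc_def Let_def)
  have at: "code_at M p ce" "code_at M (p + length ce) [JumpPos N p1]" "code_at M p1 cc"
      "code_at M (p1 + length cc) [Jump p]"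
    using bs_LoopT.prems(1) unfolding code by (auto simp: code_at_append code_at_Cons p1_def ac_simps)
  have pw: "V ^ room c \<le> B" "V ^ leaves e \<le> B"
    by (rule power_room[OF bs_LoopT.prems(4,5)], simp add: leaves_addr[of H])+
  obtain m1 where m1: "reach M w B (length ce) (p, m, ou s) (p + length ce, m1, ou s)"
      "bounded_mem B m1" "repr N H s m1" "m1 N = aval e (vs s)"
    using cexp_repr[of M p N e N H B m s V w "ou s"] bs_LoopT.prems at pw unfolding ce_def by auto
  have r1: "reach M w B 1 (p + length ce, m1, ou s) (p1, m1, ou s)"
    by (rule reach_instr[where ins = "JumpPos N p1"]) (use at m1 bs_LoopT.hyps in auto)
  obtain k2 m2 where m2: "k2 \<le> K * (tm s' - (tm s + 1))" "reach M w B k2 (p1, m1, ou s) (p1 + length cc, m2, ou s')"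
      "repr N H s' m2" "bounded_mem B m2"
    using bs_LoopT.IH(1)[of p1 m1] bs_LoopT.prems m1 at pw unfolding code unfolding cc_def
    by (auto simp: repr_tm bounded_st_tm)
  have r3: "reach M w B 1 (p1 + length cc, m2, ou s') (p, m2, ou s')"
    by (rule reach_instr[where ins = "Jump p"]) (use at m2 in auto)
  have bd: "bounded_st V s'" using bs_bounded[OF bs_LoopT.hyps(2)] bs_LoopT.prems(10) by (simp add: bounded_st_tm)
  obtain k4 m4 where m4: "k4 \<le> K * (tm s'' - tm s')"
      "reach M w B k4 (p, m2, ou s') (p + length (compile N H p (Loop e c)), m4, ou s'')"
      "repr N H s'' m4" "bounded_mem B m4"
    using bs_LoopT.IH(2)[of p m2] bs_LoopT.prems m2 bd by blast
  have t: "tm s + 1 \<le> tm s'" "tm s' \<le> tm s''"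
    using bs_tm[OF bs_LoopT.hyps(2)] bs_tm[OF bs_LoopT.hyps(3)] by auto
  \<comment> \<open>The tick for the condition leaves \<open>K\<close> steps for the test, the
    conditional jump and the jump back.\<close>
  then have "K * (tm s'' - tm s) = K * (tm s' - (tm s + 1)) + K * (tm s'' - tm s') + K"
    by (auto simp: le_iff_add algebra_simps)
  moreover have "length ce + 2 \<le> K" using bs_LoopT.prems(12) unfolding code by simp
  ultimately have "length ce + 1 + k2 + 1 + k4 \<le> K * (tm s'' - tm s)" using m2(1) m4(1) by linarith
  then show ?case
    using reach_trans[OF reach_trans[OF reach_trans[OF reach_trans[OF m1(1) r1] m2(2)] r3] m4(2)] m4
    by blast
next
  case (bs_LoopF e s c)
  define ce where "ce = cexp N e"
  define p1 where "p1 = p + length ce + 2"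
  define cc where "cc = compile N H p1 c"
  have code: "compile N H p (Loop e c) = ce @ [JumpPos N p1, Jump (p1 + length cc + 1)] @ cc @ [Jump p]"
    by (simp add: ce_def p1_def cc_def Let_def)
  let ?j = "Jump (p1 + length cc + 1)"
  have at: "code_at M p ce" "code_at M (p + length ce) [JumpPos N p1]" "code_at M (Suc (p + length ce)) [?j]"
    using bs_LoopF.prems(1) unfolding code by (auto simp: code_at_append code_at_Cons p1_def ac_simps)
  have pw: "V ^ leaves e \<le> B"
    by (rule power_room[OF bs_LoopF.prems(4,5)], simp add: leaves_addr[of H])+
  obtain m1 where m1: "reach M w B (length ce) (p, m, ou s) (p + length ce, m1, ou s)"
      "bounded_mem B m1" "repr N H s m1" "m1 N = aval e (vs s)"
    using cexp_repr[of M p N e N H B m s V w "ou s"] bs_LoopF.prems at pw unfolding ce_def by auto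
  have r1: "reach M w B 1 (p + length ce, m1, ou s) (Suc (p + length ce), m1, ou s)"
    by (rule reach_instr[where ins = "JumpPos N p1"]) (use at m1 bs_LoopF.hyps in auto)
  have r2: "reach M w B 1 (Suc (p + length ce), m1, ou s) (p1 + length cc + 1, m1, ou s)"
    by (rule reach_instr[where ins = ?j]) (use at m1 in auto)
  have "length ce + 1 + 1 \<le> K" using bs_LoopF.prems(12) unfolding code by simp
  then show ?case
    using reach_trans[OF reach_trans[OF m1(1) r1] r2] m1 unfolding code
    by (intro exI[of _ "length ce + 1 + 1"] exI[of _ m1]) (auto simp: p1_def ac_simps repr_tm)
qed

section \<open>Magnitude versus bit length\<close>

lemma int_size_le:
  assumes "\<bar>z\<bar> \<le> 2 ^ b"
  shows "int_size z \<le> b + 2"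
proof -
  have "nat \<bar>z\<bar> \<le> 2 ^ b" using assms by (simp add: nat_le_iff)
  \<comment> \<open>The boundary value \<open>2 ^ b\<close> has \<open>b + 1\<close> digits; the
    sign accounts for the remaining 1.\<close>
  then have "nat \<bar>z\<bar> < 2 ^ (b + 1)" by (rule le_less_trans) simp
  then have "floorlog 2 (nat \<bar>z\<bar>) \<le> b + 1" by (intro floorlog_leI) auto
  then show ?thesis by (simp add: int_size_def)
qed

lemma abs_le_int_size: "\<bar>z\<bar> \<le> 2 ^ int_size z"
proof (cases "z = 0")
  case False
  then have "nat \<bar>z\<bar> < 2 ^ floorlog 2 (nat \<bar>z\<bar>)"
    using floorlog_bounds[of "nat \<bar>z\<bar>" 2] by simp
  also have "\<dots> \<le> 2 ^ int_size z" by (simp add: int_size_def)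
  finally show ?thesis by (simp add: nat_less_iff)
qed simp

definition init_st :: st where
  "init_st = \<lparr>vs = \<lambda>_. 0, ar = \<lambda>_ _ _. 0, ou = [], tm = 0\<rparr>"

text \<open>The machine and its constants are fixed before the input and the bit bound.
  \<open>L\<close> ensures that the literals and the array offset are at most \<open>2 ^ b\<close>;
  \<open>K\<close> is time factor and bit factor at once, as \<open>(2 ^ b) ^ room c\<close> is at
  most \<open>2 ^ (K * b)\<close>.\<close>

theorem compile_com:
  "\<exists>M K L. \<forall>w b s. L \<le> b \<longrightarrow> bs w (2 ^ b) c init_st s \<longrightarrow>
     ram_outputs M w (K * tm s) (K * b + 2) (ou s)"
proof -
  obtain N where N: "cvars c \<subseteq> {..<N}"
    using finite_cvars finite_nat_set_iff_bounded by (meson lessThan_iff subsetI)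
  define H where "H = N + room c"
  obtain L where L: "\<forall>z\<in>clits c. \<bar>z\<bar> \<le> int L"
  proof -
    define L where "L = (\<Sum>z\<in>clits c. nat \<bar>z\<bar>)"
    have "nat \<bar>z\<bar> \<le> L" if "z \<in> clits c" for z
      using that unfolding L_def by (intro member_le_sum finite_clits) auto
    then show ?thesis using that by (meson nat_le_iff)
  qed
  define cd where "cd = compile N H 0 c"
  define M where "M = cd @ [Halt]"
  define K where "K = length cd + 3 + room c"
  have "ram_outputs M w (K * tm s) (K * b + 2) (ou s)"
    if b: "L + H + 1 \<le> b" and run: "bs w (2 ^ b) c init_st s" for w b s
  proof -
    have V: "int L + int H + 1 \<le> 2 ^ b"
    proof -
      have "int b < 2 ^ b" by (metis of_nat_less_two_power)
      then show ?thesis using b by linarith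
    qed
    have V2: "(2::int) \<le> 2 ^ b" using b power_increasing[of 1 b "2::int"] by simp
    let ?B = "2 ^ (K * b) :: int"
    have B1: "(2 ^ b) ^ room c \<le> ?B" unfolding K_def power_mult[symmetric]
      by (intro power_increasing) (auto simp: algebra_simps)
    have B2: "2 ^ b \<le> ?B" unfolding K_def
      by (intro power_increasing) auto
    have "\<exists>k m'. k \<le> K * (tm s - tm init_st) \<and>
      reach M w ?B k (0, \<lambda>_. 0, ou init_st) (0 + length cd, m', ou s) \<and>
      repr N H s m' \<and> bounded_mem ?B m'"
      unfolding cd_def
    proof (rule compile_correct[OF run _ N])
      show "code_at M 0 (compile N H 0 c)" by (auto simp: M_def cd_def code_at_def nth_append)
      show "\<forall>z\<in>clits c. \<bar>z\<bar> \<le> 2 ^ b" using L V by force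
      show "int H \<le> 2 ^ b" using V by linarith
    qed (use V2 B1 B2 in \<open>auto simp: H_def K_def cd_def init_st_def repr_def bounded_st_def bounded_mem_def\<close>)
    then obtain k m' where k: "k \<le> K * tm s"
        "reach M w ?B k (0, \<lambda>_. 0, []) (length cd, m', ou s)"
      by (auto simp: init_st_def)
    have r: "run M w k = Some (length cd, m', ou s) \<and>
      (\<forall>i. 0 \<le> i \<longrightarrow> i \<le> k \<longrightarrow> (\<exists>ci. run M w i = Some ci \<and> bounded_mem ?B (fst (snd ci))))"
      using reach_run[OF k(2), of 0] by simp
    have "int_size (m2 a) \<le> K * b + 2" if "j \<le> k" "run M w j = Some (pc, m2, out2)" for j pc m2 out2 a
      using r that by (intro int_size_le) (force simp: bounded_mem_def)
    then show ?thesis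
      unfolding ram_outputs_def using k r
      by (intro exI[of _ k] conjI exI[of _ "length cd"] exI[of _ m']) (auto simp: M_def)
  qed
  then show ?thesis by blast
qed

section \<open>Weakest preconditions\<close>

text \<open>Asking for an execution makes this total correctness: termination, nonnegative addresses
  and the bound \<open>V\<close> on stored values all have to be shown.\<close>

definition wp :: "int list \<Rightarrow> int \<Rightarrow> com \<Rightarrow> st \<Rightarrow> (st \<Rightarrow> bool) \<Rightarrow> bool" where
  "wp w V c s Q \<longleftrightarrow> (\<exists>s'. bs w V c s s' \<and> Q s')"

lemma bs_iffs:
  "bs w V Skip s s' \<longleftrightarrow> s' = s"
  "bs w V (Assign x e) s s' \<longleftrightarrow> \<bar>aval e (vs s)\<bar> \<le> V \<and>
    s' = s\<lparr>vs := (vs s)(x := aval e (vs s)), tm := tm s + 1\<rparr>"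
  "bs w V (Fetch x a e f) s s' \<longleftrightarrow> 0 \<le> aval e (vs s) \<and> 0 \<le> aval f (vs s) \<and>
    s' = s\<lparr>vs := (vs s)(x := ar s a (nat (aval e (vs s))) (nat (aval f (vs s)))), tm := tm s + 1\<rparr>"
  "bs w V (Put a e f g) s s' \<longleftrightarrow> 0 \<le> aval e (vs s) \<and> 0 \<le> aval f (vs s) \<and> \<bar>aval g (vs s)\<bar> \<le> V \<and>
    s' = s\<lparr>ar := arr_upd (ar s) a (nat (aval e (vs s))) (nat (aval f (vs s))) (aval g (vs s)),
      tm := tm s + 1\<rparr>"
  "bs w V (Read x e) s s' \<longleftrightarrow> 0 \<le> aval e (vs s) \<and> \<bar>read_input w (nat (aval e (vs s)))\<bar> \<le> V \<and>
    s' = s\<lparr>vs := (vs s)(x := read_input w (nat (aval e (vs s)))), tm := tm s + 1\<rparr>"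
  "bs w V (Emit e) s s' \<longleftrightarrow> s' = s\<lparr>ou := ou s @ [aval e (vs s)], tm := tm s + 1\<rparr>"
  "bs w V (Seq c d) s s' \<longleftrightarrow> (\<exists>s1. bs w V c s s1 \<and> bs w V d s1 s')"
  "bs w V (Cond e c d) s s' \<longleftrightarrow>
    (if aval e (vs s) > 0 then bs w V c (s\<lparr>tm := tm s + 1\<rparr>) s' else bs w V d (s\<lparr>tm := tm s + 1\<rparr>) s')"
  by (subst bs.simps; auto)+

lemma wp_simps [simp]:
  "wp w V Skip s Q \<longleftrightarrow> Q s"
  "wp w V (Assign x e) s Q \<longleftrightarrow> \<bar>aval e (vs s)\<bar> \<le> V \<and>
    Q (s\<lparr>vs := (vs s)(x := aval e (vs s)), tm := tm s + 1\<rparr>)"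
  "wp w V (Fetch x a e f) s Q \<longleftrightarrow> 0 \<le> aval e (vs s) \<and> 0 \<le> aval f (vs s) \<and>
    Q (s\<lparr>vs := (vs s)(x := ar s a (nat (aval e (vs s))) (nat (aval f (vs s)))), tm := tm s + 1\<rparr>)"
  "wp w V (Put a e f g) s Q \<longleftrightarrow> 0 \<le> aval e (vs s) \<and> 0 \<le> aval f (vs s) \<and> \<bar>aval g (vs s)\<bar> \<le> V \<and>
    Q (s\<lparr>ar := arr_upd (ar s) a (nat (aval e (vs s))) (nat (aval f (vs s))) (aval g (vs s)),
        tm := tm s + 1\<rparr>)"
  "wp w V (Read x e) s Q \<longleftrightarrow> 0 \<le> aval e (vs s) \<and> \<bar>read_input w (nat (aval e (vs s)))\<bar> \<le> V \<and>
    Q (s\<lparr>vs := (vs s)(x := read_input w (nat (aval e (vs s)))), tm := tm s + 1\<rparr>)"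
  "wp w V (Emit e) s Q \<longleftrightarrow> Q (s\<lparr>ou := ou s @ [aval e (vs s)], tm := tm s + 1\<rparr>)"
  "wp w V (Seq c d) s Q \<longleftrightarrow> wp w V c s (\<lambda>s'. wp w V d s' Q)"
  "wp w V (Cond e c d) s Q \<longleftrightarrow>
    (if aval e (vs s) > 0 then wp w V c (s\<lparr>tm := tm s + 1\<rparr>) Q else wp w V d (s\<lparr>tm := tm s + 1\<rparr>) Q)"
  unfolding wp_def bs_iffs by auto

section \<open>Frames: what a command cannot change\<close>

primrec mods :: "com \<Rightarrow> nat set" where
  "mods Skip = {}"
| "mods (Assign x e) = {x}"
| "mods (Fetch x a e f) = {x}"
| "mods (Put a e f g) = {}"
| "mods (Read x e) = {x}"
| "mods (Emit e) = {}"
| "mods (Seq c d) = mods c \<union> mods d"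
| "mods (Cond e c d) = mods c \<union> mods d"
| "mods (Loop e c) = mods c"

primrec amods :: "com \<Rightarrow> nat set" where
  "amods Skip = {}"
| "amods (Assign x e) = {}"
| "amods (Fetch x a e f) = {}"
| "amods (Put a e f g) = {a}"
| "amods (Read x e) = {}"
| "amods (Emit e) = {}"
| "amods (Seq c d) = amods c \<union> amods d"
| "amods (Cond e c d) = amods c \<union> amods d"
| "amods (Loop e c) = amods c"

primrec emits :: "com \<Rightarrow> bool" where
  "emits Skip = False"
| "emits (Assign x e) = False"
| "emits (Fetch x a e f) = False"
| "emits (Put a e f g) = False"
| "emits (Read x e) = False"
| "emits (Emit e) = True"
| "emits (Seq c d) = (emits c \<or> emits d)"
| "emits (Cond e c d) = (emits c \<or> emits d)"
| "emits (Loop e c) = emits c"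

definition frame :: "com \<Rightarrow> st \<Rightarrow> st \<Rightarrow> bool" where
  "frame c s s' \<longleftrightarrow> (\<forall>x. x \<notin> mods c \<longrightarrow> vs s' x = vs s x) \<and>
    (\<forall>a. a \<notin> amods c \<longrightarrow> ar s' a = ar s a) \<and> (\<not> emits c \<longrightarrow> ou s' = ou s)"

lemma bs_frame: "bs w V c s s' \<Longrightarrow> frame c s s'"
  by (induction rule: bs.induct) (auto simp: frame_def arr_upd_def fun_eq_iff)

lemma frame_trans: "frame c s s' \<Longrightarrow> frame c s' s'' \<Longrightarrow> frame c s s''"
  by (auto simp: frame_def)

text \<open>Unchanged variables and arrays are read off the syntax, so loop invariants only have to
  mention what the loop modifies.\<close>

lemma wp_frame:
  assumes "wp w V c s (\<lambda>s'. frame c s s' \<longrightarrow> Q s')"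
  shows "wp w V c s Q"
  using assms bs_frame unfolding wp_def by blast

lemma wp_mono:
  assumes "wp w V c s Q'" "\<And>s'. frame c s s' \<Longrightarrow> Q' s' \<Longrightarrow> Q s'"
  shows "wp w V c s Q"
  using assms bs_frame unfolding wp_def by blast

text \<open>The number \<open>k\<close> in the invariant bounds the number of remaining iterations.\<close>

lemma wp_Loop:
  assumes init: "I n s"
    and step: "\<And>k s'. I k s' \<Longrightarrow> frame c s s' \<Longrightarrow> aval e (vs s') > 0 \<Longrightarrow>
      wp w V c (s'\<lparr>tm := tm s' + 1\<rparr>) (\<lambda>s''. (\<exists>k'<k. I k' s'') \<and> tm s'' \<le> tm s' + 1 + T)"
    and exit: "\<And>k s'. I k s' \<Longrightarrow> frame c s s' \<Longrightarrow> \<not> aval e (vs s') > 0 \<Longrightarrow>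
      tm s' \<le> tm s + n * (T + 1) \<Longrightarrow> Q (s'\<lparr>tm := tm s' + 1\<rparr>)"
  shows "wp w V (Loop e c) s Q"
proof -
  \<comment> \<open>The time spent plus \<open>k * (T + 1)\<close>, the budget of the remaining
    iterations, never exceeds its initial value.\<close>
  have "wp w V (Loop e c) s' Q" if "I k s'" "frame c s s'" "tm s' + k * (T + 1) \<le> tm s + n * (T + 1)" for k s'
    using that
  proof (induction k arbitrary: s' rule: less_induct)
    case (less k)
    show ?case
    proof (cases "aval e (vs s') > 0")
      case True
      from step[OF less.prems(1,2) True] obtain s2 k' where s2:
        "bs w V c (s'\<lparr>tm := tm s' + 1\<rparr>) s2" "k' < k" "I k' s2" "tm s2 \<le> tm s' + 1 + T"
        unfolding wp_def by blast
      have "frame c s' s2" using bs_frame[OF s2(1)] by (simp add: frame_def)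
      then have f: "frame c s s2" using less.prems(2) frame_trans by blast
      have "Suc k' * (T + 1) \<le> k * (T + 1)" using s2(2) by (intro mult_right_mono) auto
      then have "tm s2 + k' * (T + 1) \<le> tm s + n * (T + 1)"
        using s2(4) less.prems(3) by simp
      from less.IH[OF s2(2,3) f this] obtain s3 where "bs w V (Loop e c) s2 s3" "Q s3"
        unfolding wp_def by blast
      then show ?thesis unfolding wp_def using bs_LoopT[OF True s2(1)] by blast
    next
      case False
      then show ?thesis
        using exit[OF less.prems(1,2) False] less.prems(3) unfolding wp_def
        by (intro exI[of _ "s'\<lparr>tm := tm s' + 1\<rparr>"]) (use bs_LoopF[OF False, of w V c] in simp)
    qed
  qed
  from this[OF init] show ?thesis by (simp add: frame_def)
qed

abbreviation add_exp (infixl "\<^bold>+" 65) where "add_exp \<equiv> Bin Add"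
abbreviation sub_exp (infixl "\<^bold>-" 65) where "sub_exp \<equiv> Bin Sub"
abbreviation mul_exp (infixl "\<^bold>*" 70) where "mul_exp \<equiv> Bin Mul"
abbreviation div_exp (infixl "\<^bold>'/" 70) where "div_exp \<equiv> Bin Div"
notation Seq (infixr ";;" 60)
notation Assign (infix "::=" 61)

definition For :: "nat \<Rightarrow> aexp \<Rightarrow> com \<Rightarrow> com" where
  "For i e c = (i ::= Lit 0;; Loop (e \<^bold>- Var i) (c;; i ::= Var i \<^bold>+ Lit 1))"

lemma mods_For [simp]: "mods (For i e c) = insert i (mods c)"
  and amods_For [simp]: "amods (For i e c) = amods c"
  and emits_For [simp]: "emits (For i e c) = emits c"
  by (auto simp: For_def)

text \<open>Loop test and increment add 2 to the cost \<open>T\<close> of each iteration; the final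
  2 pays for the initialization and the failing test. By \<open>cong\<close> the invariant ignores
  counter and clock, the two things changed outside the body; \<open>body\<close> receives the
  counter value separately.\<close>

lemma wp_For:
  assumes fresh: "i \<notin> mods c" "i \<notin> avars e" "avars e \<inter> mods c = {}"
    and e: "aval e (vs s) = int h" "int h \<le> V"
    and I0: "I 0 s"
    and cong: "\<And>j s v t. I j s \<Longrightarrow> I j (s\<lparr>vs := (vs s)(i := v), tm := t\<rparr>)"
    and body: "\<And>j s'. j < h \<Longrightarrow> I j s' \<Longrightarrow> frame (For i e c) s s' \<Longrightarrow> vs s' i = int j \<Longrightarrow>
      wp w V c s' (\<lambda>s''. I (Suc j) s'' \<and> tm s'' \<le> tm s' + T)"
    and fin: "\<And>s'. I h s' \<Longrightarrow> frame (For i e c) s s' \<Longrightarrow> tm s' \<le> tm s + h * (T + 2) + 2 \<Longrightarrow> Q s'"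
  shows "wp w V (For i e c) s Q"
proof -
  have eq: "aval e (vs s') = int h" if "\<forall>x. x \<notin> insert i (mods c) \<longrightarrow> vs s' x = vs s x" for s'
    using that fresh by (subst aval_cong[of e _ "vs s"]) (auto simp: e)
  have congt: "I j (s\<lparr>tm := t\<rparr>)" if "I j s" for j s t
    using cong[OF that, where v = "vs s i" and t = t] by simp
  let ?s = "s\<lparr>vs := (vs s)(i := 0), tm := tm s + 1\<rparr>"
  have V: "0 \<le> V" using e by linarith
  have "wp w V (Loop (e \<^bold>- Var i) (c;; i ::= Var i \<^bold>+ Lit 1)) ?s Q"
  proof (rule wp_Loop[where I = "\<lambda>k s'. \<exists>j. k + j = h \<and> I j s' \<and> vs s' i = int j" and n = h and T = "T + 1"])
    show "\<exists>j. h + j = h \<and> I j ?s \<and> vs ?s i = int j"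
      using cong[OF I0, where v = 0 and t = "tm s + 1"] by auto
  next
    fix k s' assume "\<exists>j. k + j = h \<and> I j s' \<and> vs s' i = int j"
      and f: "frame (c;; i ::= Var i \<^bold>+ Lit 1) ?s s'"
      and pos: "0 < aval (e \<^bold>- Var i) (vs s')"
    then obtain j where j: "k + j = h" "I j s'" "vs s' i = int j" by blast
    have f': "frame (For i e c) s s'" using f by (auto simp: frame_def For_def)
    then have "aval e (vs s') = int h" by (intro eq) (auto simp: frame_def)
    then have jh: "j < h" using pos j by simp
    have "wp w V c (s'\<lparr>tm := tm s' + 1\<rparr>) (\<lambda>s''. I (Suc j) s'' \<and> tm s'' \<le> tm (s'\<lparr>tm := tm s' + 1\<rparr>) + T)"
      by (rule body[OF jh]) (use f' j congt in \<open>auto simp: frame_def\<close>)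
    then have "wp w V c (s'\<lparr>tm := tm s' + 1\<rparr>)
      (\<lambda>s1. wp w V (i ::= Var i \<^bold>+ Lit 1) s1 (\<lambda>s''. (\<exists>k'<k. \<exists>j. k' + j = h \<and> I j s'' \<and> vs s'' i = int j) \<and>
          tm s'' \<le> tm s' + 1 + (T + 1)))"
    proof (rule wp_mono)
      fix s1 assume f1: "frame c (s'\<lparr>tm := tm s' + 1\<rparr>) s1"
        and "I (Suc j) s1 \<and> tm s1 \<le> tm (s'\<lparr>tm := tm s' + 1\<rparr>) + T"
      then have s1: "I (Suc j) s1" "tm s1 \<le> tm s' + 1 + T" "vs s1 i = int j"
        using fresh j by (auto simp: frame_def)
      let ?s1 = "s1\<lparr>vs := (vs s1)(i := aval (Var i \<^bold>+ Lit 1) (vs s1)), tm := tm s1 + 1\<rparr>"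
      have "k - 1 < k" "k - 1 + Suc j = h" "I (Suc j) ?s1" "vs ?s1 i = int (Suc j)"
        using j jh s1(3) by (auto intro!: cong[OF s1(1)])
      then have "\<exists>k'<k. \<exists>j. k' + j = h \<and> I j ?s1 \<and> vs ?s1 i = int j" by blast
      moreover have "\<bar>aval (Var i \<^bold>+ Lit 1) (vs s1)\<bar> \<le> V" using jh e s1(3) by simp
      moreover have "tm ?s1 \<le> tm s' + 1 + (T + 1)" using s1(2) by simp
      ultimately show "wp w V (i ::= Var i \<^bold>+ Lit 1) s1 (\<lambda>s''. (\<exists>k'<k. \<exists>j. k' + j = h \<and> I j s'' \<and> vs s'' i = int j) \<and>
          tm s'' \<le> tm s' + 1 + (T + 1))"
        unfolding wp_simps by blast
    qed
    then show "wp w V (c;; i ::= Var i \<^bold>+ Lit 1) (s'\<lparr>tm := tm s' + 1\<rparr>)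
      (\<lambda>s''. (\<exists>k'<k. \<exists>j. k' + j = h \<and> I j s'' \<and> vs s'' i = int j) \<and> tm s'' \<le> tm s' + 1 + (T + 1))"
      by simp
  next
    fix k s' assume "\<exists>j. k + j = h \<and> I j s' \<and> vs s' i = int j"
      and f: "frame (c;; i ::= Var i \<^bold>+ Lit 1) ?s s'"
      and neg: "\<not> 0 < aval (e \<^bold>- Var i) (vs s')" and t: "tm s' \<le> tm ?s + h * (T + 1 + 1)"
    then obtain j where j: "k + j = h" "I j s'" "vs s' i = int j" by blast
    have f': "frame (For i e c) s s'" using f by (auto simp: frame_def For_def)
    then have "aval e (vs s') = int h" by (intro eq) (auto simp: frame_def)
    then have jh: "j = h" using neg j by simp
    show "Q (s'\<lparr>tm := tm s' + 1\<rparr>)"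
      by (rule fin) (use congt j jh f' t in \<open>auto simp: frame_def\<close>)
  qed
  then show ?thesis using V by (simp add: For_def)
qed

section \<open>Variables and arrays of the algorithm\<close>

text \<open>\<open>vM\<close> is the number of points found, \<open>vT\<close> the number of the current grid point and \<open>vCall\<close> the
  number of calls of the machine for the scalarization, whose program counter and output length are
  \<open>vPC\<close> and \<open>vOL\<close>. The arrays hold the matrix \<open>D C\<close> (\<open>aN\<close>), the found points multiplied by \<open>D\<close> in the
  rows \<open>1, \<dots>, m\<close> of \<open>aZ\<close> (row 0 exceeds all objective values and row \<open>m + 1\<close> is the current
  candidate), the code of the right-hand side (\<open>aE\<close>), and the output (\<open>aO\<close>) and memory (\<open>aM\<close>) of the
  simulated machine.\<close>

abbreviation (input) "vN \<equiv> (0::nat)"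
abbreviation (input) "vD \<equiv> (24::nat)"
abbreviation (input) "vM \<equiv> (2::nat)"
abbreviation (input) "vT \<equiv> (3::nat)"
abbreviation (input) "vTT \<equiv> (4::nat)"
abbreviation (input) "vCall \<equiv> (5::nat)"
abbreviation (input) "vGo \<equiv> (6::nat)"
abbreviation (input) "vI \<equiv> (7::nat)"
abbreviation (input) "vJ \<equiv> (8::nat)"
abbreviation (input) "vX \<equiv> (9::nat)"
abbreviation (input) "vY \<equiv> (10::nat)"
abbreviation (input) "vS \<equiv> (11::nat)"
abbreviation (input) "vU \<equiv> (12::nat)"
abbreviation (input) "vP \<equiv> (13::nat)"
abbreviation (input) "vQ \<equiv> (14::nat)"
abbreviation (input) "vA \<equiv> (15::nat)"
abbreviation (input) "vB \<equiv> (16::nat)"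
abbreviation (input) "vR \<equiv> (17::nat)"
abbreviation (input) "vPC \<equiv> (18::nat)"
abbreviation (input) "vH \<equiv> (19::nat)"
abbreviation (input) "vOL \<equiv> (20::nat)"
abbreviation (input) "vK \<equiv> (21::nat)"
abbreviation (input) "vNew \<equiv> (22::nat)"
abbreviation (input) "vEq \<equiv> (23::nat)"

abbreviation (input) "aN \<equiv> (0::nat)"
abbreviation (input) "aZ \<equiv> (5::nat)"
abbreviation (input) "aE \<equiv> (2::nat)"
abbreviation (input) "aO \<equiv> (3::nat)"
abbreviation (input) "aM \<equiv> (4::nat)"

section \<open>Fractions in lowest terms\<close>

text \<open>The Euclidean algorithm on the absolute value of \<open>u\<close> and \<open>D\<close>,
  ending with the gcd in \<open>vA\<close>. For \<open>u = 0\<close> the gcd is \<open>D\<close>,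
  which gives 0/1 just as \<open>quotient_of\<close> does.\<close>

definition norm_prog :: com where
  "norm_prog =
    (Cond (Var vU) (vA ::= Var vU) (vA ::= Lit 0 \<^bold>- Var vU);; vB ::= Var vD;;
     Loop (Var vB) (vR ::= Var vA \<^bold>- Var vB \<^bold>* (Var vA \<^bold>/ Var vB);; vA ::= Var vB;; vB ::= Var vR);;
     vP ::= Var vU \<^bold>/ Var vA;; vQ ::= Var vD \<^bold>/ Var vA)"

lemma norm_prog_mods [simp]: "mods norm_prog = {vP, vQ, vA, vB, vR}" "amods norm_prog = {}" "\<not> emits norm_prog"
  by (auto simp: norm_prog_def)

lemma quotient_of_int_div:
  assumes "D > 0"
  shows "quotient_of (of_int u / of_int D) = (u div gcd u D, D div gcd u D)"
  using assms by (simp add: Fract_of_int_quotient[symmetric] quotient_of_Fract Rat.normalize_def Let_def)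

lemma quotient_of_bounds:
  assumes "D > 0"
  shows "\<bar>fst (quotient_of (of_int u / of_int D))\<bar> \<le> \<bar>u\<bar>"
    "\<bar>snd (quotient_of (of_int u / of_int D))\<bar> \<le> D"
  using abs_zdiv_le[of u "gcd u D"] abs_zdiv_le[of D "gcd u D"] assms
  by (simp_all add: quotient_of_int_div)

text \<open>In the Euclidean algorithm the product of the two numbers is at least halved in every step,
  except possibly in the first one, which may just swap them.\<close>

lemma euclid_potential:
  fixes a b :: int
  assumes "0 \<le> a" "0 < b" and "(b \<le> a \<and> a * b < 2 ^ k) \<or> (k \<ge> 1 \<and> a * b < 2 ^ (k - 1))"
  shows "k > 0" "b * (a mod b) < 2 ^ (k - 1)"
proof -
  have *: "k > 0 \<and> b * (a mod b) < 2 ^ (k - 1)"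
  proof (cases "b \<le> a")
    case True
    then have "0 < a * b" using assms by simp
    have ab: "a * b < 2 ^ k"
      using assms(3) order.strict_trans2[OF _ power_increasing[of "k - 1" k "2::int"]] by auto
    then have "k > 0" using \<open>0 < a * b\<close> by (cases k) auto
    have "2 * (a mod b) \<le> a"
    proof -
      have "a mod b < b" "a mod b + b * (a div b) = a" "a div b \<ge> 1"
        using assms True by (auto simp: pos_imp_zdiv_pos_iff int_one_le_iff_zero_less)
      moreover have "b * 1 \<le> b * (a div b)" using calculation assms by (intro mult_left_mono) auto
      ultimately show ?thesis by linarith
    qed
    then have "b * (2 * (a mod b)) \<le> b * a" using assms by (intro mult_left_mono) auto
    then have "2 * (b * (a mod b)) < 2 ^ k" using ab by (simp add: ac_simps)
    then show ?thesis using \<open>k > 0\<close> by (cases k) auto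
  next
    case False
    then show ?thesis using assms by (auto simp: mult.commute)
  qed
  then show "k > 0" "b * (a mod b) < 2 ^ (k - 1)" by auto
qed

lemma wp_norm:
  assumes D: "vs s vD = D" "0 < D" "D \<le> 2 ^ b" and u: "vs s vU = u" "\<bar>u\<bar> \<le> 2 ^ b"
    and Q: "\<And>s'. frame norm_prog s s' \<Longrightarrow> vs s' vP = fst (quotient_of (of_int u / of_int D)) \<Longrightarrow>
       vs s' vQ = snd (quotient_of (of_int u / of_int D)) \<Longrightarrow> tm s' \<le> tm s + (8 * b + 14) \<Longrightarrow> Q s'"
  shows "wp w (2 ^ b) norm_prog s Q"
proof -
  let ?V = "2 ^ b :: int"
  let ?c = "vR ::= Var vA \<^bold>- Var vB \<^bold>* (Var vA \<^bold>/ Var vB);; vA ::= Var vB;; vB ::= Var vR"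
  let ?I = "\<lambda>k (s' :: st). 0 \<le> vs s' vA \<and> vs s' vA \<le> ?V \<and> 0 \<le> vs s' vB \<and> vs s' vB \<le> ?V \<and>
    gcd (vs s' vA) (vs s' vB) = gcd u D \<and>
    ((vs s' vB \<le> vs s' vA \<and> vs s' vA * vs s' vB < 2 ^ k) \<or>
     (k \<ge> 1 \<and> vs s' vA * vs s' vB < 2 ^ (k - 1)))"
  have *: "wp w ?V (Loop (Var vB) ?c) s1
     (\<lambda>s'. wp w ?V (vP ::= Var vU \<^bold>/ Var vA) s' (\<lambda>s'. wp w ?V (vQ ::= Var vD \<^bold>/ Var vA) s' (\<lambda>s'. frame norm_prog s s' \<longrightarrow> Q s')))"
    if s1: "vs s1 vA = \<bar>u\<bar>" "vs s1 vB = D" "vs s1 vU = u" "vs s1 vD = D" "tm s1 \<le> tm s + 3" for s1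
  \<comment> \<open>The product starts at no more than \<open>2 ^ (2 * b)\<close>, so with index
    \<open>2 * b + 2\<close> even the second alternative holds, which allows for the initial swap.
    Four ticks per iteration give the \<open>8 * b\<close>.\<close>
  proof (rule wp_Loop[where I = ?I and n = "2 * b + 2" and T = 3])
    have "\<bar>u\<bar> * D \<le> ?V * ?V" using D u by (intro mult_mono) auto
    also have "\<dots> < 2 ^ (2 * b + 2 - 1)" by (simp flip: power_add mult_2)
    finally have "\<bar>u\<bar> * D < 2 ^ (2 * b + 2 - 1)" .
    then show "?I (2 * b + 2) s1" using s1 D u by simp
  next
    fix k s' assume I: "?I k s'" and pos: "0 < aval (Var vB) (vs s')"
    have p: "k > 0" "vs s' vB * (vs s' vA mod vs s' vB) < 2 ^ (k - 1)"
      using euclid_potential[of "vs s' vA" "vs s' vB" k] I pos by auto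
    have m: "vs s' vA - vs s' vB * (vs s' vA div vs s' vB) = vs s' vA mod vs s' vB"
      by (simp add: minus_mult_div_eq_mod)
    have lt: "vs s' vA mod vs s' vB < vs s' vB" "0 \<le> vs s' vA mod vs s' vB" using pos by auto
    have g: "gcd (vs s' vB) (vs s' vA mod vs s' vB) = gcd u D"
      using I by (metis gcd.commute gcd_red_int)
    show "wp w ?V ?c (s'\<lparr>tm := tm s' + 1\<rparr>) (\<lambda>s''. (\<exists>k'<k. ?I k' s'') \<and> tm s'' \<le> tm s' + 1 + 3)"
      using I pos p lt g by (auto simp: m intro!: exI[of _ "k - 1"])
  next
    fix k s' assume I: "?I k s'" and f: "frame ?c s1 s'" and neg: "\<not> 0 < aval (Var vB) (vs s')"
      and t: "tm s' \<le> tm s1 + (2 * b + 2) * (3 + 1)"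
    have g: "vs s' vB = 0" "vs s' vA = gcd u D" using I neg by auto
    have un: "vs s' vU = u" "vs s' vD = D" using f s1 by (auto simp: frame_def)
    have b1: "\<bar>u div gcd u D\<bar> \<le> ?V"
      using abs_zdiv_le[of u "gcd u D"] u by linarith
    have b2: "\<bar>D div gcd u D\<bar> \<le> ?V" using abs_zdiv_le[of D "gcd u D"] D by linarith
    let ?s2 = "s'\<lparr>tm := tm s' + 1\<rparr>"
    show "wp w ?V (vP ::= Var vU \<^bold>/ Var vA) ?s2 (\<lambda>s'. wp w ?V (vQ ::= Var vD \<^bold>/ Var vA) s' (\<lambda>s'. frame norm_prog s s' \<longrightarrow> Q s'))"
      by (simp add: un g b1 b2, intro impI, rule Q)
        (use t s1(5) in \<open>simp_all add: quotient_of_int_div[OF D(2)] un g\<close>)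
  qed
  show ?thesis
    by (rule wp_frame) (use D u * in \<open>auto simp: norm_prog_def\<close>)
qed

section \<open>The right-hand sides of the scalarization\<close>

definition digit :: "nat \<Rightarrow> nat \<Rightarrow> nat \<Rightarrow> nat" where
  "digit m t i = (t div (m + 1) ^ i) mod (m + 1)"

text \<open>The number \<open>t\<close> is read in base \<open>m + 1\<close>, digit \<open>i\<close>
  naming the slot that bounds coordinate \<open>i\<close>. Whatever is left in \<open>vTT\<close>
  after \<open>d\<close> digits is positive exactly when \<open>t\<close> has run past the grid, and
  \<open>round_prog\<close> stops on it. The remainder is spelled out as the machine can only
  divide.\<close>

definition eps_prog :: "nat \<Rightarrow> com" where
  "eps_prog d =
    (vTT ::= Var vT;;
     For vI (Lit (int d))
      (vK ::= Var vTT \<^bold>- (Var vM \<^bold>+ Lit 1) \<^bold>* (Var vTT \<^bold>/ (Var vM \<^bold>+ Lit 1));;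
       vTT ::= Var vTT \<^bold>/ (Var vM \<^bold>+ Lit 1);;
       Fetch vU aZ (Var vK) (Var vI);; vU ::= Var vU \<^bold>- Lit 1;;
       norm_prog;;
       Put aE (Lit 0) (Lit 2 \<^bold>* Var vI) (Var vP);;
       Put aE (Lit 0) (Lit 2 \<^bold>* Var vI \<^bold>+ Lit 1) (Var vQ)))"

lemma eps_prog_mods [simp]: "mods (eps_prog d) = {vTT, vI, vK, vU, vP, vQ, vA, vB, vR}"
   "amods (eps_prog d) = {aE}" "\<not> emits (eps_prog d)"
  by (auto simp: eps_prog_def)

lemma wp_eps:
  assumes D: "vs s vD = D" "0 < D" "D \<le> 2 ^ b" and m: "vs s vM = int m" "int m \<le> 2 ^ b"
    and t: "vs s vT = int t" "int t \<le> 2 ^ b" and d: "int d \<le> 2 ^ b"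
    and Z: "\<And>k i. k \<le> m \<Longrightarrow> i < d \<Longrightarrow> \<bar>ar s aZ k i - 1\<bar> \<le> 2 ^ b"
    and Q: "\<And>s'. frame (eps_prog d) s s' \<Longrightarrow> vs s' vTT = int (t div (m + 1) ^ d) \<Longrightarrow>
       (\<And>i. i < d \<Longrightarrow>
          ar s' aE 0 (2 * i) = fst (quotient_of (of_int (ar s aZ (digit m t i) i - 1) / of_int D)) \<and>
          ar s' aE 0 (2 * i + 1) = snd (quotient_of (of_int (ar s aZ (digit m t i) i - 1) / of_int D))) \<Longrightarrow>
       tm s' \<le> tm s + (d * (8 * b + 22) + 3) \<Longrightarrow> Q s'"
  shows "wp w (2 ^ b) (eps_prog d) s Q"
proof -
  let ?V = "2 ^ b :: int"
  let ?r = "\<lambda>i. of_int (ar s aZ (digit m t i) i - 1) / of_int D :: rat"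
  let ?s0 = "s\<lparr>vs := (vs s)(vTT := int t), tm := tm s + 1\<rparr>"
  have "wp w ?V (eps_prog d) s (\<lambda>s'. frame (eps_prog d) s s' \<longrightarrow> Q s')"
    unfolding eps_prog_def wp_simps
  proof (intro conjI)
    show "\<bar>aval (Var vT) (vs s)\<bar> \<le> ?V" using t by simp
    have t0: "aval (Var vT) (vs s) = int t" using t by simp
    let ?c = "vK ::= Var vTT \<^bold>- (Var vM \<^bold>+ Lit 1) \<^bold>* (Var vTT \<^bold>/ (Var vM \<^bold>+ Lit 1));;
       vTT ::= Var vTT \<^bold>/ (Var vM \<^bold>+ Lit 1);;
       Fetch vU aZ (Var vK) (Var vI);; vU ::= Var vU \<^bold>- Lit 1;;
       norm_prog;;
       Put aE (Lit 0) (Lit 2 \<^bold>* Var vI) (Var vP);;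
       Put aE (Lit 0) (Lit 2 \<^bold>* Var vI \<^bold>+ Lit 1) (Var vQ)"
    show "wp w ?V (For vI (Lit (int d)) ?c) (s\<lparr>vs := (vs s)(vTT := aval (Var vT) (vs s)), tm := tm s + 1\<rparr>)
      (\<lambda>s'. frame (vTT ::= Var vT;; For vI (Lit (int d)) ?c) s s' \<longrightarrow> Q s')"
      unfolding t0
    proof (rule wp_For[where h = d and T = "8 * b + 20" and I = "\<lambda>j s'. vs s' vTT = int (t div (m + 1) ^ j) \<and>
        (\<forall>i<j. ar s' aE 0 (2 * i) = fst (quotient_of (?r i)) \<and> ar s' aE 0 (2 * i + 1) = snd (quotient_of (?r i)))"])
      fix j s' assume j: "j < d" and
        I: "vs s' vTT = int (t div (m + 1) ^ j) \<and> (\<forall>i<j. ar s' aE 0 (2 * i) = fst (quotient_of (?r i)) \<and>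
           ar s' aE 0 (2 * i + 1) = snd (quotient_of (?r i)))"
        and f: "frame (For vI (Lit (int d)) ?c) ?s0 s'" and i: "vs s' vI = int j"
      have fr: "vs s' vD = D" "vs s' vM = int m" "ar s' aZ = ar s aZ"
        using f D m by (auto simp: frame_def)
      have k: "int (t div (m + 1) ^ j) - (int m + 1) * (int (t div (m + 1) ^ j) div (int m + 1)) = int (digit m t j)"
        unfolding digit_def zmod_int by (simp add: minus_mult_div_eq_mod ac_simps)
      have tt: "int (t div (m + 1) ^ j) div (int m + 1) = int (t div (m + 1) ^ Suc j)"
        unfolding power_Suc2 div_mult2_eq by (simp add: zdiv_int ac_simps)
      have dm: "digit m t j \<le> m" by (simp add: digit_def less_Suc_eq_le[symmetric])
      have tb: "int (t div (m + 1) ^ Suc j) \<le> ?V"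
        using t(2) by (meson div_le_dividend of_nat_mono order_trans)
      have zb: "\<bar>ar s aZ (digit m t j) j - 1\<bar> \<le> ?V" using Z[OF dm j] .
      have qb: "\<bar>fst (quotient_of (?r j))\<bar> \<le> ?V" "\<bar>snd (quotient_of (?r j))\<bar> \<le> ?V"
        using quotient_of_bounds[OF D(2), of "ar s aZ (digit m t j) j - 1"] zb D by auto
      let ?s1 = "s'\<lparr>vs := (vs s')(vK := int (digit m t j), vTT := int (t div (m + 1) ^ Suc j),
         vU := ar s aZ (digit m t j) j - 1), tm := Suc (Suc (Suc (Suc (tm s'))))\<rparr>"
      have "wp w ?V norm_prog ?s1 (\<lambda>s2. wp w ?V
         (Put aE (Lit 0) (Lit 2 \<^bold>* Var vI) (Var vP);;
          Put aE (Lit 0) (Lit 2 \<^bold>* Var vI \<^bold>+ Lit 1) (Var vQ)) s2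
         (\<lambda>s''. (vs s'' vTT = int (t div (m + 1) ^ Suc j) \<and>
            (\<forall>i<Suc j. ar s'' aE 0 (2 * i) = fst (quotient_of (?r i)) \<and>
              ar s'' aE 0 (2 * i + 1) = snd (quotient_of (?r i)))) \<and>
            tm s'' \<le> tm s' + (8 * b + 20)))"
      proof (rule wp_norm[where D = D and u = "ar s aZ (digit m t j) j - 1"])
        fix s2 assume f2: "frame norm_prog ?s1 s2"
          and q: "vs s2 vP = fst (quotient_of (?r j))" "vs s2 vQ = snd (quotient_of (?r j))"
          and t2: "tm s2 \<le> tm ?s1 + (8 * b + 14)"
        have "vs s2 vI = int j" "vs s2 vTT = int (t div (m + 1) ^ Suc j)" "ar s2 = ar s'"
          using f2 i by (auto simp: frame_def)
        then show "wp w ?V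
         (Put aE (Lit 0) (Lit 2 \<^bold>* Var vI) (Var vP);;
          Put aE (Lit 0) (Lit 2 \<^bold>* Var vI \<^bold>+ Lit 1) (Var vQ)) s2
         (\<lambda>s''. (vs s'' vTT = int (t div (m + 1) ^ Suc j) \<and>
            (\<forall>i<Suc j. ar s'' aE 0 (2 * i) = fst (quotient_of (?r i)) \<and>
              ar s'' aE 0 (2 * i + 1) = snd (quotient_of (?r i)))) \<and>
            tm s'' \<le> tm s' + (8 * b + 20))"
          using q qb t2 I by (auto simp: arr_upd_def nat_add_distrib nat_mult_distrib less_Suc_eq)
      qed (use fr D zb in auto)
      moreover have "int (digit m t j) \<le> ?V" using dm m(2) by linarith
      ultimately show "wp w ?V ?c s' (\<lambda>s''. (vs s'' vTT = int (t div (m + 1) ^ Suc j) \<and>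
            (\<forall>i<Suc j. ar s'' aE 0 (2 * i) = fst (quotient_of (?r i)) \<and>
              ar s'' aE 0 (2 * i + 1) = snd (quotient_of (?r i)))) \<and>
            tm s'' \<le> tm s' + (8 * b + 20))"
        using I i fr k tt tb zb by (simp add: ac_simps)
    next
      fix s' :: st assume I: "vs s' vTT = int (t div (m + 1) ^ d) \<and> (\<forall>i<d. ar s' aE 0 (2 * i) = fst (quotient_of (?r i)) \<and>
           ar s' aE 0 (2 * i + 1) = snd (quotient_of (?r i)))"
         and t: "tm s' \<le> tm ?s0 + d * (8 * b + 20 + 2) + 2"
      show "frame (vTT ::= Var vT;; For vI (Lit (int d)) ?c) s s' \<longrightarrow> Q s'"
        by (intro impI, rule Q) (use I t in \<open>auto simp: eps_prog_def algebra_simps\<close>)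
    qed (use d in auto)
  qed
  then show ?thesis by (rule wp_frame)
qed

lemma wp_SeqI:
  assumes "wp w V c s R" "\<And>s'. frame c s s' \<Longrightarrow> R s' \<Longrightarrow> wp w V d s' Q"
  shows "wp w V (Seq c d) s Q"
  unfolding wp_simps using assms by (rule wp_mono)

lemma arr_upd_fun: "arr_upd h a i j v = h(a := (h a)(i := (h a i)(j := v)))"
  by (auto simp: arr_upd_def fun_eq_iff)

section \<open>Simulating the machine for the scalarization\<close>

definition next_instr :: com where
  "next_instr = (vPC ::= Var vPC \<^bold>+ Lit 1)"

definition get_cell :: "nat \<Rightarrow> nat \<Rightarrow> com" where
  "get_cell x r = Fetch x aM (Var vCall) (Lit (int r))"

definition put_cell :: "nat \<Rightarrow> aexp \<Rightarrow> com" where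
  "put_cell r e = Put aM (Var vCall) (Lit (int r)) e"

definition matrix_end :: "nat \<Rightarrow> aexp" where
  "matrix_end d = Lit 3 \<^bold>+ Lit (2 * int d) \<^bold>* Var vN"

text \<open>The input of the scalarization differs from that of the enumeration by the code of the
  right-hand side, inserted between matrix and description.\<close>

definition read_spliced :: "nat \<Rightarrow> com" where
  "read_spliced d =
    Cond (matrix_end d \<^bold>- Var vX) (Read vY (Var vX))
     (Cond (matrix_end d \<^bold>+ Lit (2 * int d) \<^bold>- Var vX)
       (Fetch vY aE (Lit 0) (Var vX \<^bold>- matrix_end d))
       (Read vY (Var vX \<^bold>- Lit (2 * int d))))"

primrec sim_instr :: "nat \<Rightarrow> instr \<Rightarrow> com" where
  "sim_instr d (Const r c) = (put_cell r (Lit c);; next_instr)"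
| "sim_instr d (Arith f r s t) =
    (get_cell vX s;; get_cell vY t;; put_cell r (Bin f (Var vX) (Var vY));; next_instr)"
| "sim_instr d (Load r s) =
    (get_cell vX s;; Fetch vX aM (Var vCall) (Var vX);; put_cell r (Var vX);; next_instr)"
| "sim_instr d (Store r s) =
    (get_cell vX r;; get_cell vY s;; Put aM (Var vCall) (Var vX) (Var vY);; next_instr)"
| "sim_instr d (Input r s) =
    (get_cell vX s;; read_spliced d;; put_cell r (Var vY);; next_instr)"
| "sim_instr d (Output r) =
    (get_cell vX r;; Put aO (Lit 0) (Var vOL) (Var vX);; vOL ::= Var vOL \<^bold>+ Lit 1;; next_instr)"
| "sim_instr d (Jump l) = (vPC ::= Lit (int l))"
| "sim_instr d (JumpPos r l) = (get_cell vX r;; Cond (Var vX) (vPC ::= Lit (int l)) next_instr)"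
| "sim_instr d Halt = (vH ::= Lit 0)"

text \<open>The simulated program is unrolled into a chain of comparisons with the program counter.
  Conditions only test for positivity, so equality is expressed by one minus the squared difference
  being positive.\<close>

primrec sim_step :: "nat \<Rightarrow> nat \<Rightarrow> ram \<Rightarrow> com" where
  "sim_step d k [] = Skip"
| "sim_step d k (i # is) =
    Cond (Lit 1 \<^bold>- (Var vPC \<^bold>- Lit (int k)) \<^bold>* (Var vPC \<^bold>- Lit (int k)))
      (sim_instr d i) (sim_step d (Suc k) is)"

definition sim_prog :: "nat \<Rightarrow> ram \<Rightarrow> com" where
  "sim_prog d M = (vCall ::= Var vCall \<^bold>+ Lit 1;; vPC ::= Lit 0;; vOL ::= Lit 0;; vH ::= Lit 1;;
     Loop (Var vH) (sim_step d 0 M))"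

lemmas sim_defs = next_instr_def get_cell_def put_cell_def read_spliced_def matrix_end_def

lemma sim_instr_mods:
  "mods (sim_instr d i) \<subseteq> {vX, vY, vPC, vOL, vH}" "amods (sim_instr d i) \<subseteq> {aM, aO}" "\<not> emits (sim_instr d i)"
  by (cases i; auto simp: sim_defs)+

lemma sim_step_mods:
  "mods (sim_step d k is) \<subseteq> {vX, vY, vPC, vOL, vH}" "amods (sim_step d k is) \<subseteq> {aM, aO}" "\<not> emits (sim_step d k is)"
  by (induction "is" arbitrary: k) (use sim_instr_mods in auto)

lemma sim_prog_mods:
  "mods (sim_prog d M) \<subseteq> {vCall, vX, vY, vPC, vOL, vH}" "amods (sim_prog d M) \<subseteq> {aM, aO}" "\<not> emits (sim_prog d M)"
  using sim_step_mods[of d 0 M] by (auto simp: sim_prog_def)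

text \<open>Formulated through \<open>read_input\<close>, so positions beyond the end, which read as
  0, are covered as well.\<close>

definition spliced :: "int list \<Rightarrow> nat \<Rightarrow> nat \<Rightarrow> (nat \<Rightarrow> int) \<Rightarrow> int list \<Rightarrow> bool" where
  "spliced w d n e w' \<longleftrightarrow> (\<forall>a. read_input w' a =
    (if a < 3 + 2 * d * n then read_input w a
     else if a < 3 + 2 * d * n + 2 * d then e (a - (3 + 2 * d * n))
     else read_input w (a - 2 * d)))"

fun represents :: "st \<Rightarrow> config \<Rightarrow> bool" where
  "represents s (pc, m, out) \<longleftrightarrow> vs s vPC = int pc \<and> ar s aM (nat (vs s vCall)) = m \<and>
     vs s vOL = int (length out) \<and> (\<forall>j<length out. ar s aO 0 j = out ! j)"

lemma wp_read_spliced: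
  assumes "vs s vN = int n" "spliced w d n (ar s aE 0) w'" "0 \<le> vs s vX"
    and "\<bar>read_input w' (nat (vs s vX))\<bar> \<le> V"
    and "\<And>t. t \<le> tm s + 3 \<Longrightarrow> Q (s\<lparr>vs := (vs s)(vY := read_input w' (nat (vs s vX))), tm := t\<rparr>)"
  shows "wp w V (read_spliced d) s Q"
proof -
  obtain a where a: "vs s vX = int a" using assms(3) by (metis nonneg_int_cases)
  obtain L where L: "L = 3 + 2 * d * n" by blast
  have r: "read_input w' a =
    (if a < L then read_input w a else if a < L + 2 * d then ar s aE 0 (a - L) else read_input w (a - 2 * d))"
    using assms(2) by (simp add: spliced_def L)
  have m: "aval (matrix_end d) (vs s) = int L" using assms(1) by (simp add: matrix_end_def L)
  consider "a < L" | "\<not> a < L" "a < L + 2 * d" | "\<not> a < L" "\<not> a < L + 2 * d"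
    by linarith
  then show ?thesis
  proof cases
    case 1
    then show ?thesis unfolding read_spliced_def using assms(4) assms(5)[of "tm s + 2"] m a r by simp
  next
    case 2
    then have "nat (int a - int L) = a - L" by linarith
    then show ?thesis unfolding read_spliced_def using 2 assms(5)[of "Suc (Suc (Suc (tm s)))"] m a r by simp
  next
    case 3
    then have "nat (int a - 2 * int d) = a - 2 * d" "\<not> int a < int L + 2 * int d" by linarith+
    then show ?thesis unfolding read_spliced_def using 3 assms(4) assms(5)[of "Suc (Suc (Suc (tm s)))"] m a r by simp
  qed
qed

text \<open>Because \<open>exec\<close> succeeds, \<open>Halt\<close> and negative addresses are
  excluded, and the bounds on the simulated memory before and after the instruction justify every
  store. The clause on other rows keeps the memories of later calls untouched.\<close>

lemma wp_sim_instr: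
  assumes ex: "exec w' ins (pc, m, out) = Some (pc', m', out')"
    and rep: "represents s (pc, m, out)"
    and bd: "\<forall>a. \<bar>m a\<bar> \<le> V" "\<forall>a. \<bar>m' a\<bar> \<le> V" "int pc \<le> V" "int pc' \<le> V" "int (length out') \<le> V"
    and c: "0 \<le> vs s vCall" and n: "vs s vN = int n" and w': "spliced w d n (ar s aE 0) w'"
  shows "wp w V (sim_instr d ins) s (\<lambda>s'. represents s' (pc', m', out') \<and> vs s' vH = vs s vH \<and>
     (\<forall>c. c \<noteq> nat (vs s vCall) \<longrightarrow> ar s' aM c = ar s aM c) \<and> tm s' \<le> tm s + 8)"
proof (cases ins)
  case (Const r z)
  then have "\<bar>z\<bar> \<le> V" using ex spec[OF bd(2), of r] by auto
  then show ?thesis using assms Const by (auto simp: sim_defs arr_upd_fun)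
next
  case (Arith f r x y)
  then have "\<bar>arith f (m x) (m y)\<bar> \<le> V" using ex spec[OF bd(2), of r] by auto
  then show ?thesis using assms Arith by (auto simp: sim_defs arr_upd_fun)
next
  case (Load r x)
  then have "0 \<le> m x" "\<bar>m (nat (m x))\<bar> \<le> V" using ex bd(1) by (auto split: if_splits)
  then show ?thesis using assms Load by (auto simp: sim_defs arr_upd_fun)
next
  case (Store r x)
  then have "0 \<le> m r" "\<bar>m x\<bar> \<le> V" using ex bd(1) by (auto split: if_splits)
  then show ?thesis using assms Store by (auto simp: sim_defs arr_upd_fun)
next
  case (Input r x)
  let ?v = "read_input w' (nat (m x))"
  have m': "m' = m(r := ?v)" "0 \<le> m x" "pc' = Suc pc" "out' = out"
    using ex Input by (auto simp: read_input_def split: if_splits)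
  have v: "\<bar>?v\<bar> \<le> V" using spec[OF bd(2), of r] m' by simp
  show ?thesis unfolding Input sim_instr.simps
  proof (rule wp_SeqI)
    show "wp w V (get_cell vX x) s (\<lambda>s'. s' = s\<lparr>vs := (vs s)(vX := m x), tm := tm s + 1\<rparr>)"
      using rep c by (auto simp: sim_defs)
    fix s1 assume s1: "s1 = s\<lparr>vs := (vs s)(vX := m x), tm := tm s + 1\<rparr>"
    show "wp w V (read_spliced d;; put_cell r (Var vY);; next_instr) s1 (\<lambda>s'. represents s' (pc', m', out') \<and> vs s' vH = vs s vH \<and>
     (\<forall>c. c \<noteq> nat (vs s vCall) \<longrightarrow> ar s' aM c = ar s aM c) \<and> tm s' \<le> tm s + 8)"
      unfolding wp_simps(7)
      by (rule wp_read_spliced[where n = n and w' = w'])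
        (use s1 m' v n w' c rep bd in \<open>auto simp: next_instr_def put_cell_def arr_upd_fun\<close>)
  qed
next
  case (Output r)
  have "\<bar>m r\<bar> \<le> V" using bd(1) by blast
  then show ?thesis using assms Output by (auto simp: sim_defs arr_upd_fun nth_append)
next
  case (Jump l)
  then show ?thesis using assms by (auto simp: sim_defs)
next
  case (JumpPos r l)
  then show ?thesis using assms by (auto simp: sim_defs split: if_splits)
next
  case Halt
  then show ?thesis using ex by simp
qed

text \<open>The \<open>i\<close> failing comparisons and the successful one cost
  \<open>i + 1\<close> ticks.\<close>

lemma wp_sim_step:
  assumes "vs s vPC = int (k + i)" "i < length is" "wp w V (sim_instr d (is ! i)) (s\<lparr>tm := tm s + i + 1\<rparr>) Q"
  shows "wp w V (sim_step d k is) s Q"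
  using assms
proof (induction "is" arbitrary: k i s)
  case (Cons x xs)
  show ?case
  proof (cases i)
    case 0
    then show ?thesis using Cons.prems by simp
  next
    case (Suc j)
    have "\<not> 0 < 1 - (vs s vPC - int k) * (vs s vPC - int k)"
      using Cons.prems(1) Suc mult_mono[of 1 "1 + int j" 1 "1 + int j"] by simp
    then show ?thesis
      using Cons.IH[of "s\<lparr>tm := tm s + 1\<rparr>" "Suc k" j] Cons.prems Suc by simp
  qed
qed simp

section \<open>Prefixes of a halting run\<close>

lemma run_mono: "run M w k = Some c \<Longrightarrow> j \<le> k \<Longrightarrow> \<exists>c'. run M w j = Some c'"
proof (induction k arbitrary: c)
  case (Suc k)
  obtain c1 where "run M w k = Some c1" using Suc.prems(1) by (auto simp: bind_eq_Some_conv)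
  then show ?case using Suc by (cases "j = Suc k") (blast, simp)
qed auto

lemma exec_output_length: "exec w i (pc, m, out) = Some (pc', m', out') \<Longrightarrow> length out' \<le> Suc (length out)"
  by (cases i) (auto split: if_splits)

lemma run_output_length: "run M w k = Some (pc, m, out) \<Longrightarrow> length out \<le> k"
proof (induction k arbitrary: pc m out)
  case (Suc k)
  then obtain pc1 m1 out1 where 1: "run M w k = Some (pc1, m1, out1)" "step M w (pc1, m1, out1) = Some (pc, m, out)"
    by (auto simp: bind_eq_Some_conv)
  then show ?case using Suc.IH[OF 1(1)] exec_output_length[of w _ pc1 m1 out1]
    by (fastforce simp: step_def split: if_splits)
qed auto

text \<open>Every configuration before the end lies inside the program, since otherwise the run
  would be stuck; hence the dispatch always finds an instruction. Entries of \<open>aO\<close> left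
  over from earlier calls may follow the answer, so only the positions below
  \<open>length out\<close> are described.\<close>

lemma wp_sim:
  assumes run: "run M w' k = Some (pc, m, out)" "pc < length M" "M ! pc = Halt"
    and bd: "\<And>j pc m out a. j \<le> k \<Longrightarrow> run M w' j = Some (pc, m, out) \<Longrightarrow> \<bar>m a\<bar> \<le> V"
    and V: "int (length M) \<le> V" "int k \<le> V" "int c + 1 \<le> V" "1 \<le> V"
    and c: "vs s vCall = int c" "\<And>a. ar s aM (Suc c) a = 0"
    and n: "vs s vN = int n" and w': "spliced w d n (ar s aE 0) w'"
    and Q: "\<And>s'. frame (sim_prog d M) s s' \<Longrightarrow> vs s' vCall = int (Suc c) \<Longrightarrow>
      (\<And>j. j < length out \<Longrightarrow> ar s' aO 0 j = out ! j) \<Longrightarrow>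
      (\<And>c'. c' \<noteq> Suc c \<Longrightarrow> ar s' aM c' = ar s aM c') \<Longrightarrow>
      tm s' \<le> tm s + ((k + 1) * (length M + 10) + 5) \<Longrightarrow> Q s'"
  shows "wp w V (sim_prog d M) s Q"
proof -
  have nomod: "vCall \<notin> mods (sim_step d 0 M)" "vN \<notin> mods (sim_step d 0 M)" "aE \<notin> amods (sim_step d 0 M)"
    using sim_step_mods[of d 0 M] by auto
  let ?s0 = "s\<lparr>vs := (vs s)(vCall := int (Suc c), vPC := 0, vOL := 0, vH := 1), tm := Suc (Suc (Suc (Suc (tm s))))\<rparr>"
  let ?rows = "\<lambda>s'::st. \<forall>c'. c' \<noteq> Suc c \<longrightarrow> ar s' aM c' = ar s aM c'"
  \<comment> \<open>There are \<open>k\<close> simulated steps and one more iteration in which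
    \<open>Halt\<close> clears \<open>vH\<close>. After that the loop ends, so the index
    \<open>r\<close> is left free.\<close>
  let ?I = "\<lambda>r (s'::st). ?rows s' \<and>
     ((\<exists>j cfg. j \<le> k \<and> r = k + 1 - j \<and> run M w' j = Some cfg \<and> represents s' cfg \<and> vs s' vH = 1) \<or>
      (vs s' vH = 0 \<and> represents s' (pc, m, out)))"
  have *: "wp w V (Loop (Var vH) (sim_step d 0 M)) ?s0 (\<lambda>s'. frame (sim_prog d M) s s' \<longrightarrow> Q s')"
  proof (rule wp_Loop[where I = ?I and n = "k + 1" and T = "length M + 9"])
    have "represents ?s0 (0, \<lambda>_. 0, [])" using c by (auto simp: nat_add_distrib)
    then show "?I (k + 1) ?s0"
      by (auto intro!: exI[of _ "0::nat"])
  next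
    fix r and s' :: st
    assume I: "?I r s'" and f: "frame (sim_step d 0 M) ?s0 s'" and pos: "0 < aval (Var vH) (vs s')"
    then obtain j pc1 m1 out1 where j: "j \<le> k" "r = k + 1 - j" "run M w' j = Some (pc1, m1, out1)"
       and rep: "represents s' (pc1, m1, out1)" "vs s' vH = 1" and rows: "?rows s'" by auto
    have fr: "vs s' vCall = int (Suc c)" "vs s' vN = int n" "ar s' aE = ar s aE"
      using f[unfolded frame_def] nomod n by simp_all
    have pc1: "pc1 < length M"
    proof (cases "j = k")
      case False
      then have "\<exists>c. run M w' (Suc j) = Some c" using j(1) by (intro run_mono[OF run(1)]) simp
      then show ?thesis using j(3) by (auto simp: step_def bind_eq_Some_conv split: if_splits)
    qed (use run j in auto)
    show "wp w V (sim_step d 0 M) (s'\<lparr>tm := tm s' + 1\<rparr>) (\<lambda>s''. (\<exists>k'<r. ?I k' s'') \<and> tm s'' \<le> tm s' + 1 + (length M + 9))"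
    proof (rule wp_sim_step[where i = pc1])
      let ?s1 = "s'\<lparr>tm := tm (s'\<lparr>tm := tm s' + 1\<rparr>) + pc1 + 1\<rparr>"
      show "vs (s'\<lparr>tm := tm s' + 1\<rparr>) vPC = int (0 + pc1)" "pc1 < length M" using rep pc1 by auto
      have "wp w V (sim_instr d (M ! pc1)) ?s1 (\<lambda>s''. (\<exists>k'<r. ?I k' s'') \<and> tm s'' \<le> tm s' + 1 + (length M + 9))"
      proof (cases "j = k")
        case True
        then have e: "(pc1, m1, out1) = (pc, m, out)" using run j by simp
        have "\<exists>k'<r. True" using j True by auto
        then show ?thesis using run(3) e rep rows pc1 V by auto
      next
        case False
        then obtain pc2 m2 out2 where 2: "run M w' (Suc j) = Some (pc2, m2, out2)" using run_mono[OF run(1), of "Suc j"] j(1) by (metis Suc_leI le_neq_implies_less prod_cases3)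
        then have ex: "exec w' (M ! pc1) (pc1, m1, out1) = Some (pc2, m2, out2)"
          using j(3) pc1 by (auto simp: step_def)
        have pc2: "pc2 < length M"
        proof (cases "Suc j = k")
          case False
          then have "\<exists>c. run M w' (Suc (Suc j)) = Some c" using j(1) \<open>j \<noteq> k\<close> by (intro run_mono[OF run(1)]) simp
          then show ?thesis using 2 by (auto simp del: run.simps simp: run.simps(2)[of M w' "Suc j"] step_def split: if_splits)
        qed (use run 2 in auto)
        have sj: "Suc j \<le> k" using False j by simp
        have len: "length out2 \<le> k" using run_output_length[OF 2] sj by simp
        have "wp w V (sim_instr d (M ! pc1)) ?s1 (\<lambda>s''. represents s'' (pc2, m2, out2) \<and> vs s'' vH = vs ?s1 vH \<and>
           (\<forall>c. c \<noteq> nat (vs ?s1 vCall) \<longrightarrow> ar s'' aM c = ar ?s1 aM c) \<and> tm s'' \<le> tm ?s1 + 8)"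
        proof (rule wp_sim_instr[OF ex])
          show "\<forall>a. \<bar>m1 a\<bar> \<le> V" "\<forall>a. \<bar>m2 a\<bar> \<le> V" using bd[OF j(1,3)] bd[OF sj 2] by auto
        qed (use rep fr V pc1 pc2 len n w' in auto)
        then show ?thesis
        proof (rule wp_mono)
          fix s2 assume s2: "represents s2 (pc2, m2, out2) \<and> vs s2 vH = vs ?s1 vH \<and>
           (\<forall>c. c \<noteq> nat (vs ?s1 vCall) \<longrightarrow> ar s2 aM c = ar ?s1 aM c) \<and> tm s2 \<le> tm ?s1 + 8"
          have "nat (vs ?s1 vCall) = Suc c" using fr by simp
          then have "?rows s2" using s2 rows by auto
          then have "?I (k + 1 - Suc j) s2" using s2 sj 2 rep(2) by auto
          moreover have "k + 1 - Suc j < r" using j sj by simp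
          ultimately show "(\<exists>k'<r. ?I k' s2) \<and> tm s2 \<le> tm s' + 1 + (length M + 9)"
            using s2 pc1 by (auto simp del: represents.simps)
        qed
      qed
      then show "wp w V (sim_instr d (M ! pc1)) (s'\<lparr>tm := tm s' + 1, tm := tm (s'\<lparr>tm := tm s' + 1\<rparr>) + pc1 + 1\<rparr>)
         (\<lambda>s''. (\<exists>k'<r. ?I k' s'') \<and> tm s'' \<le> tm s' + 1 + (length M + 9))" by simp
    qed
  next
    fix r and s' :: st
    assume I: "?I r s'" and f: "frame (sim_step d 0 M) ?s0 s'" and neg: "\<not> 0 < aval (Var vH) (vs s')"
      and t: "tm s' \<le> tm ?s0 + (k + 1) * (length M + 9 + 1)"
    have "vs s' vCall = int (Suc c)" using f[unfolded frame_def] nomod by simp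
    then show "frame (sim_prog d M) s (s'\<lparr>tm := tm s' + 1\<rparr>) \<longrightarrow> Q (s'\<lparr>tm := tm s' + 1\<rparr>)"
      using I neg t by (intro impI Q) (auto simp: algebra_simps)
  qed
  show ?thesis
    by (rule wp_frame) (use * c V in \<open>simp add: sim_prog_def add.commute\<close>)
qed

section \<open>Clearing denominators\<close>

text \<open>Three header numbers precede the matrix, so entry \<open>k\<close> in row-major order
  has its numerator at \<open>2 * k + 3\<close> and its denominator at \<open>2 * k + 4\<close>. One
  plus the sum of the absolute entries strictly exceeds the scaled objective at any 0/1 vector,
  which makes row 0 of \<open>aZ\<close> vacuous as a bound.\<close>

definition init_prog :: "nat \<Rightarrow> com" where
  "init_prog d =
    (Read vN (Lit 0);; vD ::= Lit 1;;
     For vK (Lit (int d) \<^bold>* Var vN)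
       (Read vX (Lit 2 \<^bold>* Var vK \<^bold>+ Lit 4);; vD ::= Var vD \<^bold>* Var vX);;
     For vI (Lit (int d))
       ((vS ::= Lit 1;;
         For vJ (Var vN)
          (vK ::= Var vI \<^bold>* Var vN \<^bold>+ Var vJ;;
           Read vX (Lit 2 \<^bold>* Var vK \<^bold>+ Lit 3);; Read vY (Lit 2 \<^bold>* Var vK \<^bold>+ Lit 4);;
           vX ::= Var vX \<^bold>* (Var vD \<^bold>/ Var vY);; Put aN (Var vI) (Var vJ) (Var vX);;
           Cond (Var vX) (vS ::= Var vS \<^bold>+ Var vX) (vS ::= Var vS \<^bold>- Var vX)));;
        Put aZ (Lit 0) (Var vI) (Var vS)))"

definition num_at :: "int list \<Rightarrow> nat \<Rightarrow> int" where
  "num_at w k = read_input w (2 * k + 3)"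

definition den_at :: "int list \<Rightarrow> nat \<Rightarrow> int" where
  "den_at w k = read_input w (2 * k + 4)"

definition den_prod :: "int list \<Rightarrow> nat \<Rightarrow> int" where
  "den_prod w k = (\<Prod>l<k. den_at w l)"

definition cleared :: "int list \<Rightarrow> nat \<Rightarrow> nat \<Rightarrow> nat \<Rightarrow> nat \<Rightarrow> int" where
  "cleared w d n i j = num_at w (i * n + j) * (den_prod w (d * n) div den_at w (i * n + j))"

lemma init_prog_mods [simp]:
  "mods (init_prog d) = {vN, vD, vK, vX, vI, vS, vJ, vY}" "amods (init_prog d) = {aN, aZ}" "\<not> emits (init_prog d)"
  by (auto simp: init_prog_def)

text \<open>Bounds on final values suffice: partial products divide \<open>den_prod\<close>, and
  partial sums of absolute values increase towards the full sum.\<close>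

lemma wp_init:
  assumes n: "read_input w 0 = int n"
    and den: "\<And>k. k < d * n \<Longrightarrow> 0 < den_at w k" and num: "\<And>k. k < d * n \<Longrightarrow> \<bar>num_at w k\<bar> \<le> V"
    and DV: "den_prod w (d * n) \<le> V"
    and NV: "\<And>i. i < d \<Longrightarrow> 1 + (\<Sum>j<n. \<bar>cleared w d n i j\<bar>) \<le> V"
    and V: "int d \<le> V" "int n \<le> V" "int d * int n \<le> V" "1 \<le> V"
    and Q: "\<And>s'. frame (init_prog d) s s' \<Longrightarrow> vs s' vN = int n \<Longrightarrow> vs s' vD = den_prod w (d * n) \<Longrightarrow>
      (\<And>i j. i < d \<Longrightarrow> j < n \<Longrightarrow> ar s' aN i j = cleared w d n i j) \<Longrightarrow>
      (\<And>i. i < d \<Longrightarrow> ar s' aZ 0 i = 1 + (\<Sum>j<n. \<bar>cleared w d n i j\<bar>)) \<Longrightarrow>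
      tm s' \<le> tm s + (d * n * 4 + d * (n * 9 + 7) + 6) \<Longrightarrow> Q s'"
  shows "wp w V (init_prog d) s Q"
proof -
  let ?D = "den_prod w (d * n)"
  have dp: "0 < den_prod w k" "den_prod w k \<le> ?D" if "k \<le> d * n" for k
  proof -
    show "0 < den_prod w k" unfolding den_prod_def using that by (intro prod_pos) (auto intro: den)
    have D: "0 < ?D" unfolding den_prod_def by (intro prod_pos) (auto intro: den)
    have "den_prod w k dvd ?D" unfolding den_prod_def using that by (intro prod_dvd_prod_subset) auto
    then show "den_prod w k \<le> ?D" using D by (rule zdvd_imp_le)
  qed
  have den_le: "den_at w k \<le> ?D" if "k < d * n" for k
  proof -
    have "den_at w k dvd ?D" unfolding den_prod_def using that by (intro dvd_prodI) auto
    then show ?thesis using dp[of "d * n"] by (intro zdvd_imp_le) auto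
  qed
  let ?b1 = "Read vX (Lit 2 \<^bold>* Var vK \<^bold>+ Lit 4);; vD ::= Var vD \<^bold>* Var vX"
  let ?b3 = "vK ::= Var vI \<^bold>* Var vN \<^bold>+ Var vJ;;
           Read vX (Lit 2 \<^bold>* Var vK \<^bold>+ Lit 3);; Read vY (Lit 2 \<^bold>* Var vK \<^bold>+ Lit 4);;
           vX ::= Var vX \<^bold>* (Var vD \<^bold>/ Var vY);; Put aN (Var vI) (Var vJ) (Var vX);;
           Cond (Var vX) (vS ::= Var vS \<^bold>+ Var vX) (vS ::= Var vS \<^bold>- Var vX)"
  let ?l2 = "vS ::= Lit 1;; For vJ (Var vN) ?b3"
  let ?b2 = "?l2;; Put aZ (Lit 0) (Var vI) (Var vS)"
  let ?l1 = "For vK (Lit (int d) \<^bold>* Var vN) ?b1"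
  let ?S = "\<lambda>i k. 1 + (\<Sum>j<k. \<bar>cleared w d n i j\<bar>)"
  have inner: "wp w V ?b2 s2 (\<lambda>s3. (\<forall>i'<Suc i. (\<forall>j<n. ar s3 aN i' j = cleared w d n i' j) \<and> ar s3 aZ 0 i' = ?S i' n) \<and>
       tm s3 \<le> tm s2 + (n * 9 + 5))"
    if i: "i < d" and s2: "vs s2 vN = int n" "vs s2 vD = ?D" "vs s2 vI = int i"
      "\<forall>i'<i. (\<forall>j<n. ar s2 aN i' j = cleared w d n i' j) \<and> ar s2 aZ 0 i' = ?S i' n" for i s2
  proof (rule wp_SeqI)
    let ?R = "\<lambda>k (s3::st). vs s3 vS = ?S i k \<and> (\<forall>j<k. ar s3 aN i j = cleared w d n i j) \<and>
        (\<forall>i'. i' \<noteq> i \<longrightarrow> ar s3 aN i' = ar s2 aN i')"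
    have Sle: "?S i k \<le> V" if "k \<le> n" for k
    proof -
      have "?S i k \<le> ?S i n" using that by (intro add_left_mono sum_mono2) auto
      then show ?thesis using NV[OF i] by linarith
    qed
    have "wp w V (For vJ (Var vN) ?b3) (s2\<lparr>vs := (vs s2)(vS := 1), tm := tm s2 + 1\<rparr>)
       (\<lambda>s3. ?R n s3 \<and> tm s3 \<le> tm s2 + (n * 9 + 3))"
    proof (rule wp_For[where h = n and I = ?R and T = 7])
      fix j and s' :: st assume j: "j < n" and R: "?R j s'" and jj: "vs s' vJ = int j"
        and f: "frame (For vJ (Var vN) ?b3) (s2\<lparr>vs := (vs s2)(vS := 1), tm := tm s2 + 1\<rparr>) s'"
      have fr: "vs s' vN = int n" "vs s' vD = ?D" "vs s' vI = int i" using f s2 by (auto simp: frame_def)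
      define k where "k = i * n + j"
      have kk: "int i * int n + int j = int k" by (simp add: k_def)
      have "Suc i * n \<le> d * n" using i by (intro mult_right_mono) auto
      then have k: "k < d * n" using j by (simp add: k_def)
      have rd: "read_input w (nat (2 * int k + 3)) = num_at w k" "read_input w (nat (2 * int k + 4)) = den_at w k"
        by (simp_all add: num_at_def den_at_def nat_add_distrib nat_mult_distrib)
      have kV: "int k \<le> V" using k V(3) by (metis less_imp_le of_nat_le_iff of_nat_mult order_trans)
      have cl: "num_at w k * (?D div den_at w k) = cleared w d n i j" by (simp add: cleared_def k_def)
      have denV: "\<bar>den_at w k\<bar> \<le> V" using den_le[OF k] den[OF k] DV by simp
      have clV: "\<bar>cleared w d n i j\<bar> \<le> V" "\<bar>?S i j + cleared w d n i j\<bar> \<le> V" "\<bar>?S i j - cleared w d n i j\<bar> \<le> V"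
      proof -
        have "0 \<le> (\<Sum>j<j. \<bar>cleared w d n i j\<bar>)" by (rule sum_nonneg) simp
        moreover have "?S i (Suc j) = ?S i j + \<bar>cleared w d n i j\<bar>" by simp
        moreover have "?S i (Suc j) \<le> V" using j by (intro Sle) simp
        ultimately show "\<bar>cleared w d n i j\<bar> \<le> V" "\<bar>?S i j + cleared w d n i j\<bar> \<le> V" "\<bar>?S i j - cleared w d n i j\<bar> \<le> V" by linarith+
      qed
      show "wp w V ?b3 s' (\<lambda>s''. ?R (Suc j) s'' \<and> tm s'' \<le> tm s' + 7)"
        using R jj fr num[OF k] kV denV clV by (auto simp: kk rd cl arr_upd_fun less_Suc_eq)
    qed (use s2 V in auto)
    then show "wp w V ?l2 s2 (\<lambda>s3. ?R n s3 \<and> tm s3 \<le> tm s2 + (n * 9 + 3))" using V by simp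
    fix s3 assume f: "frame ?l2 s2 s3" and R: "?R n s3 \<and> tm s3 \<le> tm s2 + (n * 9 + 3)"
    have fr: "vs s3 vI = int i" "ar s3 aZ = ar s2 aZ" using f s2 by (auto simp: frame_def)
    have "\<bar>?S i n\<bar> \<le> V" using Sle[of n] sum_nonneg[of "{..<n}" "\<lambda>j. \<bar>cleared w d n i j\<bar>", OF abs_ge_zero] by simp
    then show "wp w V (Put aZ (Lit 0) (Var vI) (Var vS)) s3 (\<lambda>s3. (\<forall>i'<Suc i. (\<forall>j<n. ar s3 aN i' j = cleared w d n i' j) \<and> ar s3 aZ 0 i' = ?S i' n) \<and>
       tm s3 \<le> tm s2 + (n * 9 + 5))"
      using R fr s2(4) by (auto simp: arr_upd_fun less_Suc_eq)
  qed
  let ?s0 = "s\<lparr>vs := (vs s)(vN := int n, vD := 1), tm := Suc (Suc (tm s))\<rparr>"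
  have "wp w V (?l1;; For vI (Lit (int d)) ?b2) ?s0 (\<lambda>s'. frame (init_prog d) s s' \<longrightarrow> Q s')"
  proof (rule wp_SeqI)
    let ?R = "\<lambda>k (s'::st). vs s' vD = den_prod w k"
    show "wp w V ?l1 ?s0 (\<lambda>s'. ?R (d * n) s' \<and> tm s' \<le> tm s + (d * n * 4 + 4))"
    proof (rule wp_For[where h = "d * n" and I = ?R and T = 2])
      fix k and s' :: st assume k: "k < d * n" and R: "?R k s'" and kk: "vs s' vK = int k"
      have rd: "read_input w (nat (2 * int k + 4)) = den_at w k"
        by (simp add: den_at_def nat_add_distrib nat_mult_distrib)
      have "den_prod w (Suc k) = den_prod w k * den_at w k" by (simp add: den_prod_def)
      then show "wp w V ?b1 s' (\<lambda>s''. ?R (Suc k) s'' \<and> tm s'' \<le> tm s' + 2)"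
        using R kk den[OF k] den_le[OF k] DV dp[of "Suc k"] k by (auto simp: rd)
    qed (use V in \<open>auto simp: den_prod_def\<close>)
    fix s1 assume f: "frame ?l1 ?s0 s1" and R: "?R (d * n) s1 \<and> tm s1 \<le> tm s + (d * n * 4 + 4)"
    have fr: "vs s1 vN = int n" using f by (auto simp: frame_def)
    show "wp w V (For vI (Lit (int d)) ?b2) s1 (\<lambda>s'. frame (init_prog d) s s' \<longrightarrow> Q s')"
    proof (rule wp_For[where h = d and T = "n * 9 + 5" and
        I = "\<lambda>i s2. \<forall>i'<i. (\<forall>j<n. ar s2 aN i' j = cleared w d n i' j) \<and> ar s2 aZ 0 i' = ?S i' n"])
      fix i and s' :: st assume i: "i < d" and I: "\<forall>i'<i. (\<forall>j<n. ar s' aN i' j = cleared w d n i' j) \<and> ar s' aZ 0 i' = ?S i' n"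
        and f1: "frame (For vI (Lit (int d)) ?b2) s1 s'" and ii: "vs s' vI = int i"
      show "wp w V ?b2 s' (\<lambda>s3. (\<forall>i'<Suc i. (\<forall>j<n. ar s3 aN i' j = cleared w d n i' j) \<and> ar s3 aZ 0 i' = ?S i' n) \<and>
          tm s3 \<le> tm s' + (n * 9 + 5))"
        by (rule inner[OF i _ _ ii I]) (use f1 fr R in \<open>auto simp: frame_def\<close>)
    next
      fix s' :: st assume I: "\<forall>i'<d. (\<forall>j<n. ar s' aN i' j = cleared w d n i' j) \<and> ar s' aZ 0 i' = ?S i' n"
        and f1: "frame (For vI (Lit (int d)) ?b2) s1 s'" and t: "tm s' \<le> tm s1 + d * (n * 9 + 5 + 2) + 2"
      have "vs s' vN = int n" "vs s' vD = ?D" using f1 fr R by (auto simp: frame_def)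
      then show "frame (init_prog d) s s' \<longrightarrow> Q s'"
        using I t R by (intro impI Q) (auto simp: algebra_simps)
    qed (use V in auto)
  qed
  then have "wp w V (init_prog d) s (\<lambda>s'. frame (init_prog d) s s' \<longrightarrow> Q s')"
    using V n by (simp add: init_prog_def)
  then show ?thesis by (rule wp_frame)
qed

section \<open>Objective values of an answer\<close>

text \<open>The index shift for \<open>aO\<close> skips the leading 1 of a feasible answer. The
  result goes to row \<open>m + 1\<close>, which becomes a listed point simply by incrementing
  \<open>vM\<close>.\<close>

definition value_prog :: "nat \<Rightarrow> com" where
  "value_prog d =
    For vI (Lit (int d))
      ((vS ::= Lit 0;;
        For vJ (Var vN)
         (Fetch vX aN (Var vI) (Var vJ);; Fetch vY aO (Lit 0) (Var vJ \<^bold>+ Lit 1);;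
          vS ::= Var vS \<^bold>+ Var vX \<^bold>* Var vY));;
       Put aZ (Var vM \<^bold>+ Lit 1) (Var vI) (Var vS))"

lemma value_prog_mods [simp]:
  "mods (value_prog d) = {vI, vS, vJ, vX, vY}" "amods (value_prog d) = {aZ}" "\<not> emits (value_prog d)"
  by (auto simp: value_prog_def)

lemma wp_value:
  assumes n: "vs s vN = int n" and m: "vs s vM = int m"
    and N: "\<And>i j. i < d \<Longrightarrow> j < n \<Longrightarrow> ar s aN i j = N i j"
    and x: "\<And>j. j < n \<Longrightarrow> ar s aO 0 (Suc j) = x j" "\<And>j. j < n \<Longrightarrow> \<bar>x j\<bar> \<le> 1"
    and NV: "\<And>i. i < d \<Longrightarrow> (\<Sum>j<n. \<bar>N i j\<bar>) \<le> V"
    and V: "int d \<le> V" "int n \<le> V" "1 \<le> V"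
    and Q: "\<And>s'. frame (value_prog d) s s' \<Longrightarrow>
      (\<And>i. i < d \<Longrightarrow> ar s' aZ (Suc m) i = (\<Sum>j<n. N i j * x j)) \<Longrightarrow>
      (\<And>k. k \<noteq> Suc m \<Longrightarrow> ar s' aZ k = ar s aZ k) \<Longrightarrow>
      tm s' \<le> tm s + (d * (n * 5 + 7) + 2) \<Longrightarrow> Q s'"
  shows "wp w V (value_prog d) s Q"
proof -
  let ?b2 = "Fetch vX aN (Var vI) (Var vJ);; Fetch vY aO (Lit 0) (Var vJ \<^bold>+ Lit 1);;
          vS ::= Var vS \<^bold>+ Var vX \<^bold>* Var vY"
  let ?l1 = "vS ::= Lit 0;; For vJ (Var vN) ?b2"
  let ?b1 = "?l1;; Put aZ (Var vM \<^bold>+ Lit 1) (Var vI) (Var vS)"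
  let ?S = "\<lambda>i k. \<Sum>j<k. N i j * x j"
  have SV: "\<bar>?S i k\<bar> \<le> V" if "i < d" "k \<le> n" for i k
  proof -
    \<comment> \<open>Partial sums of signed terms need not be monotone; absolute values restore
      this.\<close>
    have "\<bar>?S i k\<bar> \<le> (\<Sum>j<k. \<bar>N i j * x j\<bar>)" by (rule sum_abs)
    also have "\<dots> \<le> (\<Sum>j<k. \<bar>N i j\<bar>)"
      using x(2) that by (intro sum_mono) (auto simp: abs_mult intro!: mult_left_le)
    also have "\<dots> \<le> (\<Sum>j<n. \<bar>N i j\<bar>)" using that by (intro sum_mono2) auto
    finally show ?thesis using NV that by force
  qed
  have inner: "wp w V ?b1 s2 (\<lambda>s3. ((\<forall>i'<Suc i. ar s3 aZ (Suc m) i' = ?S i' n) \<and> (\<forall>k. k \<noteq> Suc m \<longrightarrow> ar s3 aZ k = ar s2 aZ k)) \<and>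
       tm s3 \<le> tm s2 + (n * 5 + 5))"
    if i: "i < d" and f: "frame (value_prog d) s s2" and ii: "vs s2 vI = int i"
      and I: "\<forall>i'<i. ar s2 aZ (Suc m) i' = ?S i' n" for i s2
  proof (rule wp_SeqI)
    have fr: "vs s2 vN = int n" "vs s2 vM = int m" "ar s2 aN = ar s aN" "ar s2 aO = ar s aO"
      using f n m by (auto simp: frame_def)
    have "wp w V (For vJ (Var vN) ?b2) (s2\<lparr>vs := (vs s2)(vS := 0), tm := tm s2 + 1\<rparr>)
       (\<lambda>s3. vs s3 vS = ?S i n \<and> tm s3 \<le> tm s2 + (n * 5 + 3))"
    proof (rule wp_For[where h = n and I = "\<lambda>k s3. vs s3 vS = ?S i k" and T = 3])
      fix j and s' :: st assume j: "j < n" and R: "vs s' vS = ?S i j" and jj: "vs s' vJ = int j"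
        and f: "frame (For vJ (Var vN) ?b2) (s2\<lparr>vs := (vs s2)(vS := 0), tm := tm s2 + 1\<rparr>) s'"
      have fr': "vs s' vI = int i" "ar s' aN = ar s aN" "ar s' aO = ar s aO" using f fr ii by (auto simp: frame_def)
      show "wp w V ?b2 s' (\<lambda>s''. vs s'' vS = ?S i (Suc j) \<and> tm s'' \<le> tm s' + 3)"
        using R jj fr' N[OF i j] x(1)[OF j] SV[OF i, of "Suc j"] j by (auto simp: nat_add_distrib)
    qed (use fr V in auto)
    then show "wp w V ?l1 s2 (\<lambda>s3. vs s3 vS = ?S i n \<and> tm s3 \<le> tm s2 + (n * 5 + 3))" using V by simp
    fix s3 assume f3: "frame ?l1 s2 s3" and R: "vs s3 vS = ?S i n \<and> tm s3 \<le> tm s2 + (n * 5 + 3)"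
    have fr3: "vs s3 vI = int i" "vs s3 vM = int m" "ar s3 aZ = ar s2 aZ" using f3 fr ii by (auto simp: frame_def)
    show "wp w V (Put aZ (Var vM \<^bold>+ Lit 1) (Var vI) (Var vS)) s3
      (\<lambda>s3. ((\<forall>i'<Suc i. ar s3 aZ (Suc m) i' = ?S i' n) \<and> (\<forall>k. k \<noteq> Suc m \<longrightarrow> ar s3 aZ k = ar s2 aZ k)) \<and>
       tm s3 \<le> tm s2 + (n * 5 + 5))"
      using R fr3 I SV[OF i, of n] by (auto simp: arr_upd_fun less_Suc_eq nat_add_distrib)
  qed
  have "wp w V (value_prog d) s (\<lambda>s'. frame (value_prog d) s s' \<longrightarrow> Q s')"
    unfolding value_prog_def
  proof (rule wp_For[where h = d and T = "n * 5 + 5" and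
      I = "\<lambda>i s2. (\<forall>i'<i. ar s2 aZ (Suc m) i' = ?S i' n) \<and> (\<forall>k. k \<noteq> Suc m \<longrightarrow> ar s2 aZ k = ar s aZ k)"])
    fix i and s' :: st
    assume i: "i < d" and I: "(\<forall>i'<i. ar s' aZ (Suc m) i' = ?S i' n) \<and> (\<forall>k. k \<noteq> Suc m \<longrightarrow> ar s' aZ k = ar s aZ k)"
      and f: "frame (For vI (Lit (int d)) ?b1) s s'" and ii: "vs s' vI = int i"
    show "wp w V ?b1 s' (\<lambda>s3. ((\<forall>i'<Suc i. ar s3 aZ (Suc m) i' = ?S i' n) \<and> (\<forall>k. k \<noteq> Suc m \<longrightarrow> ar s3 aZ k = ar s aZ k)) \<and>
        tm s3 \<le> tm s' + (n * 5 + 5))"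
      by (rule wp_mono[OF inner[OF i _ ii]]) (use f I in \<open>auto simp: value_prog_def\<close>)
  next
    fix s' :: st
    assume "(\<forall>i'<d. ar s' aZ (Suc m) i' = ?S i' n) \<and> (\<forall>k. k \<noteq> Suc m \<longrightarrow> ar s' aZ k = ar s aZ k)"
      and "tm s' \<le> tm s + d * (n * 5 + 5 + 2) + 2"
    then show "frame (For vI (Lit (int d)) ?b1) s s' \<longrightarrow> Q s'"
      by (intro impI Q) (auto simp: algebra_simps value_prog_def)
  qed (use V in auto)
  then show ?thesis by (rule wp_frame)
qed

section \<open>Recognising and printing new points\<close>

text \<open>All rows share the denominator \<open>D\<close>, so points agree exactly when their
  integer rows do. A difference is detected by its square, as conditions test for
  positivity.\<close>

definition check_prog :: "nat \<Rightarrow> com" where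
  "check_prog d =
    (vNew ::= Lit 1;;
     For vK (Var vM)
      ((vEq ::= Lit 1;;
        For vI (Lit (int d))
         (Fetch vX aZ (Var vK \<^bold>+ Lit 1) (Var vI);; Fetch vY aZ (Var vM \<^bold>+ Lit 1) (Var vI);;
          Cond ((Var vX \<^bold>- Var vY) \<^bold>* (Var vX \<^bold>- Var vY)) (vEq ::= Lit 0) Skip));;
       Cond (Var vEq) (vNew ::= Lit 0) Skip))"

lemma check_prog_mods [simp]:
  "mods (check_prog d) = {vNew, vK, vEq, vI, vX, vY}" "amods (check_prog d) = {}" "\<not> emits (check_prog d)"
  by (auto simp: check_prog_def)

lemma wp_check:
  assumes m: "vs s vM = int m" and V: "int d \<le> V" "int m \<le> V" "1 \<le> V"
    and Q: "\<And>s'. frame (check_prog d) s s' \<Longrightarrow>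
      vs s' vNew = (if \<exists>k<m. \<forall>i<d. ar s aZ (Suc k) i = ar s aZ (Suc m) i then 0 else 1) \<Longrightarrow>
      tm s' \<le> tm s + (m * (d * 6 + 8) + 3) \<Longrightarrow> Q s'"
  shows "wp w V (check_prog d) s Q"
proof -
  let ?b2 = "Fetch vX aZ (Var vK \<^bold>+ Lit 1) (Var vI);; Fetch vY aZ (Var vM \<^bold>+ Lit 1) (Var vI);;
          Cond ((Var vX \<^bold>- Var vY) \<^bold>* (Var vX \<^bold>- Var vY)) (vEq ::= Lit 0) Skip"
  let ?l1 = "vEq ::= Lit 1;; For vI (Lit (int d)) ?b2"
  let ?b1 = "?l1;; Cond (Var vEq) (vNew ::= Lit 0) Skip"
  let ?z = "ar s aZ"
  let ?E = "\<lambda>k j. \<forall>i<j. ?z (Suc k) i = ?z (Suc m) i"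
  let ?N = "\<lambda>k. if \<exists>k'<k. ?E k' d then 0 else 1 :: int"
  have sq: "0 < (x - y) * (x - y) \<longleftrightarrow> x \<noteq> y" for x y :: int
    by (metis eq_iff_diff_eq_0 not_real_square_gt_zero zero_less_mult_iff not_less_iff_gr_or_eq)
  have inner: "wp w V ?b1 s2 (\<lambda>s3. vs s3 vNew = ?N (Suc k) \<and> tm s3 \<le> tm s2 + (d * 6 + 6))"
    if k: "k < m" and fr: "vs s2 vM = int m" "ar s2 = ar s" and kk: "vs s2 vK = int k"
      and I: "vs s2 vNew = ?N k" for k s2
  proof (rule wp_SeqI)
    have "wp w V (For vI (Lit (int d)) ?b2) (s2\<lparr>vs := (vs s2)(vEq := 1), tm := tm s2 + 1\<rparr>)
       (\<lambda>s3. vs s3 vEq = (if ?E k d then 1 else 0) \<and> tm s3 \<le> tm s2 + (d * 6 + 3))"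
    proof (rule wp_For[where h = d and I = "\<lambda>j s3. vs s3 vEq = (if ?E k j then 1 else 0)" and T = 4])
      fix j and s' :: st assume j: "j < d" and R: "vs s' vEq = (if ?E k j then 1 else 0)" and jj: "vs s' vI = int j"
        and f: "frame (For vI (Lit (int d)) ?b2) (s2\<lparr>vs := (vs s2)(vEq := 1), tm := tm s2 + 1\<rparr>) s'"
      have fr': "vs s' vK = int k" "vs s' vM = int m" "ar s' = ar s" using f fr kk by (auto simp: frame_def)
      show "wp w V ?b2 s' (\<lambda>s''. vs s'' vEq = (if ?E k (Suc j) then 1 else 0) \<and> tm s'' \<le> tm s' + 4)"
        using R jj fr' V by (auto simp: nat_add_distrib sq less_Suc_eq)
    qed (use V in auto)
    then show "wp w V ?l1 s2 (\<lambda>s3. vs s3 vEq = (if ?E k d then 1 else 0) \<and> tm s3 \<le> tm s2 + (d * 6 + 3))" using V by simp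
    fix s3 assume f3: "frame ?l1 s2 s3" and R: "vs s3 vEq = (if ?E k d then 1 else 0) \<and> tm s3 \<le> tm s2 + (d * 6 + 3)"
    have "vs s3 vNew = ?N k" using f3 I by (auto simp: frame_def)
    moreover have "?N (Suc k) = (if ?E k d then 0 else ?N k)" by (auto simp: less_Suc_eq)
    ultimately show "wp w V (Cond (Var vEq) (vNew ::= Lit 0) Skip) s3 (\<lambda>s3. vs s3 vNew = ?N (Suc k) \<and> tm s3 \<le> tm s2 + (d * 6 + 6))"
      using R V by (simp split: if_splits)
  qed
  have "wp w V (For vK (Var vM) ?b1) (s\<lparr>vs := (vs s)(vNew := 1), tm := Suc (tm s)\<rparr>) (\<lambda>s'. frame (check_prog d) s s' \<longrightarrow> Q s')"
  proof (rule wp_For[where h = m and T = "d * 6 + 6" and I = "\<lambda>k s2. vs s2 vNew = ?N k"])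
    fix k and s' :: st
    assume k: "k < m" and I: "vs s' vNew = ?N k" and kk: "vs s' vK = int k"
      and f: "frame (For vK (Var vM) ?b1) (s\<lparr>vs := (vs s)(vNew := 1), tm := Suc (tm s)\<rparr>) s'"
    have "ar s' = ar s" "vs s' vM = int m" using f m by (auto simp: frame_def)
    then show "wp w V ?b1 s' (\<lambda>s3. vs s3 vNew = ?N (Suc k) \<and> tm s3 \<le> tm s' + (d * 6 + 6))"
      by (intro inner[OF k _ _ kk I]) auto
  next
    fix s' :: st
    assume "vs s' vNew = ?N m" and "tm s' \<le> tm (s\<lparr>vs := (vs s)(vNew := 1), tm := Suc (tm s)\<rparr>) + m * (d * 6 + 6 + 2) + 2"
    then show "frame (check_prog d) s s' \<longrightarrow> Q s'"
      by (intro impI Q) (auto simp: algebra_simps)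
  qed (use V m in auto)
  then have "wp w V (check_prog d) s (\<lambda>s'. frame (check_prog d) s s' \<longrightarrow> Q s')"
    using V by (simp add: check_prog_def)
  then show ?thesis by (rule wp_frame)
qed

definition emit_prog :: "nat \<Rightarrow> com" where
  "emit_prog d = For vI (Lit (int d)) (Fetch vU aZ (Var vM) (Var vI);; norm_prog;; Emit (Var vP);; Emit (Var vQ))"

lemma emit_prog_mods [simp]:
  "mods (emit_prog d) = {vI, vU, vP, vQ, vA, vB, vR}" "amods (emit_prog d) = {}"
  by (auto simp: emit_prog_def)

lemma wp_emit:
  assumes D: "vs s vD = D" "0 < D" "D \<le> 2 ^ b" and m: "vs s vM = int m" and d: "int d \<le> 2 ^ b"
    and Z: "\<And>i. i < d \<Longrightarrow> \<bar>ar s aZ m i\<bar> \<le> 2 ^ b"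
    and Q: "\<And>s'. frame (emit_prog d) s s' \<Longrightarrow>
      ou s' = ou s @ concat (map (\<lambda>i. rat_code (of_int (ar s aZ m i) / of_int D)) [0..<d]) \<Longrightarrow>
      tm s' \<le> tm s + (d * (8 * b + 19) + 2) \<Longrightarrow> Q s'"
  shows "wp w (2 ^ b) (emit_prog d) s Q"
proof -
  let ?V = "2 ^ b :: int"
  let ?r = "\<lambda>i. of_int (ar s aZ m i) / of_int D :: rat"
  let ?p = "Emit (Var vP);; Emit (Var vQ)"
  let ?c = "Fetch vU aZ (Var vM) (Var vI);; norm_prog;; ?p"
  let ?O = "\<lambda>j. ou s @ concat (map (\<lambda>i. rat_code (?r i)) [0..<j])"
  have "wp w ?V (emit_prog d) s (\<lambda>s'. frame (emit_prog d) s s' \<longrightarrow> Q s')"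
    unfolding emit_prog_def
  proof (rule wp_For[where h = d and T = "8 * b + 17" and I = "\<lambda>j s'. ou s' = ?O j"])
    fix j and s' :: st assume j: "j < d" and I: "ou s' = ?O j" and jj: "vs s' vI = int j"
      and f: "frame (For vI (Lit (int d)) ?c) s s'"
    have fr: "vs s' vD = D" "vs s' vM = int m" "ar s' = ar s" using f D m by (auto simp: frame_def)
    have rc: "rat_code (?r j) = [fst (quotient_of (?r j)), snd (quotient_of (?r j))]"
      by (simp add: rat_code_def split: prod.split)
    show "wp w ?V ?c s' (\<lambda>s''. ou s'' = ?O (Suc j) \<and> tm s'' \<le> tm s' + (8 * b + 17))"
    proof (rule wp_SeqI)
      show "wp w ?V (Fetch vU aZ (Var vM) (Var vI)) s' (\<lambda>s1. vs s1 vU = ar s aZ m j \<and> tm s1 \<le> tm s' + 1)"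
        using fr jj by simp
      fix s1 assume f1: "frame (Fetch vU aZ (Var vM) (Var vI)) s' s1"
        and s1: "vs s1 vU = ar s aZ m j \<and> tm s1 \<le> tm s' + 1"
      have fr1: "vs s1 vD = D" "ou s1 = ?O j" using f1 fr I by (auto simp: frame_def)
      show "wp w ?V (norm_prog;; ?p) s1 (\<lambda>s''. ou s'' = ?O (Suc j) \<and> tm s'' \<le> tm s' + (8 * b + 17))"
        unfolding wp_simps(7)
      proof (rule wp_norm[where D = D and u = "ar s aZ m j"])
        fix s2 assume "frame norm_prog s1 s2" "vs s2 vP = fst (quotient_of (?r j))"
          "vs s2 vQ = snd (quotient_of (?r j))" "tm s2 \<le> tm s1 + (8 * b + 14)"
        then show "wp w ?V (Emit (Var vP)) s2 (\<lambda>s'a. wp w ?V (Emit (Var vQ)) s'a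
          (\<lambda>s''. ou s'' = ?O (Suc j) \<and> tm s'' \<le> tm s' + (8 * b + 17)))"
          using fr1 s1 by (simp add: rc frame_def)
      qed (use fr1 s1 D Z[OF j] in auto)
    qed
  next
    fix s' :: st assume "ou s' = ?O d" "tm s' \<le> tm s + d * (8 * b + 17 + 2) + 2"
    then show "frame (For vI (Lit (int d)) ?c) s s' \<longrightarrow> Q s'"
      by (intro impI Q) (auto simp: algebra_simps emit_prog_def)
  qed (use d in auto)
  then show ?thesis by (rule wp_frame)
qed

section \<open>Layout of the input\<close>

lemma length_concat_uniform:
  "(\<And>x. x \<in> set xs \<Longrightarrow> length x = L) \<Longrightarrow> length (concat xs) = length xs * L"
  by (induction xs) auto

lemma nth_concat_uniform:
  assumes "\<And>x. x \<in> set xs \<Longrightarrow> length x = L" "i < length xs" "j < L"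
  shows "concat xs ! (i * L + j) = xs ! i ! j"
  using assms
proof (induction xs arbitrary: i)
  case (Cons x xs)
  then show ?case by (cases i) (auto simp: nth_append)
qed simp

lemma rat_code_eq: "rat_code r = [fst (quotient_of r), snd (quotient_of r)]"
  by (simp add: rat_code_def split: prod.split)

lemma length_vec_code [simp]: "length (vec_code v) = 2 * dim_vec v"
  unfolding vec_code_def by (subst length_concat_uniform[where L = 2]) (auto simp: rat_code_eq)

lemma vec_code_nth:
  assumes "i < dim_vec v"
  shows "vec_code v ! (2 * i) = fst (quotient_of (v $ i))"
    "vec_code v ! (2 * i + 1) = snd (quotient_of (v $ i))"
proof -
  have len: "\<And>x. x \<in> set (map rat_code (list_of_vec v)) \<Longrightarrow> length x = 2" by (auto simp: rat_code_eq)
  show "vec_code v ! (2 * i) = fst (quotient_of (v $ i))"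
    using assms nth_concat_uniform[where xs = "map rat_code (list_of_vec v)" and i = i and j = 0, OF len]
    by (simp add: vec_code_def rat_code_eq[of "v $ i"] mult.commute)
  show "vec_code v ! (2 * i + 1) = snd (quotient_of (v $ i))"
    using assms nth_concat_uniform[where xs = "map rat_code (list_of_vec v)" and i = i and j = 1, OF len]
    by (simp add: vec_code_def rat_code_eq[of "v $ i"] mult.commute)
qed

lemma length_mat_code [simp]: "length (mat_code A) = 2 * dim_row A * dim_col A"
  unfolding mat_code_def by (subst length_concat_uniform[where L = "2 * dim_col A"]) (auto simp: rows_def)

lemma mat_code_nth:
  assumes "i < dim_row A" "j < dim_col A"
  shows "mat_code A ! (2 * (i * dim_col A + j)) = fst (quotient_of (A $$ (i, j)))"
    "mat_code A ! (2 * (i * dim_col A + j) + 1) = snd (quotient_of (A $$ (i, j)))"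
proof -
  let ?xs = "map vec_code (rows A)"
  have len: "\<And>x. x \<in> set ?xs \<Longrightarrow> length x = 2 * dim_col A" by (auto simp: rows_def)
  have i: "i < length ?xs" using assms by simp
  have r: "?xs ! i = vec_code (row A i)" using assms by simp
  have "2 * j < 2 * dim_col A" "2 * j + 1 < 2 * dim_col A" using assms by auto
  from nth_concat_uniform[OF len i this(1)] nth_concat_uniform[OF len i this(2)]
  show "mat_code A ! (2 * (i * dim_col A + j)) = fst (quotient_of (A $$ (i, j)))"
    "mat_code A ! (2 * (i * dim_col A + j) + 1) = snd (quotient_of (A $$ (i, j)))"
    using vec_code_nth[of j "row A i"] assms unfolding r mat_code_def
    by (auto simp: algebra_simps)
qed

lemma index_lt: "i < d \<Longrightarrow> j < n \<Longrightarrow> i * n + j < d * (n::nat)"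
proof -
  assume "i < d" "j < n"
  then have "Suc i * n \<le> d * n" by (intro mult_right_mono) auto
  then show ?thesis using \<open>j < n\<close> by simp
qed

lemma moco_input_entries:
  assumes "i < num_objs I" "j < num_vars I"
  shows "num_at (moco_input I) (i * num_vars I + j) = fst (quotient_of (objectives I $$ (i, j)))"
    "den_at (moco_input I) (i * num_vars I + j) = snd (quotient_of (objectives I $$ (i, j)))"
proof -
  let ?k = "i * num_vars I + j"
  have "?k < num_objs I * num_vars I" using assms by (rule index_lt)
  then have k: "2 * ?k < length (mat_code (objectives I))" "2 * ?k + 1 < length (mat_code (objectives I))" by auto
  have "read_input (moco_input I) (2 * ?k + 3) = mat_code (objectives I) ! (2 * ?k)"
    using k by (simp add: moco_input_def read_input_def nth_append numeral_3_eq_3)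
  moreover have "read_input (moco_input I) (2 * ?k + 4) = mat_code (objectives I) ! (2 * ?k + 1)"
    using k by (simp add: moco_input_def read_input_def nth_append eval_nat_numeral)
  ultimately show "num_at (moco_input I) ?k = fst (quotient_of (objectives I $$ (i, j)))"
    "den_at (moco_input I) ?k = snd (quotient_of (objectives I $$ (i, j)))"
    using mat_code_nth[OF assms] by (simp_all add: num_at_def den_at_def)
qed

lemma den_at_pos:
  assumes "k < num_objs I * num_vars I"
  shows "0 < den_at (moco_input I) k"
proof -
  let ?n = "num_vars I"
  have n: "0 < ?n" using assms by (cases ?n) auto
  have "k div ?n < num_objs I" using assms by (simp add: less_mult_imp_div_less)
  moreover have "k mod ?n < ?n" using n by simp
  moreover have "k = k div ?n * ?n + k mod ?n" by simp
  ultimately show ?thesis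
    using moco_input_entries(2)[of "k div ?n" I "k mod ?n"] quotient_of_denom_pos' by metis
qed

text \<open>The header has no field for the right-hand side, whose length is determined by the
  number of objectives. Header and matrix therefore coincide, and the description is merely
  shifted.\<close>

lemma eps_input_spliced:
  assumes "dim_vec \<epsilon> = num_objs I"
    and "\<And>i. i < num_objs I \<Longrightarrow> e (2 * i) = fst (quotient_of (\<epsilon> $ i)) \<and> e (2 * i + 1) = snd (quotient_of (\<epsilon> $ i))"
  shows "spliced (moco_input I) (num_objs I) (num_vars I) e (eps_input I \<epsilon>)"
proof -
  let ?d = "num_objs I" and ?n = "num_vars I"
  define xs where "xs = [int ?n, int ?d, int (length (description I))] @ mat_code (objectives I)"
  have lx: "length xs = 3 + 2 * ?d * ?n" by (simp add: xs_def)
  have mi: "moco_input I = xs @ description I" "eps_input I \<epsilon> = xs @ vec_code \<epsilon> @ description I"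
    by (simp_all add: xs_def moco_input_def eps_input_def)
  have e: "vec_code \<epsilon> ! l = e l" if "l < 2 * ?d" for l
  proof -
    have "l div 2 < ?d" using that by simp
    note * = vec_code_nth[of "l div 2" \<epsilon>, unfolded assms(1), OF this] assms(2)[OF this]
    show ?thesis
    proof (cases "even l")
      case True
      then show ?thesis using *(1,3) by simp
    next
      case False
      then have "2 * (l div 2) + 1 = l" by simp
      then show ?thesis using *(2,3) by metis
    qed
  qed
  show ?thesis
    unfolding spliced_def mi lx[symmetric]
    using assms(1) e by (auto simp: read_input_def nth_append add.commute)
qed

section \<open>Scalarization and Pareto-front\<close>

lemma eps_objective_eq:
  "eps_objective I x = (\<Sum>i<num_objs I. (objectives I *\<^sub>v x) $ i)"
  by (simp add: eps_objective_def scalar_prod_def lessThan_atLeast0)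

lemma optimal_in_front:
  assumes opt: "is_arg_min (eps_objective I) (\<lambda>x. x \<in> eps_feasible I \<epsilon>) x"
  shows "objectives I *\<^sub>v x \<in> pareto_front I"
proof -
  let ?C = "objectives I"
  have x: "x \<in> eps_feasible I \<epsilon>" and mn: "\<And>x'. x' \<in> eps_feasible I \<epsilon> \<Longrightarrow> \<not> eps_objective I x' < eps_objective I x"
    using opt by (auto simp: is_arg_min_def)
  have False if y': "y' \<in> outcomes I" "y' < ?C *\<^sub>v x" for y'
  proof -
    obtain x' where x': "x' \<in> solutions I" "y' = ?C *\<^sub>v x'" using y'(1) by (auto simp: outcomes_def)
    have le: "\<forall>i<num_objs I. (?C *\<^sub>v x') $ i \<le> (?C *\<^sub>v x) $ i" and ne: "\<not> (\<forall>i<num_objs I. (?C *\<^sub>v x) $ i \<le> (?C *\<^sub>v x') $ i)"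
      using y'(2) x' by (auto simp: less_vec_def less_eq_vec_def)
    have "x' \<in> eps_feasible I \<epsilon>"
      using x x' le by (auto simp: eps_feasible_def intro: order_trans)
    moreover have "eps_objective I x' < eps_objective I x"
      unfolding eps_objective_eq
      by (rule sum_strict_mono_ex1) (use le ne in \<open>auto simp: not_le\<close>)
    ultimately show False using mn by blast
  qed
  then show ?thesis using x by (auto simp: pareto_front_def outcomes_def eps_feasible_def)
qed

text \<open>The witness is the number with these digits in base \<open>m + 1\<close>; the induction
  step prepends the lowest digit.\<close>

lemma digits_exist: "\<forall>i<d. \<kappa> i \<le> m \<Longrightarrow> \<exists>t<(m + 1) ^ d. \<forall>i<d. digit m t i = \<kappa> i"
proof (induction d arbitrary: \<kappa>)
  case (Suc d)
  have "\<forall>i<d. \<kappa> (Suc i) \<le> m" using Suc.prems by auto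
  from Suc.IH[OF this] obtain t where t: "t < (m + 1) ^ d" "\<forall>i<d. digit m t i = \<kappa> (Suc i)" by blast
  let ?t = "\<kappa> 0 + (m + 1) * t"
  have k0: "\<kappa> 0 < m + 1" using Suc.prems by auto
  have dv: "?t div (m + 1) = t" using k0 by (subst div_mult_self2) auto
  have "(m + 1) * Suc t \<le> (m + 1) * (m + 1) ^ d" using t(1) by (intro mult_left_mono) auto
  then have "?t < (m + 1) ^ Suc d" using k0 by simp
  moreover have "digit m ?t i = \<kappa> i" if "i < Suc d" for i
  proof (cases i)
    case 0
    have "?t mod (m + 1) = \<kappa> 0" using k0 by (metis mod_less mod_mult_self2)
    then show ?thesis using 0 by (simp add: digit_def)
  next
    case (Suc j)
    have "?t div (m + 1) ^ Suc j = t div (m + 1) ^ j"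
      unfolding power_Suc div_mult2_eq dv ..
    then show ?thesis using t(2) that Suc by (simp add: digit_def)
  qed
  ultimately show ?case by blast
qed simp

definition scaled :: "nat \<Rightarrow> int \<Rightarrow> (nat \<Rightarrow> int) \<Rightarrow> rat vec" where
  "scaled d D z = vec d (\<lambda>i. of_int (z i) / of_int D)"

lemma vec_code_scaled: "vec_code (scaled d D z) = concat (map (\<lambda>i. rat_code (of_int (z i) / of_int D)) [0..<d])"
  by (simp add: vec_code_def scaled_def list_of_vec_vec o_def)

lemma scaled_eq_iff: "0 < D \<Longrightarrow> scaled d D z = scaled d D z' \<longleftrightarrow> (\<forall>i<d. z i = z' i)"
  by (auto simp: scaled_def vec_eq_iff)

text \<open>Given a nondominated point not yet found, every coordinate of the grid point below is the
  least value of a listed point (slot 0 being a sentinel) that exceeds the coordinate of the new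
  point; a listed point below it would dominate the new point.\<close>

lemma front_exhausted:
  assumes D: "0 < D" and d: "num_objs I = d"
    and int: "\<And>x. x \<in> solutions I \<Longrightarrow> \<exists>z. objectives I *\<^sub>v x = scaled d D z \<and> (\<forall>i<d. z i < Z 0 i)"
    and grid: "\<And>t. t < (m + 1) ^ d \<Longrightarrow> eps_feasible I (scaled d D (\<lambda>i. Z (digit m t i) i - 1)) = {} \<or>
       (\<exists>k<m. scaled d D (Z (Suc k)) \<in> outcomes I \<and> (\<forall>i<d. Z (Suc k) i \<le> Z (digit m t i) i - 1))"
    and y: "y \<in> pareto_front I"
  shows "\<exists>k<m. y = scaled d D (Z (Suc k))"
proof -
  obtain x where x: "x \<in> solutions I" "y = objectives I *\<^sub>v x" using y by (auto simp: pareto_front_def outcomes_def)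
  obtain z where z: "y = scaled d D z" "\<forall>i<d. z i < Z 0 i" using int[OF x(1)] x(2) by blast
  have "\<exists>k\<le>m. z i < Z k i \<and> (\<forall>k'\<le>m. z i < Z k' i \<longrightarrow> Z k i \<le> Z k' i)" if "i < d" for i
  proof -
    let ?K = "{k. k \<le> m \<and> z i < Z k i}"
    have "finite ?K" "?K \<noteq> {}" using z(2) that by auto
    then obtain k where "is_arg_min (\<lambda>k. Z k i) (\<lambda>k. k \<in> ?K) k" using ex_is_arg_min_if_finite by metis
    then show ?thesis by (auto simp: is_arg_min_linorder intro!: exI[of _ k])
  qed
  then obtain \<kappa> where \<kappa>: "\<And>i. i < d \<Longrightarrow> \<kappa> i \<le> m \<and> z i < Z (\<kappa> i) i \<and> (\<forall>k'\<le>m. z i < Z k' i \<longrightarrow> Z (\<kappa> i) i \<le> Z k' i)"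
    by metis
  obtain t where t: "t < (m + 1) ^ d" "\<forall>i<d. digit m t i = \<kappa> i" using digits_exist[of d \<kappa> m] \<kappa> by auto
  have "x \<in> eps_feasible I (scaled d D (\<lambda>i. Z (digit m t i) i - 1))"
    unfolding eps_feasible_def
  proof (intro CollectI conjI x(1) allI impI)
    fix i assume i: "i < num_objs I"
    have "row (objectives I) i \<bullet> x = y $ i" using x i by simp
    also have "\<dots> = of_int (z i) / of_int D" using z i d by (simp add: scaled_def)
    also have "\<dots> \<le> of_int (Z (\<kappa> i) i - 1) / of_int D" using \<kappa>[of i] i d D by (intro divide_right_mono) auto
    finally show "row (objectives I) i \<bullet> x \<le> scaled d D (\<lambda>i. Z (digit m t i) i - 1) $ i"
      using t i d by (simp add: scaled_def)
  qed
  then obtain k where k: "k < m" "scaled d D (Z (Suc k)) \<in> outcomes I" "\<forall>i<d. Z (Suc k) i \<le> Z (digit m t i) i - 1"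
    using grid[OF t(1)] by blast
  \<comment> \<open>If it were larger, minimality would put the chosen slot at or below it, whereas
    the right-hand side keeps it strictly below that slot.\<close>
  have le: "Z (Suc k) i \<le> z i" if "i < d" for i
  proof (rule ccontr)
    assume "\<not> Z (Suc k) i \<le> z i"
    then have "Z (\<kappa> i) i \<le> Z (Suc k) i" using \<kappa>[OF that] k(1) by auto
    then show False using k(3) t(2) that by fastforce
  qed
  have "scaled d D (Z (Suc k)) \<le> y" using le D z by (auto simp: scaled_def less_eq_vec_def divide_right_mono)
  moreover have "\<not> scaled d D (Z (Suc k)) < y" using y k(2) by (auto simp: pareto_front_def)
  ultimately have "scaled d D (Z (Suc k)) = y" by (auto simp: less_vec_def)
  then show ?thesis using k(1) by blast
qed

text \<open>Each denominator divides the product, so the division in \<open>cleared\<close> is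
  exact.\<close>

lemma cleared_entry:
  assumes "i < num_objs I" "j < num_vars I"
  shows "objectives I $$ (i, j) =
    of_int (cleared (moco_input I) (num_objs I) (num_vars I) i j) / of_int (den_prod (moco_input I) (num_objs I * num_vars I))"
proof -
  let ?w = "moco_input I" and ?k = "i * num_vars I + j" and ?D = "den_prod (moco_input I) (num_objs I * num_vars I)"
  have k: "?k < num_objs I * num_vars I" using assms by (rule index_lt)
  have "den_at ?w ?k dvd ?D" unfolding den_prod_def using k by (intro dvd_prodI) auto
  then obtain c where c: "?D = den_at ?w ?k * c" by (elim dvdE)
  have dp: "0 < den_at ?w ?k" using den_at_pos[OF k] .
  have D: "0 < ?D" unfolding den_prod_def by (intro prod_pos) (auto intro: den_at_pos)
  then have c0: "c \<noteq> 0" using c by auto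
  have "objectives I $$ (i, j) = of_int (num_at ?w ?k) / of_int (den_at ?w ?k)"
    unfolding moco_input_entries[OF assms] using quotient_of_div surjective_pairing by blast
  also have "\<dots> = of_int (num_at ?w ?k * c) / of_int ?D" using c0 dp unfolding c by simp
  also have "num_at ?w ?k * c = cleared ?w (num_objs I) (num_vars I) i j"
    using dp unfolding cleared_def c by simp
  finally show ?thesis .
qed

text \<open>The entries of \<open>x\<close> are 0 or 1, so taking floors loses nothing and expresses
  the outcome by exactly the integers that the program computes.\<close>

lemma outcome_scaled:
  assumes "x \<in> binary_vecs (num_vars I)"
  shows "objectives I *\<^sub>v x = scaled (num_objs I) (den_prod (moco_input I) (num_objs I * num_vars I))
    (\<lambda>i. \<Sum>j<num_vars I. cleared (moco_input I) (num_objs I) (num_vars I) i j * \<lfloor>x $ j\<rfloor>)"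
proof (rule eq_vecI)
  let ?D = "den_prod (moco_input I) (num_objs I * num_vars I)"
  let ?N = "cleared (moco_input I) (num_objs I) (num_vars I)"
  let ?v = "scaled (num_objs I) ?D (\<lambda>i. \<Sum>j<num_vars I. ?N i j * \<lfloor>x $ j\<rfloor>)"
  show "dim_vec (objectives I *\<^sub>v x) = dim_vec ?v" by (simp add: scaled_def)
  fix i assume "i < dim_vec ?v"
  then have i: "i < num_objs I" by (simp add: scaled_def)
  have x: "dim_vec x = num_vars I" "\<And>j. j < num_vars I \<Longrightarrow> of_int \<lfloor>x $ j\<rfloor> = x $ j"
    using assms by (auto simp: binary_vecs_def)
  have "(objectives I *\<^sub>v x) $ i = (\<Sum>j<num_vars I. objectives I $$ (i, j) * x $ j)"
    using i x by (simp add: scalar_prod_def lessThan_atLeast0)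
  also have "\<dots> = (\<Sum>j<num_vars I. of_int (?N i j * \<lfloor>x $ j\<rfloor>) / of_int ?D)"
  proof (intro sum.cong refl)
    fix j assume "j \<in> {..<num_vars I}"
    then have j: "j < num_vars I" by simp
    have "objectives I $$ (i, j) * x $ j = of_int (?N i j) / of_int ?D * of_int \<lfloor>x $ j\<rfloor>"
      unfolding cleared_entry[OF i j] x(2)[OF j] ..
    then show "objectives I $$ (i, j) * x $ j = of_int (?N i j * \<lfloor>x $ j\<rfloor>) / of_int ?D" by simp
  qed
  also have "\<dots> = ?v $ i" using i by (simp add: scaled_def sum_divide_distrib)
  finally show "(objectives I *\<^sub>v x) $ i = ?v $ i" .
qed

section \<open>The enumeration\<close>

text \<open>Restarting at 0 is forced by the numbering: the digits of \<open>t\<close> are taken in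
  base \<open>m + 1\<close>, so once \<open>m\<close> grows the numbers already processed may denote
  other grid points.\<close>

definition answer_prog :: "nat \<Rightarrow> com" where
  "answer_prog d =
    (Fetch vX aO (Lit 0) (Lit 0);;
     Cond (Var vX)
      (value_prog d;; check_prog d;;
       Cond (Var vNew)
         (vM ::= Var vM \<^bold>+ Lit 1;; vT ::= Lit 0;; emit_prog d)
         (vT ::= Var vT \<^bold>+ Lit 1))
      (vT ::= Var vT \<^bold>+ Lit 1))"

definition round_prog :: "nat \<Rightarrow> ram \<Rightarrow> com" where
  "round_prog d M =
    (eps_prog d;; Cond (Var vTT) (vGo ::= Lit 0) (sim_prog d M;; answer_prog d))"

definition main_prog :: "nat \<Rightarrow> ram \<Rightarrow> com" where
  "main_prog d M = (init_prog d;; vGo ::= Lit 1;; Loop (Var vGo) (round_prog d M))"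

lemma answer_prog_mods:
  "vGo \<notin> mods (answer_prog d)" "vN \<notin> mods (answer_prog d)" "vD \<notin> mods (answer_prog d)"
  "vCall \<notin> mods (answer_prog d)" "aN \<notin> amods (answer_prog d)" "aM \<notin> amods (answer_prog d)"
  by (auto simp: answer_prog_def)

definition points :: "nat \<Rightarrow> int \<Rightarrow> (nat \<Rightarrow> nat \<Rightarrow> int) \<Rightarrow> nat \<Rightarrow> rat vec list" where
  "points d D Z m = map (\<lambda>k. scaled d D (Z (Suc k))) [0..<m]"

text \<open>A 0/1 vector is determined by its set of ones. An exponential bound is good enough,
  because it only serves to limit the bit length of counters.\<close>

lemma finite_front:
  assumes "solutions I \<subseteq> binary_vecs (num_vars I)"
  shows "finite (pareto_front I)" "card (pareto_front I) \<le> 2 ^ num_vars I"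
proof -
  let ?n = "num_vars I"
  let ?f = "\<lambda>A. vec ?n (\<lambda>j. if j \<in> A then 1 else 0 :: rat)"
  have sub: "binary_vecs ?n \<subseteq> ?f ` Pow {..<?n}"
  proof
    fix x assume x: "x \<in> binary_vecs ?n"
    have "x = ?f {j. j < ?n \<and> x $ j = 1}"
      using x by (intro eq_vecI) (auto simp: binary_vecs_def)
    then show "x \<in> ?f ` Pow {..<?n}" by blast
  qed
  have fin: "finite (binary_vecs ?n)" by (rule finite_subset[OF sub]) simp
  have "card (binary_vecs ?n) \<le> card (?f ` Pow {..<?n})" by (rule card_mono[OF _ sub]) simp
  also have "\<dots> \<le> card (Pow {..<?n})" by (rule card_image_le) simp
  finally have cb: "card (binary_vecs ?n) \<le> 2 ^ ?n" by (simp add: card_Pow)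
  have pf: "pareto_front I \<subseteq> (\<lambda>x. objectives I *\<^sub>v x) ` binary_vecs ?n"
    using assms by (auto simp: pareto_front_def outcomes_def)
  show "finite (pareto_front I)" by (rule finite_subset[OF pf]) (simp add: fin)
  have "card (pareto_front I) \<le> card ((\<lambda>x. objectives I *\<^sub>v x) ` binary_vecs ?n)"
    by (rule card_mono[OF _ pf]) (simp add: fin)
  also have "\<dots> \<le> card (binary_vecs ?n)" by (rule card_image_le[OF fin])
  finally show "card (pareto_front I) \<le> 2 ^ ?n" using cb by simp
qed

text \<open>Right-hand sides are restricted to denominator \<open>D\<close> and numerators up to
  \<open>U\<close>, the only ones ever asked, so that \<open>\<tau>\<close> and \<open>2 ^ b\<close>
  bound all calls uniformly. The 1 in \<open>bnd i + 1\<close> makes room for subtracting 1 from a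
  slot; \<open>totalV\<close> bounds the number of rounds and thereby the counters.\<close>

locale pareto_enumeration =
  fixes I :: moco_instance and M :: ram and b \<tau> d n :: nat and U D :: int
    and N :: "nat \<Rightarrow> nat \<Rightarrow> int" and bnd :: "nat \<Rightarrow> int"
  assumes sol: "solutions I \<subseteq> binary_vecs (num_vars I)"
    and d_def: "d = num_objs I" and n_def: "n = num_vars I"
    and D_def: "D = den_prod (moco_input I) (d * n)"
    and N_def: "N = cleared (moco_input I) d n"
    and bnd_def: "bnd = (\<lambda>i. 1 + (\<Sum>j<n. \<bar>N i j\<bar>))"
    and scalarization: "\<And>u. \<forall>i<d. \<bar>u i\<bar> \<le> U \<Longrightarrow>
      \<exists>k pc m out. k \<le> \<tau> \<and> run M (eps_input I (scaled d D u)) k = Some (pc, m, out) \<and> pc < length M \<and> M ! pc = Halt \<and>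
        (\<forall>j pc m out a. j \<le> k \<longrightarrow> run M (eps_input I (scaled d D u)) j = Some (pc, m, out) \<longrightarrow> \<bar>m a\<bar> \<le> 2 ^ b) \<and>
        eps_answer I (scaled d D u) out"
    and bU: "\<And>i. i < d \<Longrightarrow> bnd i + 1 \<le> U"
    and UV: "U \<le> 2 ^ b" and DV: "D \<le> 2 ^ b"
    and numV: "\<And>k. k < d * n \<Longrightarrow> \<bar>num_at (moco_input I) k\<bar> \<le> 2 ^ b"
    and dV: "int d \<le> 2 ^ b" "int n \<le> 2 ^ b" "int d * int n \<le> 2 ^ b"
    and MV: "int (length M) \<le> 2 ^ b" "int \<tau> \<le> 2 ^ b"
    and totalV: "int (card (pareto_front I) * ((card (pareto_front I) + 1) ^ d + 1) + (card (pareto_front I) + 1) ^ d + 1) \<le> 2 ^ b"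
begin

abbreviation "F \<equiv> card (pareto_front I)"
abbreviation "G \<equiv> (F + 1) ^ d"
abbreviation "rounds \<equiv> F * (G + 1) + G + 1"
abbreviation "V \<equiv> 2 ^ b :: int"
abbreviation "w \<equiv> moco_input I"

definition grid_point :: "(nat \<Rightarrow> nat \<Rightarrow> int) \<Rightarrow> nat \<Rightarrow> nat \<Rightarrow> rat vec" where
  "grid_point Z m t = scaled d D (\<lambda>i. Z (digit m t i) i - 1)"

text \<open>A grid point is handled if its scalarization cannot contribute a new point.\<close>

definition handled :: "(nat \<Rightarrow> nat \<Rightarrow> int) \<Rightarrow> nat \<Rightarrow> nat \<Rightarrow> bool" where
  "handled Z m t \<longleftrightarrow> eps_feasible I (grid_point Z m t) = {} \<or>
       (\<exists>k<m. scaled d D (Z (Suc k)) \<in> outcomes I \<and> (\<forall>i<d. Z (Suc k) i \<le> Z (digit m t i) i - 1))"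

definition base :: "st \<Rightarrow> bool" where
  "base s \<longleftrightarrow> vs s vN = int n \<and> vs s vD = D \<and> (\<forall>i<d. \<forall>j<n. ar s aN i j = N i j) \<and>
     (\<forall>i<d. ar s aZ 0 i = bnd i)"

definition calls :: "st \<Rightarrow> nat \<Rightarrow> bool" where
  "calls s c \<longleftrightarrow> vs s vCall = int c \<and> (\<forall>c'>c. \<forall>a. ar s aM c' a = 0)"

definition found :: "st \<Rightarrow> nat \<Rightarrow> nat \<Rightarrow> bool" where
  "found s m t \<longleftrightarrow> vs s vM = int m \<and> vs s vT = int t \<and>
     distinct (points d D (ar s aZ) m) \<and> set (points d D (ar s aZ) m) \<subseteq> pareto_front I \<and>
     ou s = concat (map vec_code (points d D (ar s aZ) m)) \<and>
     (\<forall>k<m. \<forall>i<d. \<bar>ar s aZ (Suc k) i\<bar> \<le> bnd i) \<and>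
     (\<forall>t'<t. handled (ar s aZ) m t') \<and> t \<le> (m + 1) ^ d"

section \<open>Invariants of the search\<close>

lemma D_pos: "0 < D"
  unfolding D_def den_prod_def d_def n_def by (intro prod_pos) (auto intro: den_at_pos)

lemma V_ge: "1 \<le> V" "int F \<le> V" "int G + 1 \<le> V" "int rounds \<le> V"
proof -
  show t: "int rounds \<le> V" using totalV by simp
  show "1 \<le> V" by simp
  have "F * 1 \<le> F * (G + 1)" by (intro mult_left_mono) auto
  then have "F \<le> rounds" "G + 1 \<le> rounds" by linarith+
  then show "int F \<le> V" "int G + 1 \<le> V" using t by linarith+
qed

lemma bnd_eq: "bnd i = 1 + (\<Sum>j<n. \<bar>N i j\<bar>)"
  by (simp add: bnd_def)

lemma bnd_le: "i < d \<Longrightarrow> bnd i \<le> V" "i < d \<Longrightarrow> 1 \<le> bnd i" "i < d \<Longrightarrow> (\<Sum>j<n. \<bar>N i j\<bar>) \<le> V"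
  using bU[of i] UV sum_nonneg[of "{..<n}" "\<lambda>j. \<bar>N i j\<bar>", OF abs_ge_zero] by (auto simp: bnd_eq)

lemma digit_le: "digit m t i \<le> m"
  by (simp add: digit_def less_Suc_eq_le[symmetric])

text \<open>Digits do not exceed \<open>m\<close>; thus a candidate written to row
  \<open>m + 1\<close> does not disturb what is known about the grid.\<close>

lemma handled_cong:
  assumes "\<And>k. k \<le> m \<Longrightarrow> Z k = Z' k"
  shows "handled Z m t \<longleftrightarrow> handled Z' m t"
  using assms digit_le[of m t] by (auto simp: handled_def grid_point_def)

lemma points_cong: "(\<And>k. k \<le> m \<Longrightarrow> Z k = Z' k) \<Longrightarrow> points d D Z m = points d D Z' m"
  by (auto simp: points_def)

lemma found_cong:
  assumes "found s m t" "vs s' vM = vs s vM" "vs s' vT = vs s vT" "ou s' = ou s" "\<And>k. k \<le> m \<Longrightarrow> ar s' aZ k = ar s aZ k"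
  shows "found s' m t"
  using assms handled_cong[of m "ar s' aZ" "ar s aZ"] points_cong[of m "ar s' aZ" "ar s aZ"]
  by (simp add: found_def)

text \<open>Listed points are distinct members of the front. This ties the counter to
  \<open>F\<close>, a number that the program never learns.\<close>

lemma found_le:
  assumes "found s m t"
  shows "m \<le> F"
proof -
  have "card (set (points d D (ar s aZ) m)) = m"
    using distinct_card[of "points d D (ar s aZ) m"] assms by (simp add: found_def) (simp add: points_def)
  then show ?thesis
    using card_mono[OF finite_front(1)[OF sol], of "set (points d D (ar s aZ) m)"] assms by (simp add: found_def)
qed

lemma slots_bounded:
  assumes "base s" "found s m t" "k \<le> m" "i < d"
  shows "\<bar>ar s aZ k i\<bar> \<le> bnd i"
  using assms bnd_le[of i] by (cases k) (auto simp: base_def found_def)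

lemma found_end:
  assumes f: "found s m t" and bs: "base s" and t: "t = (m + 1) ^ d"
  shows "set (points d D (ar s aZ) m) = pareto_front I"
proof
  show "set (points d D (ar s aZ) m) \<subseteq> pareto_front I" using f by (simp add: found_def)
  show "pareto_front I \<subseteq> set (points d D (ar s aZ) m)"
  proof
    fix y assume y: "y \<in> pareto_front I"
    have "\<exists>k<m. y = scaled d D (ar s aZ (Suc k))"
    proof (rule front_exhausted[OF D_pos d_def[symmetric] _ _ y])
      fix x assume x: "x \<in> solutions I"
      then have xb: "x \<in> binary_vecs (num_vars I)" using sol by auto
      \<comment> \<open>Strict thanks to the 1 added in \<open>bnd\<close>.\<close>
      have "(\<Sum>j<n. N i j * \<lfloor>x $ j\<rfloor>) < ar s aZ 0 i" if "i < d" for i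
      proof -
        have "(\<Sum>j<n. N i j * \<lfloor>x $ j\<rfloor>) \<le> (\<Sum>j<n. \<bar>N i j\<bar>)"
          using xb by (intro sum_mono) (auto simp: binary_vecs_def n_def)
        then show ?thesis using bs that by (simp add: base_def bnd_eq)
      qed
      then show "\<exists>z. objectives I *\<^sub>v x = scaled d D z \<and> (\<forall>i<d. z i < ar s aZ 0 i)"
        using outcome_scaled[OF xb] unfolding N_def D_def d_def n_def by blast
    next
      fix t' assume "t' < (m + 1) ^ d"
      then show "eps_feasible I (scaled d D (\<lambda>i. ar s aZ (digit m t' i) i - 1)) = {} \<or>
       (\<exists>k<m. scaled d D (ar s aZ (Suc k)) \<in> outcomes I \<and> (\<forall>i<d. ar s aZ (Suc k) i \<le> ar s aZ (digit m t' i) i - 1))"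
        using f t by (auto simp: found_def handled_def grid_point_def)
    qed
    then show "y \<in> set (points d D (ar s aZ) m)" by (auto simp: points_def)
  qed
qed

lemma found_next:
  assumes "found s m t" "handled (ar s aZ) m t" "t < (m + 1) ^ d" "vs s' vM = vs s vM" "vs s' vT = int (Suc t)"
    "ou s' = ou s" "ar s' aZ = ar s aZ"
  shows "found s' m (Suc t)"
  using assms by (auto simp: found_def less_Suc_eq)

definition answer_time :: nat where
  "answer_time = d * (n * 5 + 7) + F * (d * 6 + 8) + d * (8 * b + 19) + 20"

text \<open>An infeasible grid point is handled by definition, and one answered by a listed point is
  handled by that point, which satisfies the right-hand side. Any other answer is optimal, hence a
  front point not listed so far.\<close>

lemma wp_answer:
  assumes bs: "base s" and f: "found s m t" and t: "t < (m + 1) ^ d"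
    and ans: "eps_answer I (grid_point (ar s aZ) m t) out"
    and out: "\<And>j. j < length out \<Longrightarrow> ar s aO 0 j = out ! j"
  shows "wp w V (answer_prog d) s (\<lambda>s'. base s' \<and> (found s' m (Suc t) \<or> found s' (Suc m) 0) \<and> tm s' \<le> tm s + answer_time)"
proof -
  let ?Z = "ar s aZ"
  have mF: "m \<le> F" by (rule found_le[OF f])
  have "(m + 1) ^ d \<le> G" using mF by (intro power_mono) auto
  then have tV: "int t + 1 \<le> V" using t V_ge(3) by linarith
  have mV: "int m \<le> V" using mF V_ge(2) by linarith
  have mt: "vs s vM = int m" "vs s vT = int t" using f by (auto simp: found_def)
  show ?thesis
  proof (cases "eps_feasible I (grid_point ?Z m t) = {}")
    case True
    then have "out = [0]" using ans by (simp add: eps_answer_def)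
    then have o: "ar s aO 0 0 = 0" using out[of 0] by simp
    have h: "handled ?Z m t" using True by (simp add: handled_def)
    have "found (s\<lparr>vs := (vs s)(vX := 0, vT := 1 + int t), tm := Suc (Suc (Suc (tm s)))\<rparr>) m (Suc t)"
      by (rule found_next[OF f h t]) (auto simp: mt)
    then show ?thesis using bs tV mt o by (auto simp: answer_prog_def base_def answer_time_def add.commute)
  next
    case False
    then obtain x where x: "is_arg_min (eps_objective I) (\<lambda>x. x \<in> eps_feasible I (grid_point ?Z m t)) x"
      and o: "out = 1 # map floor (list_of_vec x)" using ans by (auto simp: eps_answer_def)
    have xf: "x \<in> eps_feasible I (grid_point ?Z m t)" using x by (simp add: is_arg_min_def)
    then have xs: "x \<in> solutions I" by (simp add: eps_feasible_def)
    then have xb: "x \<in> binary_vecs (num_vars I)" using sol by auto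
    then have xd: "dim_vec x = n" by (auto simp: binary_vecs_def n_def)
    have o0: "ar s aO 0 0 = 1" using out[of 0] o by simp
    have oj: "ar s aO 0 (Suc j) = \<lfloor>x $ j\<rfloor>" if "j < n" for j using out[of "Suc j"] that o xd by simp
    have x01: "\<bar>\<lfloor>x $ j\<rfloor>\<bar> \<le> 1" if "j < n" for j using xb that by (auto simp: binary_vecs_def n_def)
    define z where "z = (\<lambda>i. \<Sum>j<n. N i j * \<lfloor>x $ j\<rfloor>)"
    have cx: "objectives I *\<^sub>v x = scaled d D z"
      using outcome_scaled[OF xb] unfolding z_def N_def D_def d_def n_def .
    have zle: "z i \<le> ?Z (digit m t i) i - 1" if i: "i < d" for i
    proof -
      have "of_int (z i) / of_int D = row (objectives I) i \<bullet> x" using cx i d_def by (metis dim_mult_mat_vec index_mult_mat_vec index_vec scaled_def)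
      also have "\<dots> \<le> grid_point ?Z m t $ i" using xf i d_def by (auto simp: eps_feasible_def)
      also have "\<dots> = of_int (?Z (digit m t i) i - 1) / of_int D" using i by (simp add: grid_point_def scaled_def)
      finally have "(of_int (z i) :: rat) \<le> of_int (?Z (digit m t i) i - 1)"
        using D_pos by (simp add: divide_le_cancel del: of_int_diff)
      then show ?thesis by (simp only: of_int_le_iff)
    qed
    have zb: "\<bar>z i\<bar> \<le> bnd i" if i: "i < d" for i
    proof -
      have "\<bar>z i\<bar> \<le> (\<Sum>j<n. \<bar>N i j * \<lfloor>x $ j\<rfloor>\<bar>)" unfolding z_def by (rule sum_abs)
      also have "\<dots> \<le> (\<Sum>j<n. \<bar>N i j\<bar>)" using x01 by (intro sum_mono) (auto simp: abs_mult intro!: mult_left_le)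
      finally show ?thesis by (simp add: bnd_eq)
    qed
    have yf: "scaled d D z \<in> pareto_front I" using optimal_in_front[OF x] cx by simp
    let ?post = "\<lambda>s'. base s' \<and> (found s' m (Suc t) \<or> found s' (Suc m) 0) \<and> tm s' \<le> tm s + answer_time"
    let ?s0 = "s\<lparr>vs := (vs s)(vX := 1), tm := Suc (Suc (tm s))\<rparr>"
    let ?tl = "Cond (Var vNew) (vM ::= Var vM \<^bold>+ Lit 1;; vT ::= Lit 0;; emit_prog d) (vT ::= Var vT \<^bold>+ Lit 1)"
    have "wp w V (value_prog d) ?s0 (\<lambda>s'. wp w V (check_prog d) s' (\<lambda>s'. wp w V ?tl s' ?post))"
    proof (rule wp_value[where n = n and m = m and N = N and x = "\<lambda>j. \<lfloor>x $ j\<rfloor>"])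
      fix s1 assume f1: "frame (value_prog d) ?s0 s1"
        and z1: "\<And>i. i < d \<Longrightarrow> ar s1 aZ (Suc m) i = (\<Sum>j<n. N i j * \<lfloor>x $ j\<rfloor>)"
        and old: "\<And>k. k \<noteq> Suc m \<Longrightarrow> ar s1 aZ k = ar ?s0 aZ k"
        and t1: "tm s1 \<le> tm ?s0 + (d * (n * 5 + 7) + 2)"
      have zz: "ar s1 aZ (Suc m) i = z i" if "i < d" for i using z1[OF that] by (simp add: z_def)
      have oldZ: "\<And>k. k \<le> m \<Longrightarrow> ar s1 aZ k = ?Z k" using old by simp
      have bs1: "base s1" using bs f1 oldZ[of 0] by (auto simp: base_def frame_def)
      have fd1: "found s1 m t" by (rule found_cong[OF f]) (use f1 oldZ in \<open>auto simp: frame_def\<close>)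
      have m1: "vs s1 vM = int m" "vs s1 vT = int t" using fd1 by (auto simp: found_def)
      show "wp w V (check_prog d) s1 (\<lambda>s'. wp w V ?tl s' ?post)"
      proof (rule wp_check[OF m1(1)])
        fix s2 assume f2: "frame (check_prog d) s1 s2"
          and new: "vs s2 vNew = (if \<exists>k<m. \<forall>i<d. ar s1 aZ (Suc k) i = ar s1 aZ (Suc m) i then 0 else 1)"
          and t2: "tm s2 \<le> tm s1 + (m * (d * 6 + 8) + 3)"
        have t0: "tm ?s0 = tm s + 2" by simp
        have "m * (d * 6 + 8) \<le> F * (d * 6 + 8)" using mF by (intro mult_right_mono) auto
        then have t2': "tm s2 \<le> tm s + (d * (n * 5 + 7) + F * (d * 6 + 8) + 7)"
          using t1 t2 t0 by linarith
        have ar2: "ar s2 = ar s1" "ou s2 = ou s1" using f2 by (auto simp: frame_def fun_eq_iff)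
        have bs2: "base s2" using bs1 f2 by (auto simp: base_def frame_def)
        have fd2: "found s2 m t" by (rule found_cong[OF fd1]) (use f2 in \<open>auto simp: frame_def\<close>)
        have m2: "vs s2 vM = int m" "vs s2 vT = int t" using fd2 by (auto simp: found_def)
        show "wp w V ?tl s2 ?post"
        proof (cases "\<exists>k<m. \<forall>i<d. ar s1 aZ (Suc k) i = ar s1 aZ (Suc m) i")
          case True
          then obtain k where k: "k < m" "\<forall>i<d. ar s1 aZ (Suc k) i = z i" using zz by auto
          have "scaled d D (ar s1 aZ (Suc k)) = scaled d D z" using k by (simp add: scaled_eq_iff[OF D_pos])
          then have "scaled d D (ar s1 aZ (Suc k)) \<in> outcomes I" using yf by (simp add: pareto_front_def)
          moreover have "\<forall>i<d. ar s1 aZ (Suc k) i \<le> ar s1 aZ (digit m t i) i - 1"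
            using k zle oldZ digit_le by simp
          ultimately have h: "handled (ar s2 aZ) m t" using k(1) unfolding handled_def ar2 by blast
          have "found (s2\<lparr>vs := (vs s2)(vT := 1 + int t), tm := Suc (Suc (tm s2))\<rparr>) m (Suc t)"
            by (rule found_next[OF fd2 h t]) (auto simp: m2)
          moreover have "vs s2 vNew = 0" using new True by simp
          ultimately show ?thesis using bs2 tV m2 t2' by (simp add: base_def answer_time_def add.commute)
        next
          case False
          \<comment> \<open>The enlarged list still consists of distinct front points, so the
            incremented counter stays within \<open>F\<close> and hence within
            \<open>V\<close>.\<close>
          have mF1: "Suc m \<le> F" and ds: "distinct (points d D (ar s2 aZ) (Suc m))"
            and ss: "set (points d D (ar s2 aZ) (Suc m)) \<subseteq> pareto_front I"
          proof -
            have pz: "scaled d D (ar s2 aZ (Suc m)) = scaled d D z" using zz by (simp add: ar2 scaled_eq_iff[OF D_pos])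
            have "scaled d D (ar s2 aZ (Suc m)) \<notin> set (points d D (ar s2 aZ) m)"
              using False by (auto simp: points_def ar2 scaled_eq_iff[OF D_pos])
            then show ds: "distinct (points d D (ar s2 aZ) (Suc m))" using fd2 by (simp add: found_def points_def)
            show ss: "set (points d D (ar s2 aZ) (Suc m)) \<subseteq> pareto_front I" using fd2 pz yf by (auto simp: found_def points_def)
            have "card (set (points d D (ar s2 aZ) (Suc m))) = Suc m" using distinct_card[OF ds] by (simp add: points_def)
            then show "Suc m \<le> F" using card_mono[OF finite_front(1)[OF sol] ss] by simp
          qed
          let ?s3 = "s2\<lparr>vs := (vs s2)(vM := 1 + int m, vT := 0), tm := Suc (Suc (Suc (tm s2)))\<rparr>"
          have "wp w V (emit_prog d) ?s3 ?post"
          proof (rule wp_emit[where D = D and m = "Suc m"])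
            fix s4 assume f4: "frame (emit_prog d) ?s3 s4"
              and ou4: "ou s4 = ou ?s3 @ concat (map (\<lambda>i. rat_code (of_int (ar ?s3 aZ (Suc m) i) / of_int D)) [0..<d])"
              and t4: "tm s4 \<le> tm ?s3 + (d * (8 * b + 19) + 2)"
            have ar4: "ar s4 = ar s2" "vs s4 vM = int (Suc m)" "vs s4 vT = 0" using f4 by (auto simp: frame_def fun_eq_iff)
            have bs4: "base s4" using bs2 f4 by (auto simp: base_def frame_def)
            have ou4': "ou s4 = concat (map vec_code (points d D (ar s2 aZ) (Suc m)))"
              using ou4 fd2 by (simp add: found_def points_def vec_code_scaled)
            have "\<forall>k<Suc m. \<forall>i<d. \<bar>ar s2 aZ (Suc k) i\<bar> \<le> bnd i"
              using fd2 zb zz by (auto simp: found_def less_Suc_eq ar2)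
            then have "found s4 (Suc m) 0" using ar4 ds ss ou4' by (simp add: found_def)
            then show "?post s4" using bs4 t4 t2' by (simp add: answer_time_def)
          next
            show "\<And>i. i < d \<Longrightarrow> \<bar>ar ?s3 aZ (Suc m) i\<bar> \<le> 2 ^ b"
              using zz zb bnd_le(1) ar2 by (metis (no_types, lifting) order_trans st.select_convs(2) st.surjective st.update_convs(1) st.update_convs(4))
          qed (use bs2 D_pos DV dV in \<open>auto simp: base_def\<close>)
          moreover have "vs s2 vNew = 1" using new False by simp
          moreover have "1 + int m \<le> V" using mF1 V_ge(2) by linarith
          ultimately show ?thesis using m2 by (simp add: add.commute)
        qed
      qed (use dV mV in auto)
    qed (use bs f oj x01 bnd_le dV in \<open>auto simp: base_def found_def\<close>)
    then show ?thesis unfolding answer_prog_def using o0 by simp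
  qed
qed

definition round_time :: nat where
  "round_time = d * (8 * b + 22) + (\<tau> + 1) * (length M + 10) + answer_time + 20"

lemma wp_round:
  assumes bs: "base s" and f: "found s m t" and c: "calls s c" "int c + 1 \<le> V" and go: "vs s vGo = 1"
  shows "wp w V (round_prog d M) s (\<lambda>s'. base s' \<and>
     ((vs s' vGo = 1 \<and> t < (m + 1) ^ d \<and> calls s' (Suc c) \<and> (found s' m (Suc t) \<or> found s' (Suc m) 0)) \<or>
      (vs s' vGo = 0 \<and> t = (m + 1) ^ d \<and> calls s' c \<and> found s' m t)) \<and> tm s' \<le> tm s + round_time)"
    (is "wp w V _ s ?post")
  unfolding round_prog_def wp_simps(7)
proof (rule wp_eps[where D = D and m = m and t = t])
  let ?Z = "ar s aZ"
  have mF: "m \<le> F" by (rule found_le[OF f])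
  have "(m + 1) ^ d \<le> G" using mF by (intro power_mono) auto
  then show "int t \<le> 2 ^ b" using f V_ge(3) unfolding found_def by linarith
  show "int m \<le> 2 ^ b" using mF V_ge(2) by linarith
  show "\<bar>?Z k i - 1\<bar> \<le> 2 ^ b" if "k \<le> m" "i < d" for k i
    using slots_bounded[OF bs f that] bU[OF that(2)] UV by linarith
  show "vs s vD = D" "vs s vM = int m" "vs s vT = int t" using bs f by (auto simp: base_def found_def)
  show "0 < D" "D \<le> 2 ^ b" "int d \<le> 2 ^ b" by (fact D_pos DV dV(1))+
  fix s1 assume f1: "frame (eps_prog d) s s1" and tt: "vs s1 vTT = int (t div (m + 1) ^ d)"
    and E: "\<And>i. i < d \<Longrightarrow>
          ar s1 aE 0 (2 * i) = fst (quotient_of (of_int (?Z (digit m t i) i - 1) / of_int D)) \<and>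
          ar s1 aE 0 (2 * i + 1) = snd (quotient_of (of_int (?Z (digit m t i) i - 1) / of_int D))"
    and t1: "tm s1 \<le> tm s + (d * (8 * b + 22) + 3)"
  have fr: "ar s1 aZ = ?Z" "ar s1 aM = ar s aM" "vs s1 vN = int n" "vs s1 vGo = 1" "vs s1 vCall = int c"
    using f1 bs go c by (auto simp: frame_def base_def calls_def)
  have bs1: "base s1" using bs f1 by (auto simp: base_def frame_def)
  have fd1: "found s1 m t" by (rule found_cong[OF f]) (use f1 in \<open>auto simp: frame_def\<close>)
  have c1: "calls s1 c" using c f1 by (auto simp: calls_def frame_def)
  show "wp w V (Cond (Var vTT) (vGo ::= Lit 0) (sim_prog d M;; answer_prog d)) s1 ?post"
  proof (cases "t < (m + 1) ^ d")
    case False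
    then have t: "t = (m + 1) ^ d" using f by (auto simp: found_def)
    let ?s2 = "s1\<lparr>vs := (vs s1)(vGo := 0), tm := Suc (Suc (tm s1))\<rparr>"
    have "base ?s2" "calls ?s2 c" using bs1 c1 by (auto simp: base_def calls_def)
    moreover have "found ?s2 m t" by (rule found_cong[OF fd1]) auto
    ultimately show ?thesis using tt t t1 by (simp add: round_time_def)
  next
    case True
    define u where "u = (\<lambda>i. ?Z (digit m t i) i - 1)"
    have "\<forall>i<d. \<bar>u i\<bar> \<le> U"
    proof (intro allI impI)
      fix i assume i: "i < d"
      show "\<bar>u i\<bar> \<le> U"
        using slots_bounded[OF bs f digit_le[of m t i] i] bU[OF i] unfolding u_def by linarith
    qed
    from scalarization[OF this] obtain k pc mem out where k: "k \<le> \<tau>"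
      "run M (eps_input I (scaled d D u)) k = Some (pc, mem, out)" "pc < length M" "M ! pc = Halt"
      "\<forall>j pc m out a. j \<le> k \<longrightarrow> run M (eps_input I (scaled d D u)) j = Some (pc, m, out) \<longrightarrow> \<bar>m a\<bar> \<le> 2 ^ b"
      "eps_answer I (scaled d D u) out" by blast
    have gu: "grid_point ?Z m t = scaled d D u" by (simp add: grid_point_def u_def)
    let ?s1 = "s1\<lparr>tm := tm s1 + 1\<rparr>"
    have "wp w V (sim_prog d M) ?s1 (\<lambda>s2. wp w V (answer_prog d) s2 ?post)"
    proof (rule wp_sim[where c = c and n = n, OF k(2,3,4)])
      show "\<bar>ma a\<bar> \<le> 2 ^ b" if "j \<le> k" "run M (eps_input I (scaled d D u)) j = Some (pca, ma, outa)" for j pca ma outa a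
        using k(5) that by blast
      show "spliced w d n (ar ?s1 aE 0) (eps_input I (scaled d D u))"
        unfolding d_def n_def
        by (rule eps_input_spliced) (use E in \<open>auto simp: scaled_def u_def d_def\<close>)
      show "int k \<le> 2 ^ b" using k(1) MV(2) by linarith
      fix s2 assume f2: "frame (sim_prog d M) ?s1 s2" and cl: "vs s2 vCall = int (Suc c)"
        and o: "\<And>j. j < length out \<Longrightarrow> ar s2 aO 0 j = out ! j"
        and rows: "\<And>c'. c' \<noteq> Suc c \<Longrightarrow> ar s2 aM c' = ar ?s1 aM c'"
        and t2: "tm s2 \<le> tm ?s1 + ((k + 1) * (length M + 10) + 5)"
      have nm: "vN \<notin> mods (sim_prog d M)" "vD \<notin> mods (sim_prog d M)" "vM \<notin> mods (sim_prog d M)"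
        "vT \<notin> mods (sim_prog d M)" "vGo \<notin> mods (sim_prog d M)" "aN \<notin> amods (sim_prog d M)" "aZ \<notin> amods (sim_prog d M)"
        using sim_prog_mods[of d M] by auto
      have fr2: "vs s2 vN = vs s1 vN" "vs s2 vD = vs s1 vD" "vs s2 vM = vs s1 vM" "vs s2 vT = vs s1 vT"
        "vs s2 vGo = 1" "ar s2 aN = ar s1 aN" "ar s2 aZ = ar s1 aZ" "ou s2 = ou s1"
        using f2[unfolded frame_def] nm fr sim_prog_mods(3)[of d M] by simp_all
      have bs2: "base s2" using bs1 fr2 by (simp add: base_def)
      have fd2: "found s2 m t" by (rule found_cong[OF fd1]) (simp_all add: fr2)
      have c2: "calls s2 (Suc c)" using c1 cl rows by (simp add: calls_def)
      have t0: "tm ?s1 = tm s1 + 1" by simp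
      have "(k + 1) * (length M + 10) \<le> (\<tau> + 1) * (length M + 10)" using k(1) by (intro mult_right_mono) auto
      then have t2': "tm s2 \<le> tm s + (d * (8 * b + 22) + (\<tau> + 1) * (length M + 10) + 9)"
        using t1 t2 t0 by linarith
      have "wp w V (answer_prog d) s2 (\<lambda>s'. base s' \<and> (found s' m (Suc t) \<or> found s' (Suc m) 0) \<and> tm s' \<le> tm s2 + answer_time)"
        by (rule wp_answer[OF bs2 fd2 True _ o]) (use k(6) gu fr2 fr in simp)
      then show "wp w V (answer_prog d) s2 ?post"
      proof (rule wp_mono)
        fix s3 assume f3: "frame (answer_prog d) s2 s3"
          and p: "base s3 \<and> (found s3 m (Suc t) \<or> found s3 (Suc m) 0) \<and> tm s3 \<le> tm s2 + answer_time"
        have "vs s3 vGo = 1" "calls s3 (Suc c)"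
          using f3 fr2 c2 answer_prog_mods[of d] by (simp_all add: frame_def calls_def)
        then show "?post s3" using p t2' True by (simp add: round_time_def)
      qed
    qed (use fr c c1 MV in \<open>auto simp: calls_def\<close>)
    then show ?thesis using tt True by simp
  qed
qed

definition enumeration_time :: nat where
  "enumeration_time = d * n * 4 + d * (n * 9 + 7) + 10 + rounds * (round_time + 1)"

theorem wp_main:
  "wp w V (main_prog d M) init_st (\<lambda>s'. \<exists>ys. ou s' = concat (map vec_code ys) \<and> distinct ys \<and>
     set ys = pareto_front I \<and> tm s' \<le> enumeration_time)" (is "wp w V _ init_st ?post")
  unfolding main_prog_def wp_simps(7)
proof (rule wp_init[where n = n])
  show "read_input w 0 = int n" by (simp add: read_input_def moco_input_def n_def)
  show "0 < den_at w k" if "k < d * n" for k using den_at_pos that by (simp add: d_def n_def)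
  show "1 + (\<Sum>j<n. \<bar>cleared w d n i j\<bar>) \<le> 2 ^ b" if "i < d" for i
    using bnd_le(1)[OF that] by (simp add: bnd_eq N_def)
  show "\<bar>num_at w k\<bar> \<le> 2 ^ b" if "k < d * n" for k using numV[OF that] .
  show "den_prod w (d * n) \<le> 2 ^ b" using DV by (simp add: D_def)
  fix s1 assume f1: "frame (init_prog d) init_st s1" and s1: "vs s1 vN = int n" "vs s1 vD = den_prod w (d * n)"
      "\<And>i j. i < d \<Longrightarrow> j < n \<Longrightarrow> ar s1 aN i j = cleared w d n i j"
      "\<And>i. i < d \<Longrightarrow> ar s1 aZ 0 i = 1 + (\<Sum>j<n. \<bar>cleared w d n i j\<bar>)"
      and t1: "tm s1 \<le> tm init_st + (d * n * 4 + d * (n * 9 + 7) + 6)"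
  let ?s2 = "s1\<lparr>vs := (vs s1)(vGo := 1), tm := Suc (tm s1)\<rparr>"
  have bs: "base ?s2" using s1[folded D_def N_def] by (simp add: base_def bnd_eq)
  have fd: "found ?s2 0 0" and cl: "calls ?s2 0"
    using f1 by (auto simp: found_def calls_def frame_def init_st_def points_def)
  \<comment> \<open>Lexicographic rank: a new point lowers \<open>F - m\<close> and thereby releases
    \<open>G + 1\<close>, enough for resetting \<open>t\<close> from any position in the grid; an
    old answer lowers \<open>G - t\<close>. Calls plus rank never exceed \<open>rounds\<close>, so
    the call counter stays within \<open>V\<close>.\<close>
  let ?I = "\<lambda>k (s::st). base s \<and> (\<exists>m t c. found s m t \<and> calls s c \<and> c + k \<le> rounds \<and>
      ((vs s vGo = 1 \<and> k = (F - m) * (G + 1) + (G - t) + 1) \<or> (vs s vGo = 0 \<and> k = 0 \<and> t = (m + 1) ^ d)))"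
  have "wp w V (Loop (Var vGo) (round_prog d M)) ?s2 ?post"
  proof (rule wp_Loop[where I = ?I and n = rounds and T = round_time])
    show "?I rounds ?s2" using bs fd cl by (auto intro!: exI[of _ "0::nat"])
  next
    fix k and s :: st assume I: "?I k s" and pos: "0 < aval (Var vGo) (vs s)"
    then obtain m t c where bs: "base s" and fd: "found s m t" and c: "calls s c" "c + k \<le> rounds"
      and go: "vs s vGo = 1" and k: "k = (F - m) * (G + 1) + (G - t) + 1" by auto
    have cV: "int c + 1 \<le> V" using c(2) k V_ge(4) by linarith
    have bs': "base (s\<lparr>tm := tm s + 1\<rparr>)" "calls (s\<lparr>tm := tm s + 1\<rparr>) c" "vs (s\<lparr>tm := tm s + 1\<rparr>) vGo = 1"
      using bs c go by (simp_all add: base_def calls_def)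
    have fd': "found (s\<lparr>tm := tm s + 1\<rparr>) m t" by (rule found_cong[OF fd]) auto
    show "wp w V (round_prog d M) (s\<lparr>tm := tm s + 1\<rparr>) (\<lambda>s''. (\<exists>k'<k. ?I k' s'') \<and> tm s'' \<le> tm s + 1 + round_time)"
    proof (rule wp_mono[OF wp_round[OF bs'(1) fd' bs'(2) cV bs'(3)]])
      fix s3
      assume p: "base s3 \<and>
        ((vs s3 vGo = 1 \<and> t < (m + 1) ^ d \<and> calls s3 (Suc c) \<and> (found s3 m (Suc t) \<or> found s3 (Suc m) 0)) \<or>
         (vs s3 vGo = 0 \<and> t = (m + 1) ^ d \<and> calls s3 c \<and> found s3 m t)) \<and>
        tm s3 \<le> tm (s\<lparr>tm := tm s + 1\<rparr>) + round_time"
      have mF: "m \<le> F" by (rule found_le[OF fd])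
      have mG: "(m + 1) ^ d \<le> G" using mF by (intro power_mono) auto
      have "\<exists>k'<k. ?I k' s3"
      proof -
        consider (stop) "vs s3 vGo = 0" "t = (m + 1) ^ d" "calls s3 c" "found s3 m t"
          | (old) "vs s3 vGo = 1" "t < (m + 1) ^ d" "calls s3 (Suc c)" "found s3 m (Suc t)"
          | (new) "vs s3 vGo = 1" "t < (m + 1) ^ d" "calls s3 (Suc c)" "found s3 (Suc m) 0"
          using p by blast
        then show ?thesis
        proof cases
          case stop
          have "c + 0 \<le> rounds" using c(2) by linarith
          then have "?I 0 s3" using p stop by (intro conjI exI[of _ m] exI[of _ t] exI[of _ c] disjI2) simp_all
          then show ?thesis using k by (intro exI[of _ 0]) simp
        next
          case old
          let ?k = "(F - m) * (G + 1) + (G - Suc t) + 1"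
          have lt: "?k < k" using old(2) mG k by simp
          moreover have "Suc c + ?k \<le> rounds" using lt c(2) by linarith
          then have "?I ?k s3" using p old
            by (intro conjI exI[of _ "m"] exI[of _ "Suc t"] exI[of _ "Suc c"] disjI1) (simp_all only: refl)
          ultimately show ?thesis by blast
        next
          case new
          let ?k = "(F - Suc m) * (G + 1) + (G - 0) + 1"
          have "F - m = Suc (F - Suc m)" using found_le[OF new(4)] by simp
          then have "(F - m) * (G + 1) = (F - Suc m) * (G + 1) + (G + 1)" by simp
          then have lt: "?k < k" using new(2) mG k by linarith
          moreover have "Suc c + ?k \<le> rounds" using lt c(2) by linarith
          then have "?I ?k s3" using p new
            by (intro conjI exI[of _ "Suc m"] exI[of _ "0"] exI[of _ "Suc c"] disjI1) (simp_all only: refl)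
          ultimately show ?thesis by blast
        qed
      qed
      then show "(\<exists>k'<k. ?I k' s3) \<and> tm s3 \<le> tm s + 1 + round_time" using p by simp
    qed
  next
    fix k and s :: st assume I: "?I k s" and neg: "\<not> 0 < aval (Var vGo) (vs s)"
      and t: "tm s \<le> tm ?s2 + rounds * (round_time + 1)"
    then obtain m where "base s" "found s m ((m + 1) ^ d)" by auto
    then show "?post (s\<lparr>tm := tm s + 1\<rparr>)"
      using found_end[of s m "(m + 1) ^ d"] t t1
      by (intro exI[of _ "points d D (ar s aZ) m"]) (simp add: found_def enumeration_time_def init_st_def)
  qed
  then show "wp w V (vGo ::= Lit 1) s1 (\<lambda>s'. wp w V (Loop (Var vGo) (round_prog d M)) s' ?post)"
    by simp
qed (use dV in auto)

end

section \<open>Polynomial bounds\<close>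

text \<open>Coefficients are natural numbers, so nothing can cancel. Monotonicity is what allows
  sizes to be replaced by upper bounds later.\<close>

lemma poly_nat_mono: "x \<le> y \<Longrightarrow> poly p x \<le> poly p y" for p :: "nat poly"
  by (induction p) (auto intro: add_mono mult_mono)

definition poly_bounded :: "(nat \<Rightarrow> nat) \<Rightarrow> bool" where
  "poly_bounded f \<longleftrightarrow> (\<exists>p. \<forall>x. f x \<le> poly p x)"

lemma poly_bounded_const: "poly_bounded (\<lambda>_. c)"
  unfolding poly_bounded_def by (rule exI[of _ "[:c:]"]) simp

lemma poly_bounded_id: "poly_bounded (\<lambda>x. x)"
  unfolding poly_bounded_def by (rule exI[of _ "[:0, 1:]"]) simp

lemma poly_bounded_add: "poly_bounded f \<Longrightarrow> poly_bounded g \<Longrightarrow> poly_bounded (\<lambda>x. f x + g x)"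
  unfolding poly_bounded_def by (metis add_mono poly_add)

lemma poly_bounded_mult: "poly_bounded f \<Longrightarrow> poly_bounded g \<Longrightarrow> poly_bounded (\<lambda>x. f x * g x)"
  unfolding poly_bounded_def by (metis mult_le_mono poly_mult)

text \<open>The exponent is constant. Through this rule the fixed number of objectives makes
  \<open>(F + 1) ^ d\<close> polynomial.\<close>

lemma poly_bounded_power: "poly_bounded f \<Longrightarrow> poly_bounded (\<lambda>x. f x ^ k)"
  by (induction k) (simp_all add: poly_bounded_const poly_bounded_mult)

lemma poly_bounded_poly: "poly_bounded f \<Longrightarrow> poly_bounded (\<lambda>x. poly p (f x))"
  unfolding poly_bounded_def by (metis order_trans poly_nat_mono poly_pcompose)

lemmas poly_bounded_intros = poly_bounded_const poly_bounded_id poly_bounded_add poly_bounded_mult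
  poly_bounded_power poly_bounded_poly

lemma ram_outputs_mono: "ram_outputs M w t b out \<Longrightarrow> t \<le> t' \<Longrightarrow> b \<le> b' \<Longrightarrow> ram_outputs M w t' b' out"
  unfolding ram_outputs_def by (meson order_trans)

section \<open>Size of the numbers\<close>

lemma rat_size_eq: "rat_size r = int_size (fst (quotient_of r)) + int_size (snd (quotient_of r))"
  by (simp add: rat_size_def rat_code_eq)

lemma rat_size_le_mat_size:
  assumes "i < dim_row A" "j < dim_col A"
  shows "rat_size (A $$ (i, j)) \<le> mat_size A"
proof -
  have "rat_size (A $$ (i, j)) \<le> (\<Sum>j<dim_col A. rat_size (A $$ (i, j)))"
    using assms by (intro member_le_sum) auto
  also have "\<dots> \<le> mat_size A"
    unfolding mat_size_def using assms by (intro member_le_sum[of i _ "\<lambda>i. \<Sum>j<dim_col A. rat_size (A $$ (i, j))"]) auto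
  finally show ?thesis .
qed

lemma sum_lessThan_mult: "(\<Sum>k<d * n. f k) = (\<Sum>i<d. \<Sum>j<n. f (i * n + j))" for f :: "nat \<Rightarrow> nat"
proof -
  have "sum f {i * n..<i * n + n} = (\<Sum>j<n. f (i * n + j))" for i
    using sum.shift_bounds_nat_ivl[of f 0 "i * n" n] by (simp add: lessThan_atLeast0 add.commute)
  then show ?thesis by (simp flip: sum.nat_group)
qed

text \<open>Encoding lengths of factors add up, and the length of each denominator is part of that
  of its entry; thus even the plain product of all denominators is short.\<close>

lemma den_prod_le: "den_prod (moco_input I) (num_objs I * num_vars I) \<le> 2 ^ mat_size (objectives I)"
proof -
  let ?w = "moco_input I" and ?d = "num_objs I" and ?n = "num_vars I"
  have "den_prod ?w (?d * ?n) \<le> (\<Prod>k<?d * ?n. 2 ^ int_size (den_at ?w k))"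
    unfolding den_prod_def
  proof (rule prod_mono)
    fix k assume "k \<in> {..<?d * ?n}"
    then show "0 \<le> den_at ?w k \<and> den_at ?w k \<le> 2 ^ int_size (den_at ?w k)"
      using den_at_pos[of k I] abs_le_int_size[of "den_at ?w k"] by auto
  qed
  also have "\<dots> = 2 ^ (\<Sum>k<?d * ?n. int_size (den_at ?w k))" by (simp add: power_sum)
  also have "\<dots> \<le> 2 ^ mat_size (objectives I)"
  proof (rule power_increasing)
    have "(\<Sum>k<?d * ?n. int_size (den_at ?w k)) = (\<Sum>i<?d. \<Sum>j<?n. int_size (den_at ?w (i * ?n + j)))"
      by (rule sum_lessThan_mult)
    also have "\<dots> \<le> mat_size (objectives I)"
      unfolding mat_size_def by (intro sum_mono) (simp add: moco_input_entries rat_size_eq)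
    finally show "(\<Sum>k<?d * ?n. int_size (den_at ?w k)) \<le> mat_size (objectives I)" .
  qed simp
  finally show ?thesis .
qed

lemma num_at_le:
  assumes "k < num_objs I * num_vars I"
  shows "\<bar>num_at (moco_input I) k\<bar> \<le> 2 ^ mat_size (objectives I)"
proof -
  let ?n = "num_vars I"
  have n: "0 < ?n" using assms by (cases ?n) auto
  have i: "k div ?n < num_objs I" "k mod ?n < ?n" using assms n by (simp_all add: less_mult_imp_div_less)
  have "num_at (moco_input I) k = fst (quotient_of (objectives I $$ (k div ?n, k mod ?n)))"
    using moco_input_entries(1)[OF i] by simp
  then have "(2::int) ^ int_size (num_at (moco_input I) k) \<le> 2 ^ mat_size (objectives I)"
    using rat_size_le_mat_size[of "k div ?n" "objectives I" "k mod ?n"] i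
    by (intro power_increasing) (auto simp: rat_size_eq)
  then show ?thesis using abs_le_int_size[of "num_at (moco_input I) k"] by linarith
qed

text \<open>One \<open>mat_size\<close> pays for the numerator, the other for the cofactor of the
  denominator in the product.\<close>

lemma cleared_le:
  assumes "i < num_objs I" "j < num_vars I"
  shows "\<bar>cleared (moco_input I) (num_objs I) (num_vars I) i j\<bar> \<le> 2 ^ (2 * mat_size (objectives I))"
proof -
  let ?k = "i * num_vars I + j" and ?D = "den_prod (moco_input I) (num_objs I * num_vars I)"
  have k: "?k < num_objs I * num_vars I" using assms by (rule index_lt)
  have "0 < ?D" unfolding den_prod_def by (intro prod_pos) (auto intro: den_at_pos)
  then have "\<bar>?D div den_at (moco_input I) ?k\<bar> \<le> 2 ^ mat_size (objectives I)"
    using abs_zdiv_le[of ?D "den_at (moco_input I) ?k"] den_prod_le[of I] by linarith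
  then show ?thesis
    unfolding cleared_def abs_mult mult_2 power_add using num_at_le[OF k] by (intro mult_mono) auto
qed

text \<open>Passing to lowest terms does not enlarge numerator or denominator; each of them has
  length at most \<open>b + 2\<close>.\<close>

lemma vec_size_scaled_le:
  assumes "0 < D" "D \<le> 2 ^ b" "\<forall>i<d. \<bar>u i\<bar> \<le> 2 ^ b"
  shows "vec_size (scaled d D u) \<le> d * (2 * b + 4)"
proof -
  have "vec_size (scaled d D u) = (\<Sum>i<d. rat_size (of_int (u i) / of_int D))" by (simp add: vec_size_def scaled_def)
  also have "\<dots> \<le> (\<Sum>i<d. 2 * b + 4)"
  proof (rule sum_mono)
    fix i assume "i \<in> {..<d}"
    then have "\<bar>u i\<bar> \<le> 2 ^ b" using assms by simp
    then have "\<bar>fst (quotient_of (of_int (u i) / of_int D))\<bar> \<le> 2 ^ b"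
       "\<bar>snd (quotient_of (of_int (u i) / of_int D))\<bar> \<le> 2 ^ b"
      using quotient_of_bounds[OF assms(1), of "u i"] assms(2) by linarith+
    note this[THEN int_size_le]
    then show "rat_size (of_int (u i) / of_int D) \<le> 2 * b + 4" by (simp add: rat_size_eq)
  qed
  finally show ?thesis by simp
qed

section \<open>Explicit time and bit bounds\<close>

definition time_bound :: "nat \<Rightarrow> nat \<Rightarrow> nat \<Rightarrow> nat \<Rightarrow> nat \<Rightarrow> nat \<Rightarrow> nat" where
  "time_bound d l b \<tau> n F = d * n * 4 + d * (n * 9 + 7) + 10 +
     (F * ((F + 1) ^ d + 1) + (F + 1) ^ d + 1) *
      (d * (8 * b + 22) + (\<tau> + 1) * (l + 10) +
       (d * (n * 5 + 7) + F * (d * 6 + 8) + d * (8 * b + 19) + 20) + 20 + 1)"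

lemma time_bound_mono:
  "b \<le> b' \<Longrightarrow> \<tau> \<le> \<tau>' \<Longrightarrow> n \<le> n' \<Longrightarrow> F \<le> F' \<Longrightarrow> time_bound d l b \<tau> n F \<le> time_bound d l b' \<tau>' n' F'"
  unfolding time_bound_def by (intro add_mono mult_mono power_mono order_refl) auto

lemma (in pareto_enumeration) enumeration_time_eq:
  "enumeration_time = time_bound d (length M) b \<tau> n F"
  by (simp add: enumeration_time_def time_bound_def round_time_def answer_time_def)

text \<open>Instance plus right-hand side with numerators up to \<open>2 ^ (3 * S + 2)\<close>, as
  measured by \<open>vec_size_scaled_le\<close>.\<close>

definition rhs_size :: "nat \<Rightarrow> nat \<Rightarrow> nat" where
  "rhs_size d S = S + d * (2 * (3 * S + 2) + 4)"

text \<open>A sum in place of a maximum keeps this visibly polynomial. The summands cover program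
  length, time and cell length of the calls, dimensions, and the numbers in matrix and slots; the
  last one is the exponent for the number of rounds.\<close>

definition bit_bound :: "nat \<Rightarrow> nat \<Rightarrow> nat poly \<Rightarrow> nat poly \<Rightarrow> nat \<Rightarrow> nat" where
  "bit_bound l d p q S = l + poly p (rhs_size d S) + poly q (rhs_size d S) + d + d * S + (3 * S + 2) +
     (S + 2 + (S + 1) * d)"

lemma rhs_size_mono: "S \<le> S' \<Longrightarrow> rhs_size d S \<le> rhs_size d S'"
  unfolding rhs_size_def by (intro add_mono mult_mono) auto

lemma bit_bound_mono: "S \<le> S' \<Longrightarrow> bit_bound l d p q S \<le> bit_bound l d p q S'"
  unfolding bit_bound_def by (intro add_mono mult_mono poly_nat_mono rhs_size_mono) auto

lemma instance_enumeration:
  assumes sol: "solutions I \<subseteq> binary_vecs (num_vars I)" and d: "num_objs I = d"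
    and sc: "\<And>\<epsilon>. \<epsilon> \<in> carrier_vec d \<Longrightarrow>
      \<exists>out. ram_outputs M (eps_input I \<epsilon>) (poly p (input_size I + vec_size \<epsilon>)) (poly q (input_size I + vec_size \<epsilon>)) out
        \<and> eps_answer I \<epsilon> out"
    and b: "bit_bound (length M) d p q (input_size I) \<le> b"
  defines "D \<equiv> den_prod (moco_input I) (d * num_vars I)"
    and "N \<equiv> cleared (moco_input I) d (num_vars I)"
  shows "pareto_enumeration I M b (poly p (rhs_size d (input_size I))) d (num_vars I)
    (2 ^ (3 * input_size I + 2)) D N (\<lambda>i. 1 + (\<Sum>j<num_vars I. \<bar>N i j\<bar>))"
proof
  let ?S = "input_size I" and ?n = "num_vars I" and ?F = "card (pareto_front I)"
  have S: "?n \<le> ?S" "mat_size (objectives I) \<le> ?S" by (simp_all add: input_size_def)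
  have pw: "(2::int) ^ k \<le> 2 ^ b" if "k \<le> b" for k using that by (intro power_increasing) auto
  have small: "int k \<le> 2 ^ b" if "k \<le> b" for k
    using pw[OF that] of_nat_less_two_power[of k, where 'a = int] by linarith
  have Dle: "D \<le> 2 ^ ?S"
    using den_prod_le[of I] power_increasing[OF S(2), of "2::int"] unfolding D_def d by linarith
  have Dpos: "0 < D" unfolding D_def den_prod_def d[symmetric] by (intro prod_pos) (auto intro: den_at_pos)
  \<comment> \<open>At most \<open>2 ^ ?S\<close> summands of size at most
    \<open>2 ^ (2 * ?S)\<close> give \<open>3 * ?S\<close>; the two ones are absorbed by a factor of
    4.\<close>
  show "1 + (\<Sum>j<?n. \<bar>N i j\<bar>) + 1 \<le> 2 ^ (3 * ?S + 2)" if i: "i < d" for i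
  proof -
    have "(\<Sum>j<?n. \<bar>N i j\<bar>) \<le> (\<Sum>j<?n. 2 ^ (2 * ?S))"
    proof (rule sum_mono)
      fix j assume "j \<in> {..<?n}"
      then have "\<bar>N i j\<bar> \<le> 2 ^ (2 * mat_size (objectives I))" using cleared_le[of i I j] i d by (simp add: N_def)
      also have "\<dots> \<le> 2 ^ (2 * ?S)" using S(2) by (intro power_increasing) auto
      finally show "\<bar>N i j\<bar> \<le> 2 ^ (2 * ?S)" .
    qed
    also have "\<dots> = int ?n * 2 ^ (2 * ?S)" by simp
    also have "\<dots> \<le> 2 ^ ?S * 2 ^ (2 * ?S)"
    proof (rule mult_right_mono)
      show "int ?n \<le> 2 ^ ?S" using S(1) of_nat_less_two_power[of ?S, where 'a = int] by linarith
    qed simp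
    also have "\<dots> = 2 ^ (3 * ?S)" by (simp flip: power_add)
    finally have "(\<Sum>j<?n. \<bar>N i j\<bar>) \<le> 2 ^ (3 * ?S)" .
    moreover have "(1::int) \<le> 2 ^ (3 * ?S)" by simp
    moreover have "(2::int) ^ (3 * ?S + 2) = 4 * 2 ^ (3 * ?S)" by simp
    ultimately show ?thesis by linarith
  qed
  show "(2::int) ^ (3 * ?S + 2) \<le> 2 ^ b" using b by (intro pw) (simp add: bit_bound_def)
  have "(2::int) ^ ?S \<le> 2 ^ b" using b by (intro pw) (simp add: bit_bound_def)
  then show "D \<le> 2 ^ b" using Dle by linarith
  show "\<bar>num_at (moco_input I) k\<bar> \<le> 2 ^ b" if "k < d * ?n" for k
  proof -
    have "\<bar>num_at (moco_input I) k\<bar> \<le> 2 ^ mat_size (objectives I)" using num_at_le[of k I] that d by simp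
    also have "\<dots> \<le> 2 ^ ?S" using S(2) by (intro power_increasing) auto
    finally show ?thesis using \<open>(2::int) ^ ?S \<le> 2 ^ b\<close> by linarith
  qed
  show "int d \<le> 2 ^ b" "int (length M) \<le> 2 ^ b" "int (poly p (rhs_size d ?S)) \<le> 2 ^ b"
    by (rule small, use b in \<open>simp add: bit_bound_def\<close>)+
  show "int ?n \<le> 2 ^ b" using b S(1) by (intro small) (simp add: bit_bound_def)
  have "d * ?n \<le> d * ?S" using S(1) by (rule mult_left_mono) simp
  then have "d * ?n \<le> b" using b unfolding bit_bound_def by linarith
  then show "int d * int ?n \<le> 2 ^ b" using small[of "d * ?n"] by simp
  show "int (?F * ((?F + 1) ^ d + 1) + (?F + 1) ^ d + 1) \<le> 2 ^ b"
  proof -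
    let ?G = "2 ^ ((?S + 1) * d) :: nat"
    have "?F \<le> 2 ^ ?S" using finite_front(2)[OF sol] power_increasing[OF S(1), of "2::nat"] by linarith
    moreover have "(1::nat) \<le> 2 ^ ?S" "(2::nat) ^ (?S + 1) = 2 * 2 ^ ?S" by simp_all
    ultimately have F: "?F + 1 \<le> 2 ^ (?S + 1)" "?F \<le> 2 ^ ?S" by linarith+
    have "(?F + 1) ^ d \<le> (2 ^ (?S + 1)) ^ d" using F by (intro power_mono) auto
    then have G: "(?F + 1) ^ d \<le> ?G" unfolding power_mult .
    have "1 \<le> ?G" by simp
    have "?F * ((?F + 1) ^ d + 1) \<le> 2 ^ ?S * (?G + ?G)"
      using F G \<open>1 \<le> ?G\<close> by (intro mult_mono add_mono) auto
    moreover have "1 * ?G \<le> 2 ^ ?S * ?G" by (intro mult_right_mono) auto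
    \<comment> \<open>Four copies of \<open>2 ^ ?S * ?G\<close>, two for the restarts and one for
      each remaining summand, explain the 2 in the exponent.\<close>
    moreover have "2 ^ ?S * (?G + ?G) + 2 ^ ?S * ?G + 2 ^ ?S * ?G = 2 ^ (?S + 2 + (?S + 1) * d)"
      by (simp add: power_add)
    ultimately have "?F * ((?F + 1) ^ d + 1) + (?F + 1) ^ d + 1 \<le> 2 ^ (?S + 2 + (?S + 1) * d)"
      using G \<open>1 \<le> ?G\<close> by linarith
    moreover have "?S + 2 + (?S + 1) * d \<le> b" using b unfolding bit_bound_def by linarith
    then have "(2::nat) ^ (?S + 2 + (?S + 1) * d) \<le> 2 ^ b" by (intro power_increasing) auto
    ultimately have "?F * ((?F + 1) ^ d + 1) + (?F + 1) ^ d + 1 \<le> 2 ^ b" by linarith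
    then show ?thesis by (metis of_nat_le_iff of_nat_numeral of_nat_power)
  qed
  fix u :: "nat \<Rightarrow> int" assume u: "\<forall>i<d. \<bar>u i\<bar> \<le> 2 ^ (3 * ?S + 2)"
  let ?e = "scaled d D u"
  have "D \<le> 2 ^ (3 * ?S + 2)"
    using Dle power_increasing[of ?S "3 * ?S + 2" "2::int"] by linarith
  then have "vec_size ?e \<le> d * (2 * (3 * ?S + 2) + 4)" using u Dpos by (intro vec_size_scaled_le) auto
  then have sz: "?S + vec_size ?e \<le> rhs_size d ?S" by (simp add: rhs_size_def)
  have "?e \<in> carrier_vec d" by (simp add: scaled_def)
  from sc[OF this] obtain out where o: "eps_answer I ?e out"
    "ram_outputs M (eps_input I ?e) (poly p (?S + vec_size ?e)) (poly q (?S + vec_size ?e)) out" by blast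
  have "ram_outputs M (eps_input I ?e) (poly p (rhs_size d ?S)) b out"
    by (rule ram_outputs_mono[OF o(2)])
      (use sz b poly_nat_mono[OF sz, of q] in \<open>auto intro: poly_nat_mono simp: bit_bound_def\<close>)
  then obtain k pc m where k: "k \<le> poly p (rhs_size d ?S)" "run M (eps_input I ?e) k = Some (pc, m, out)"
      "pc < length M" "M ! pc = Halt"
    and mem: "\<forall>j\<le>k. \<forall>pc' m' out'. run M (eps_input I ?e) j = Some (pc', m', out') \<longrightarrow> (\<forall>a. int_size (m' a) \<le> b)"
    unfolding ram_outputs_def by blast
  have "\<bar>m' a\<bar> \<le> 2 ^ b" if "j \<le> k" "run M (eps_input I ?e) j = Some (pc', m', out')" for j pc' m' out' a
  proof -
    have "int_size (m' a) \<le> b" using mem that by blast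
    then have "(2::int) ^ int_size (m' a) \<le> 2 ^ b" by (rule pw)
    then show ?thesis using abs_le_int_size[of "m' a"] by linarith
  qed
  then show "\<exists>k pc m out. k \<le> poly p (rhs_size d ?S) \<and> run M (eps_input I ?e) k = Some (pc, m, out) \<and>
       pc < length M \<and> M ! pc = Halt \<and>
       (\<forall>j pc m out a. j \<le> k \<longrightarrow> run M (eps_input I ?e) j = Some (pc, m, out) \<longrightarrow> \<bar>m a\<bar> \<le> 2 ^ b) \<and>
       eps_answer I ?e out"
    using k o(1) by blast
qed (use sol d in \<open>simp_all add: D_def N_def\<close>)

theorem corollary3p1:
  fixes P :: "moco_instance set" and d :: nat
  assumes "moco_problem P"
    and "eps_constraint_poly_time P"
  shows "pareto_front_output_poly_time {I \<in> P. num_objs I = d}"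
proof -
  obtain M and p q :: "nat poly" where sc: "\<And>I \<epsilon>. I \<in> P \<Longrightarrow> \<epsilon> \<in> carrier_vec (num_objs I) \<Longrightarrow>
      \<exists>out. ram_outputs M (eps_input I \<epsilon>) (poly p (input_size I + vec_size \<epsilon>)) (poly q (input_size I + vec_size \<epsilon>)) out
        \<and> eps_answer I \<epsilon> out"
    using assms(2) unfolding eps_constraint_poly_time_def Let_def by blast
  \<comment> \<open>The program depends on \<open>d\<close> and \<open>M\<close> only, so one
    machine serves all instances.\<close>
  obtain M' K L where M': "\<And>w b s. L \<le> b \<Longrightarrow> bs w (2 ^ b) (main_prog d M) init_st s \<Longrightarrow>
     ram_outputs M' w (K * tm s) (K * b + 2) (ou s)"
    using compile_com[of "main_prog d M"] by blast
  define B where "B = (\<lambda>S. L + bit_bound (length M) d p q S)"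
  \<comment> \<open>Input size, number of variables and cardinality of the front are all replaced by
    a common bound \<open>x\<close>, later their sum \<open>?S + ?F\<close>. The cells, in contrast,
    are bounded through \<open>B\<close> at the input size alone.\<close>
  define T where "T = (\<lambda>x. K * time_bound d (length M) (B x) (poly p (rhs_size d x)) x x)"
  have Bb: "poly_bounded (\<lambda>S. K * B S + 2)"
    unfolding B_def bit_bound_def rhs_size_def by (intro poly_bounded_intros)
  have Tb: "poly_bounded T"
    unfolding T_def B_def bit_bound_def rhs_size_def time_bound_def by (intro poly_bounded_intros)
  obtain q' where q': "\<And>S. K * B S + 2 \<le> poly q' S" using Bb unfolding poly_bounded_def by blast
  obtain p' where p': "\<And>x. T x \<le> poly p' x" using Tb unfolding poly_bounded_def by blast
  show ?thesis
    unfolding pareto_front_output_poly_time_def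
  proof (rule exI[of _ M'], rule exI[of _ p'], rule exI[of _ q'], rule ballI)
    fix I assume "I \<in> {I \<in> P. num_objs I = d}"
    then have I: "I \<in> P" "num_objs I = d" by auto
    let ?S = "input_size I" and ?n = "num_vars I" and ?F = "card (pareto_front I)"
    have sol: "solutions I \<subseteq> binary_vecs ?n" using assms(1) I by (simp add: moco_problem_def)
    have loc: "pareto_enumeration I M (B ?S) (poly p (rhs_size d ?S)) d ?n (2 ^ (3 * ?S + 2))
      (den_prod (moco_input I) (d * ?n)) (cleared (moco_input I) d ?n)
      (\<lambda>i. 1 + (\<Sum>j<?n. \<bar>cleared (moco_input I) d ?n i j\<bar>))"
      by (rule instance_enumeration[OF sol I(2)]) (use sc[OF I(1)] I(2) in \<open>auto simp: B_def\<close>)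
    obtain s ys where s: "bs (moco_input I) (2 ^ B ?S) (main_prog d M) init_st s"
        "ou s = concat (map vec_code ys)" "distinct ys" "set ys = pareto_front I" "tm s \<le> time_bound d (length M) (B ?S) (poly p (rhs_size d ?S)) ?n ?F"
      using pareto_enumeration.wp_main[OF loc] unfolding wp_def pareto_enumeration.enumeration_time_eq[OF loc] by blast
    have "ram_outputs M' (moco_input I) (K * tm s) (K * B ?S + 2) (ou s)"
      by (rule M'[OF _ s(1)]) (simp add: B_def)
    then have "ram_outputs M' (moco_input I) (poly p' (?S + ?F)) (poly q' ?S) (ou s)"
    proof (rule ram_outputs_mono)
      have "B ?S \<le> B (?S + ?F)" unfolding B_def by (intro add_left_mono bit_bound_mono) simp
      moreover have "poly p (rhs_size d ?S) \<le> poly p (rhs_size d (?S + ?F))"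
        by (intro poly_nat_mono rhs_size_mono) simp
      moreover have "?n \<le> ?S" by (simp add: input_size_def)
      ultimately have "K * tm s \<le> T (?S + ?F)"
        unfolding T_def by (intro mult_left_mono order_trans[OF s(5) time_bound_mono]) auto
      then show "K * tm s \<le> poly p' (?S + ?F)" using p' order_trans by blast
    qed (rule q')
    then show "\<exists>ys. ram_outputs M' (moco_input I) (poly p' (?S + ?F)) (poly q' ?S) (concat (map vec_code ys)) \<and>
      distinct ys \<and> set ys = pareto_front I"
      using s by metis
  qed
qed

end
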